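(* Let $p\in[2,3)$, let $\mathbf X=(X,\mathbb X)$ be a level-2 rough path on $[0,T]$ over $\mathbb{R}^d$ with finite $p$-variation (no one-sided continuity is assumed), $F\in C_b^3(\mathbb{R}^e,\mathcal L(\mathbb{R}^d,\mathbb{R}^e))$ and $y_0\in\mathbb{R}^e$. Then there exists a unique solution $Y\in V^p([0,T],\mathbb{R}^e)$ of $$Y_t=\int_0^tF(Y_s)^\ell\,d\mathbf X_s+y_0.$$
   Context: $C_b^3$: three times continuously differentiable, bounded with derivatives up to order $3$. $X_{s,t}=X_t-X_s$; $\|X\|_{p,[0,T]}=(\sup_{\mathcal P}\sum_{[s,t]\in\mathcal P}|X_{s,t}|^p)^{1/p}$ for paths and analogously with $\Xi_{s,t}$ for functions of $s\le t$; $V^p$ is the space of paths of finite $p$-variation. A level-2 rough path of finite $p$-variation over $\mathbb{R}^d$ is $\mathbf X=(X,\mathbb X)$, $X:[0,T]\to\mathbb{R}^d$, $\mathbb X:\{0\le s\le t\le T\}\to\mathbb{R}^{d\times d}$, with $\mathbb X_{s,t}=\mathbb X_{s,u}+\mathbb X_{u,t}+X_{s,u}\otimes X_{u,t}$ for $s\le u\le t$ and $\|X\|_{p,[0,T]}+\|\mathbb X\|_{p/2,[0,T]}<\infty$. $Y$ is a solution if $(Y,F(Y))$ is a controlled rough path, i.e. $Y,F(Y)$ have finite $p$-variation and $R_{s,t}=Y_{s,t}-F(Y_s)X_{s,t}$ has finite $p/2$-variation, and for all $t$, $Y_t-y_0$ is the limit of $\sum_{[u,v]\in\mathcal P}\big(F(Y_u)X_{u,v}+DF(Y_u)F(Y_u)\mathbb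 X_{u,v}\big)$ over partitions of $[0,t]$ in the refinement (RRS) sense: for every $\varepsilon>0$ there is a partition $\mathcal P_\varepsilon$ such that the sum over any refinement of $\mathcal P_\varepsilon$ is within $\varepsilon$ of the limit. *)

theory Defs
  imports "HOL-Analysis.Analysis"
begin

text \<open>
  A partition of \<open>[a, b]\<close> is represented by its finite set of points, so that refinement is
  inclusion.  For \<open>a = b\<close> the only partition is \<open>{a}\<close>, which has no intervals.
\<close>

definition partition_points :: "real \<Rightarrow> real \<Rightarrow> real set \<Rightarrow> bool" where
  "partition_points a b P \<longleftrightarrow> finite P \<and> P \<subseteq> {a..b} \<and> a \<in> P \<and> b \<in> P"

definition partition_intervals :: "real set \<Rightarrow> (real \<times> real) set" where
  "partition_intervals P = {(u, v). u \<in> P \<and> v \<in> P \<and> u < v \<and> P \<inter> {u<..<v} = {}}"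

definition partition_sum ::
  "(real \<Rightarrow> real \<Rightarrow> 'a) \<Rightarrow> real set \<Rightarrow> 'a::comm_monoid_add" where
  "partition_sum \<Xi> P = (\<Sum>(u, v)\<in>partition_intervals P. \<Xi> u v)"

text \<open>
  Finiteness of the \<open>p\<close>-variation norm, i.e. of the supremum of the \<open>p\<close>-th power sums; only the
  values \<open>\<Xi> s t\<close> with \<open>0 \<le> s < t \<le> T\<close> matter.
\<close>

definition finite_variation2 ::
  "real \<Rightarrow> real \<Rightarrow> (real \<Rightarrow> real \<Rightarrow> 'a::real_normed_vector) \<Rightarrow> bool" where
  "finite_variation2 p T \<Xi> \<longleftrightarrow>
     bdd_above {partition_sum (\<lambda>s t. norm (\<Xi> s t) powr p) P | P. partition_points 0 T P}"

definition incr :: "(real \<Rightarrow> 'a::real_normed_vector) \<Rightarrow> real \<Rightarrow> real \<Rightarrow> 'a" where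
  "incr X s t = X t - X s"

definition Vp :: "real \<Rightarrow> real \<Rightarrow> (real \<Rightarrow> 'a::real_normed_vector) set" where
  "Vp p T = {X. finite_variation2 p T (incr X)}"

definition tensor :: "real ^ 'd \<Rightarrow> real ^ 'd \<Rightarrow> real ^ 'd ^ 'd" where
  "tensor x y = (\<chi> i j. x $ i * y $ j)"

definition rough_path ::
  "real \<Rightarrow> real \<Rightarrow> (real \<Rightarrow> real ^ 'd::finite) \<Rightarrow> (real \<Rightarrow> real \<Rightarrow> real ^ 'd ^ 'd) \<Rightarrow> bool" where
  "rough_path p T X XX \<longleftrightarrow>
     (\<forall>s u t. 0 \<le> s \<and> s \<le> u \<and> u \<le> t \<and> t \<le> T \<longrightarrow>
        XX s t = XX s u + XX u t + tensor (incr X s u) (incr X u t)) \<and>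
     X \<in> Vp p T \<and> finite_variation2 (p / 2) T XX"

definition Cb3 :: "('a::real_normed_vector \<Rightarrow> 'b::real_normed_vector) \<Rightarrow> bool" where
  "Cb3 F \<longleftrightarrow>
     (\<exists>(F1 :: 'a \<Rightarrow> ('a \<Rightarrow>\<^sub>L 'b))
        (F2 :: 'a \<Rightarrow> ('a \<Rightarrow>\<^sub>L ('a \<Rightarrow>\<^sub>L 'b)))
        (F3 :: 'a \<Rightarrow> ('a \<Rightarrow>\<^sub>L ('a \<Rightarrow>\<^sub>L ('a \<Rightarrow>\<^sub>L 'b)))).
        (\<forall>y. (F has_derivative blinfun_apply (F1 y)) (at y)) \<and>
        (\<forall>y. (F1 has_derivative blinfun_apply (F2 y)) (at y)) \<and>
        (\<forall>y. (F2 has_derivative blinfun_apply (F3 y)) (at y)) \<and>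
        continuous_on UNIV F3 \<and>
        bounded (range F) \<and> bounded (range F1) \<and> bounded (range F2) \<and> bounded (range F3))"

text \<open>
  \<open>DFF F y A\<close> is \<open>DF(y)F(y)A\<close>: the bilinear map \<open>(x, x') \<mapsto> (DF(y)(F(y) x)) x'\<close>, extended
  linearly to matrices.  The first tensor factor of \<open>A\<close> is thus fed to \<open>F(y)\<close>, as Chen's relation
  in \<open>rough_path\<close> requires.
\<close>

definition DFF ::
  "(real ^ 'e::finite \<Rightarrow> ((real ^ 'd::finite) \<Rightarrow>\<^sub>L (real ^ 'e))) \<Rightarrow> real ^ 'e \<Rightarrow> real ^ 'd ^ 'd \<Rightarrow> real ^ 'e" where
  "DFF F y A =
     (\<Sum>i\<in>UNIV. \<Sum>j\<in>UNIV. A $ i $ j *\<^sub>R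
        blinfun_apply (frechet_derivative F (at y) (blinfun_apply (F y) (axis i 1))) (axis j 1))"

definition controlled ::
  "real \<Rightarrow> real \<Rightarrow> (real \<Rightarrow> real ^ 'd::finite) \<Rightarrow> (real \<Rightarrow> real ^ 'e::finite) \<Rightarrow>
   (real \<Rightarrow> ((real ^ 'd) \<Rightarrow>\<^sub>L (real ^ 'e))) \<Rightarrow> bool" where
  "controlled p T X Y Y' \<longleftrightarrow>
     Y \<in> Vp p T \<and> Y' \<in> Vp p T \<and>
     finite_variation2 (p / 2) T (\<lambda>s t. incr Y s t - blinfun_apply (Y' s) (incr X s t))"

definition RRS_limit ::
  "real \<Rightarrow> real \<Rightarrow> (real \<Rightarrow> real \<Rightarrow> 'a::real_normed_vector) \<Rightarrow> 'a \<Rightarrow> bool" where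
  "RRS_limit a b \<Xi> I \<longleftrightarrow>
     (\<forall>\<epsilon>>0. \<exists>P. partition_points a b P \<and>
        (\<forall>Q. partition_points a b Q \<and> P \<subseteq> Q \<longrightarrow> norm (partition_sum \<Xi> Q - I) < \<epsilon>))"

definition rde_solution ::
  "real \<Rightarrow> real \<Rightarrow> (real \<Rightarrow> real ^ 'd::finite) \<Rightarrow> (real \<Rightarrow> real \<Rightarrow> real ^ 'd ^ 'd) \<Rightarrow>
   (real ^ 'e::finite \<Rightarrow> ((real ^ 'd) \<Rightarrow>\<^sub>L (real ^ 'e))) \<Rightarrow> real ^ 'e \<Rightarrow> (real \<Rightarrow> real ^ 'e) \<Rightarrow> bool" where
  "rde_solution p T X XX F y0 Y \<longleftrightarrow>
     controlled p T X Y (\<lambda>t. F (Y t)) \<and>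
     (\<forall>t\<in>{0..T}. RRS_limit 0 t
        (\<lambda>u v. blinfun_apply (F (Y u)) (incr X u v) + DFF F (Y u) (XX u v)) (Y t - y0))"

end

theory Submission
  imports Defs
begin

text \<open>
  The idea is to solve the equation by composing steps of the second-order Euler scheme
  \<open>\<phi>\<^bsub>s,t\<^esub>(a) = a + F(a) X\<^bsub>s,t\<^esub> + DF(a)F(a) XX\<^bsub>s,t\<^esub>\<close> along finite partitions.  Chen's relation says
  exactly that two consecutive steps agree with a single step up to terms of third order, and with a
  control \<open>\<omega>\<close> that dominates the variation of \<open>X\<close> and \<open>XX\<close> this defect is at most
  \<open>K min(\<omega>(s,u), \<omega>(u,t))\<^sup>\<eta> \<omega>(s,t)\<close> with \<open>\<eta> = 3/p - 1 > 0\<close> (\<open>euler_almost_flow\<close>).  The rest of the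
  argument only uses this and three Lipschitz-type bounds, collected in the locale \<open>almost_flow\<close>.

  By repeated halving of the control, compositions along arbitrary partitions stay within
  \<open>C \<omega>(s,t)\<^bsup>1+\<eta>\<^esup>\<close> of a single step and are Lipschitz, uniformly in the partition
  (\<open>approx_error\<close>, \<open>approx_lipschitz\<close>).  For a continuous control this would give convergence as
  the mesh tends to zero.  Here \<open>X\<close> may jump on either side of a point, so \<open>\<omega>(u,v)\<close> need not
  become small.  What does become small is \<open>\<omega>\<close> on the part of \<open>[u,v]\<close> that stays away from one
  of the endpoints: superadditivity forces \<open>\<omega>(q,v)\<close> to vanish as \<open>u < q \<le> v\<close> and \<open>v\<close> decreases to
  \<open>u\<close>, and symmetrically on the left (\<open>ex_one_sided_fine\<close>).  Since the defect carries the
  minimum of the controls of the two sides, this suffices: a partition can be chosen so that each of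
  its intervals contributes an error of at most \<open>C \<epsilon>\<^sup>\<eta> \<omega>(u,v)\<close> (\<open>approx_error_one_sided\<close>), and these
  errors sum to at most \<open>C \<epsilon>\<^sup>\<eta> \<omega>(0,T)\<close>.  Hence the compositions converge under refinement, and
  their limit \<open>Y\<close> satisfies \<open>|Y\<^bsub>t\<^esub> - \<phi>\<^bsub>s,t\<^esub>(Y\<^bsub>s\<^esub>)| \<le> C \<omega>(s,t)\<^bsup>1+\<eta>\<^esup>\<close>, which yields the variation bounds,
  as well as the small bound on the intervals of fine partitions, which yields the RRS limit.

  For uniqueness, two paths that both satisfy the small bound coincide, because both are shadowed by
  the same composition (\<open>almost_orbits_agree\<close>).  That every solution satisfies it is another
  instance of sewing: translations \<open>y \<mapsto> y + \<Xi>\<^bsub>s,t\<^esub>\<close> form an almost flow whose compositions are the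
  partition sums of \<open>\<Xi>\<close> (\<open>RRS_limit_close\<close>, \<open>solution_follows_euler\<close>).
\<close>


section \<open>Partitions and compositions along partitions\<close>

text \<open>
  Estimates along a finite set of points often run from right to left: a statement about \<open>s\<close> is
  deduced from the same statement about the next point \<open>u\<close> of \<open>P\<close> after \<open>s\<close>.
\<close>

lemma next_point_induct [consumes 1, case_names base step]:
  fixes P :: "real set"
  assumes fin: "finite P"
    and base: "\<And>s. P \<inter> {s<..<t} = {} \<Longrightarrow> R s"
    and step: "\<And>s u. \<lbrakk>s < u; u < t; u \<in> P; P \<inter> {s<..<u} = {}; R u\<rbrakk> \<Longrightarrow> R s"
  shows "R s"
proof (induction "card (P \<inter> {s<..<t})" arbitrary: s rule: less_induct)
  case less
  show ?case
  proof (cases "P \<inter> {s<..<t} = {}")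
    case True
    then show ?thesis by (rule base)
  next
    case False
    define u where "u = Min (P \<inter> {s<..<t})"
    have u: "u \<in> P" "s < u" "u < t"
      using Min_in[of "P \<inter> {s<..<t}"] fin False unfolding u_def by auto
    have gap: "P \<inter> {s<..<u} = {}"
      using Min_le[of "P \<inter> {s<..<t}"] fin u unfolding u_def by fastforce
    have "P \<inter> {u<..<t} \<subset> P \<inter> {s<..<t}" using u by auto
    then have "card (P \<inter> {u<..<t}) < card (P \<inter> {s<..<t})"
      using fin by (intro psubset_card_mono) auto
    then have "R u" by (rule less)
    with u gap show ?thesis by (intro step[of s u]) auto
  qed
qed

lemma peel_off_first_point:
  fixes P :: "real set"
  assumes "s \<in> P" "s < u" "u \<le> b" "P \<inter> {s<..<u} = {}"
  shows "P \<inter> {s..b} = insert s (P \<inter> {u..b})"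
proof -
  have "u \<le> x" if "x \<in> P" "s \<le> x" "x \<noteq> s" for x
    using assms(4) that by (metis IntI empty_iff greaterThanLessThan_iff not_less order_le_less)
  then show ?thesis using assms by auto
qed

lemma finite_partition_intervals: "finite P \<Longrightarrow> finite (partition_intervals P)"
  by (rule finite_subset[of _ "P \<times> P"]) (auto simp: partition_intervals_def)

lemma partition_sum_Cons:
  assumes "a < u" "partition_points u b Q"
  shows "partition_sum \<Xi> (insert a Q) = \<Xi> a u + partition_sum \<Xi> Q"
proof -
  have Q: "finite Q" "u \<in> Q" "\<And>x. x \<in> Q \<Longrightarrow> u \<le> x"
    using assms(2) by (auto simp: partition_points_def)
  have "partition_intervals (insert a Q) = insert (a, u) (partition_intervals Q)"
  proof (intro equalityI subsetI)
    fix x assume "x \<in> partition_intervals (insert a Q)"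
    then obtain s t where x: "x = (s, t)" "s \<in> insert a Q" "t \<in> insert a Q" "s < t"
      and gap: "insert a Q \<inter> {s<..<t} = {}"
      by (auto simp: partition_intervals_def)
    have t: "t \<in> Q" using x Q assms(1) by force
    show "x \<in> insert (a, u) (partition_intervals Q)"
    proof (cases "s = a")
      case True
      then have "\<not> u < t" using gap Q(2) assms(1) by auto
      then show ?thesis using Q(3)[OF t] True x by simp
    next
      case False
      then show ?thesis using x t gap by (auto simp: partition_intervals_def)
    qed
  next
    fix x assume "x \<in> insert (a, u) (partition_intervals Q)"
    then consider "x = (a, u)"
      | s t where "x = (s, t)" "s \<in> Q" "t \<in> Q" "s < t" "Q \<inter> {s<..<t} = {}"
      by (auto simp: partition_intervals_def)
    then show "x \<in> partition_intervals (insert a Q)"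
    proof cases
      case 1
      then show ?thesis using Q assms(1) by (force simp: partition_intervals_def)
    next
      case 2
      then show ?thesis using Q(3)[of s] assms(1) by (auto simp: partition_intervals_def)
    qed
  qed
  moreover have "(a, u) \<notin> partition_intervals Q"
    using Q assms(1) by (force simp: partition_intervals_def)
  ultimately show ?thesis
    using finite_partition_intervals[OF Q(1)] by (simp add: partition_sum_def)
qed

lemma partition_sum_singleton [simp]: "partition_sum \<Xi> {a} = 0"
proof -
  have "partition_intervals {a} = {}" by (auto simp: partition_intervals_def)
  then show ?thesis by (simp add: partition_sum_def)
qed

lemma partition_points_Cons:
  "\<lbrakk>a < u; partition_points u b Q\<rbrakk> \<Longrightarrow> partition_points a b (insert a Q)"
  by (force simp: partition_points_def)

lemma partition_points_singleton [simp]: "partition_points a a {a}"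
  by (auto simp: partition_points_def)

lemma partition_points_induct [consumes 1, case_names singleton Cons]:
  assumes "partition_points a b P"
    and single: "R b {b}"
    and Cons: "\<And>a u Q. \<lbrakk>a < u; partition_points u b Q; R u Q\<rbrakk> \<Longrightarrow> R a (insert a Q)"
  shows "R a P"
proof -
  from assms(1) have P: "finite P" "P \<subseteq> {a..b}" "a \<in> P" "b \<in> P"
    by (auto simp: partition_points_def)
  have "s \<in> P \<longrightarrow> R s (P \<inter> {s..b})" for s
    using P(1)
  proof (induction s rule: next_point_induct[where t = b])
    case (base s)
    show ?case
    proof
      assume s: "s \<in> P"
      show "R s (P \<inter> {s..b})"
      proof (cases "s = b")
        case True
        with s show ?thesis using single by simp
      next
        case False
        with s P have "s < b" by force
        moreover have "P \<inter> {s..b} = insert s {b}"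
          using peel_off_first_point[of s P b b] base s P(4) \<open>s < b\<close> by auto
        ultimately show ?thesis using Cons[of s b "{b}"] single by simp
      qed
    qed
  next
    case (step s u)
    show ?case
    proof
      assume s: "s \<in> P"
      have "P \<inter> {s..b} = insert s (P \<inter> {u..b})"
        using peel_off_first_point[of s P u b] step(1-4) s by auto
      moreover have "partition_points u b (P \<inter> {u..b})"
        using P step by (auto simp: partition_points_def)
      ultimately show "R s (P \<inter> {s..b})" using Cons step by simp
    qed
  qed
  moreover have "P \<inter> {a..b} = P" using P by auto
  ultimately show ?thesis using P(3) by metis
qed

lemma partition_points_le: "partition_points a b P \<Longrightarrow> a \<le> b"
  by (auto simp: partition_points_def)

lemma partition_append:
  fixes \<Xi> :: "real \<Rightarrow> real \<Rightarrow> 'a::comm_monoid_add"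
  assumes "partition_points a u P" "partition_points u b Q"
  shows "partition_points a b (P \<union> Q)"
    and "partition_sum \<Xi> (P \<union> Q) = partition_sum \<Xi> P + partition_sum \<Xi> Q"
proof -
  have "partition_points a b (P \<union> Q) \<and>
      partition_sum \<Xi> (P \<union> Q) = partition_sum \<Xi> P + partition_sum \<Xi> Q"
    using assms(1)
  proof (induction rule: partition_points_induct)
    case singleton
    have "u \<in> Q" using assms(2) by (auto simp: partition_points_def)
    then show ?case using assms(2) by (simp add: insert_absorb)
  next
    case (Cons a v P)
    then show ?case
      using partition_points_Cons[of a v b "P \<union> Q"] partition_sum_Cons[of a v b "P \<union> Q" \<Xi>]
        partition_sum_Cons[of a v u P \<Xi>] by (simp add: add.assoc)
  qed
  then show "partition_points a b (P \<union> Q)"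
    "partition_sum \<Xi> (P \<union> Q) = partition_sum \<Xi> P + partition_sum \<Xi> Q" by auto
qed

lemma partition_sum_telescope:
  fixes Y :: "real \<Rightarrow> 'a::ab_group_add"
  assumes "partition_points a b P"
  shows "partition_sum (\<lambda>u v. Y v - Y u) P = Y b - Y a"
  using assms by (induction rule: partition_points_induct) (simp_all add: partition_sum_Cons)

lemma partition_sum_diff:
  fixes \<Xi> :: "real \<Rightarrow> real \<Rightarrow> 'a::ab_group_add"
  shows "partition_sum \<Xi> P - partition_sum \<Psi> P = partition_sum (\<lambda>u v. \<Xi> u v - \<Psi> u v) P"
  by (simp add: partition_sum_def sum_subtractf split_def)

lemma partition_intervals_bounds:
  assumes "partition_points a b P" "(u, v) \<in> partition_intervals P"
  shows "a \<le> u" "u < v" "v \<le> b" "P \<inter> {u<..<v} = {}"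
  using assms by (auto simp: partition_intervals_def partition_points_def)

lemma partition_sum_mono:
  fixes f g :: "real \<Rightarrow> real \<Rightarrow> real"
  assumes "partition_points a b P"
    and "\<And>u v. \<lbrakk>a \<le> u; u < v; v \<le> b; P \<inter> {u<..<v} = {}\<rbrakk> \<Longrightarrow> f u v \<le> g u v"
  shows "partition_sum f P \<le> partition_sum g P"
  unfolding partition_sum_def
  using assms(2) by (intro sum_mono) (auto dest: partition_intervals_bounds[OF assms(1)])

lemma partition_sum_cmult:
  fixes f :: "real \<Rightarrow> real \<Rightarrow> real"
  shows "partition_sum (\<lambda>u v. c * f u v) P = c * partition_sum f P"
  by (simp add: partition_sum_def sum_distrib_left split_def)

lemma norm_partition_sum_le:
  "norm (partition_sum \<Xi> P) \<le> partition_sum (\<lambda>u v. norm (\<Xi> u v)) P"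
  unfolding partition_sum_def split_def by (rule norm_sum)

text \<open>
  Only the points of \<open>P\<close> strictly between \<open>s\<close> and \<open>t\<close> matter, so a single set \<open>P\<close> serves all
  subintervals at once, whether or not their endpoints belong to \<open>P\<close>.  For an infinite \<open>P\<close>, or when
  no point lies in between, the value is the single step \<open>\<phi> s t\<close>.
\<close>

function compose_along :: "(real \<Rightarrow> real \<Rightarrow> 'a \<Rightarrow> 'a) \<Rightarrow> real set \<Rightarrow> real \<Rightarrow> real \<Rightarrow> 'a \<Rightarrow> 'a" where
  "compose_along \<phi> P s t a =
     (if finite P \<and> P \<inter> {s<..<t} \<noteq> {}
      then (let u = Min (P \<inter> {s<..<t}) in compose_along \<phi> P u t (\<phi> s u a))
      else \<phi> s t a)"
  by auto
termination
proof (relation "Wellfounded.measure (\<lambda>(\<phi>, P, s, t, a). card (P \<inter> {s<..<t}))", goal_cases)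
  case (2 \<phi> P s t a u)
  have "u \<in> P \<inter> {s<..<t}" using Min_in[of "P \<inter> {s<..<t}"] 2 by auto
  then have "P \<inter> {u<..<t} \<subset> P \<inter> {s<..<t}" by auto
  then show ?case using 2 by (auto intro!: psubset_card_mono)
qed simp

declare compose_along.simps [simp del]

lemma compose_along_gap: "P \<inter> {s<..<t} = {} \<Longrightarrow> compose_along \<phi> P s t a = \<phi> s t a"
  by (simp add: compose_along.simps)

lemma compose_along_step:
  assumes "finite P" "s < u" "u < t" "u \<in> P" "P \<inter> {s<..<u} = {}"
  shows "compose_along \<phi> P s t a = compose_along \<phi> P u t (\<phi> s u a)"
proof -
  have "Min (P \<inter> {s<..<t}) = u"
    using assms by (intro Min_eqI) (auto simp: disjoint_iff not_less)
  moreover have "P \<inter> {s<..<t} \<noteq> {}" using assms by auto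
  ultimately show ?thesis
    using assms(1) by (subst compose_along.simps) simp
qed

lemma compose_along_split:
  assumes fin: "finite P" and "s < v" "v < t" "v \<in> P"
  shows "compose_along \<phi> P s t a = compose_along \<phi> P v t (compose_along \<phi> P s v a)"
proof -
  have "s < v \<longrightarrow> (\<forall>a. compose_along \<phi> P s t a = compose_along \<phi> P v t (compose_along \<phi> P s v a))"
    using fin
  proof (induction s rule: next_point_induct[where t = v])
    case (base s)
    then show ?case
      using assms by (auto simp: compose_along_gap compose_along_step[of P s v])
  next
    case (step s u)
    then show ?case
      using assms by (auto simp: compose_along_step[of P s u])
  qed
  then show ?thesis using assms by blast
qed

text \<open>
  This identity lets one sewing argument cover both nonlinear flows and sums over partitions.
  The hypothesis on the diagonal accounts for \<open>a = b\<close>, where the sum is empty but the composition is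
  the step \<open>\<Xi> b b\<close>.
\<close>

lemma compose_along_translation:
  fixes \<Xi> :: "real \<Rightarrow> real \<Rightarrow> 'a::ab_group_add"
  assumes P: "partition_points a b P" and z: "\<Xi> b b = 0"
  shows "compose_along (\<lambda>u v y. y + \<Xi> u v) P a b y = y + partition_sum \<Xi> P"
proof -
  let ?c = "\<lambda>s y. compose_along (\<lambda>u v y. y + \<Xi> u v) P s b y"
  have fin: "finite P" and b: "b \<in> P" "P \<subseteq> {a..b}" and a: "a \<in> P"
    using P by (auto simp: partition_points_def)
  have "s \<in> P \<longrightarrow> (\<forall>y. ?c s y = y + partition_sum \<Xi> (P \<inter> {s..b}))" for s
    using fin
  proof (induction s rule: next_point_induct[where t = b])
    case (base s)
    show ?case
    proof (intro impI allI)
      fix y assume s: "s \<in> P"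
      show "?c s y = y + partition_sum \<Xi> (P \<inter> {s..b})"
      proof (cases "s = b")
        case True
        with b z show ?thesis by (simp add: compose_along_gap)
      next
        case False
        with s b have "s < b" by force
        moreover have "P \<inter> {s..b} = insert s {b}"
          using peel_off_first_point[of s P b b] base s b \<open>s < b\<close> by auto
        ultimately show ?thesis using base
          by (simp add: compose_along_gap partition_sum_Cons[where b = b])
      qed
    qed
  next
    case (step s u)
    show ?case
    proof (intro impI allI)
      fix y assume s: "s \<in> P"
      have "P \<inter> {s..b} = insert s (P \<inter> {u..b})"
        using peel_off_first_point[of s P u b] step(1-4) s by auto
      moreover have "partition_points u b (P \<inter> {u..b})"
        using fin b step by (auto simp: partition_points_def)
      ultimately show "?c s y = y + partition_sum \<Xi> (P \<inter> {s..b})"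
        using step fin by (simp add: compose_along_step[of P s u] partition_sum_Cons add.assoc)
    qed
  qed
  moreover have "P \<inter> {a..b} = P" using b by auto
  ultimately show ?thesis using a by metis
qed


section \<open>Controls without continuity\<close>

locale control =
  fixes T :: real and \<omega> :: "real \<Rightarrow> real \<Rightarrow> real"
  assumes nonneg: "\<lbrakk>0 \<le> s; s \<le> t; t \<le> T\<rbrakk> \<Longrightarrow> 0 \<le> \<omega> s t"
    and superadditive: "\<lbrakk>0 \<le> s; s \<le> u; u \<le> t; t \<le> T\<rbrakk> \<Longrightarrow> \<omega> s u + \<omega> u t \<le> \<omega> s t"
begin

lemma diagonal: "\<lbrakk>0 \<le> s; s \<le> T\<rbrakk> \<Longrightarrow> \<omega> s s = 0"
  using superadditive[of s s s] nonneg[of s s] by auto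

lemma control_mono:
  assumes "0 \<le> s" "s \<le> s'" "s' \<le> t'" "t' \<le> t" "t \<le> T"
  shows "\<omega> s' t' \<le> \<omega> s t"
  using superadditive[of s s' t] superadditive[of s' t' t] nonneg[of s s'] nonneg[of t' t] assms
  by auto

lemma partition_sum_control_le:
  assumes "partition_points a b P" "0 \<le> a" "b \<le> T"
  shows "partition_sum \<omega> P \<le> \<omega> a b"
  using assms
proof (induction rule: partition_points_induct)
  case singleton
  then show ?case by (simp add: diagonal)
next
  case (Cons a u Q)
  then show ?case
    using superadditive[of a u b] partition_points_le[OF Cons(2)]
    by (simp add: partition_sum_Cons)
qed

text \<open>
  A jump at \<open>s\<close> makes \<open>\<omega> s t\<close> large however close \<open>t\<close> is, and likewise for a jump at \<open>t\<close>.  An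
  interval is acceptable if removing a neighbourhood of one of its endpoints, however small, leaves
  only a small control; at most one endpoint then carries a large jump into the interval.
\<close>

definition one_sided_small :: "real \<Rightarrow> real \<Rightarrow> real \<Rightarrow> bool" where
  "one_sided_small \<epsilon> s t \<longleftrightarrow> (\<forall>q\<in>{s<..<t}. \<omega> q t \<le> \<epsilon>) \<or> (\<forall>q\<in>{s<..<t}. \<omega> s q \<le> \<epsilon>)"

definition one_sided_fine :: "real \<Rightarrow> real set \<Rightarrow> bool" where
  "one_sided_fine \<epsilon> P \<longleftrightarrow> finite P \<and>
     (\<forall>u v. 0 \<le> u \<longrightarrow> u < v \<longrightarrow> v \<le> T \<longrightarrow> P \<inter> {u<..<v} = {} \<longrightarrow> one_sided_small \<epsilon> u v)"

lemma one_sided_fineD: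
  "\<lbrakk>one_sided_fine \<epsilon> P; 0 \<le> u; u < v; v \<le> T; P \<inter> {u<..<v} = {}\<rbrakk> \<Longrightarrow> one_sided_small \<epsilon> u v"
  by (auto simp: one_sided_fine_def)

text \<open>
  By superadditivity \<open>\<omega> q v \<le> \<omega> q T - \<omega> v T\<close>, and the decreasing function \<open>q \<mapsto> \<omega> q T\<close> is bounded, so
  close to \<open>x\<close> on the right it stays within \<open>\<epsilon>\<close> of its supremum.  The point \<open>x\<close> itself is
  excluded, so that a jump at \<open>x\<close> does not enter.
\<close>

lemma small_right_of_point:
  assumes "0 \<le> x" "x \<le> T" "0 < \<epsilon>"
  shows "\<exists>d>0. \<forall>q v. x < q \<longrightarrow> q \<le> v \<longrightarrow> v < x + d \<longrightarrow> v \<le> T \<longrightarrow> \<omega> q v \<le> \<epsilon>"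
proof (cases "x = T")
  case True
  then show ?thesis by (intro exI[of _ 1]) auto
next
  case False
  \<comment> \<open>The right limit at \<open>x\<close> of the decreasing function \<open>q \<mapsto> \<omega> q T\<close>.\<close>
  define S where "S = (SUP q\<in>{x<..T}. \<omega> q T)"
  have bdd: "bdd_above ((\<lambda>q. \<omega> q T) ` {x<..T})"
    using assms(1,2) by (intro bdd_aboveI2[of _ _ "\<omega> 0 T"]) (auto intro: control_mono)
  have ne: "{x<..T} \<noteq> {}" using False assms by auto
  obtain y where y: "y \<in> {x<..T}" "S - \<epsilon> < \<omega> y T"
    using less_cSUP_iff[OF ne bdd, of "S - \<epsilon>"] assms(3) unfolding S_def by auto
  show ?thesis
  proof (intro exI[of _ "y - x"] conjI allI impI)
    show "0 < y - x" using y by auto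
    fix q v assume qv: "x < q" "q \<le> v" "v < x + (y - x)" "v \<le> T"
    have "\<omega> q v + \<omega> v T \<le> \<omega> q T" using qv assms by (intro superadditive) auto
    moreover have "\<omega> q T \<le> S" unfolding S_def using qv by (intro cSUP_upper bdd) auto
    moreover have "\<omega> y T \<le> \<omega> v T" using qv y assms by (intro control_mono) auto
    ultimately show "\<omega> q v \<le> \<epsilon>" using y by auto
  qed
qed

lemma small_left_of_point:
  assumes "0 \<le> x" "x \<le> T" "0 < \<epsilon>"
  shows "\<exists>d>0. \<forall>u q. q < x \<longrightarrow> u \<le> q \<longrightarrow> x - d < u \<longrightarrow> 0 \<le> u \<longrightarrow> \<omega> u q \<le> \<epsilon>"
proof (cases "x = 0")
  case True
  then show ?thesis by (intro exI[of _ 1]) auto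
next
  case False
  define S where "S = (SUP q\<in>{0..<x}. \<omega> 0 q)"
  have bdd: "bdd_above ((\<lambda>q. \<omega> 0 q) ` {0..<x})"
    using assms(1,2) by (intro bdd_aboveI2[of _ _ "\<omega> 0 T"]) (auto intro: control_mono)
  have ne: "{0..<x} \<noteq> {}" using False assms by auto
  obtain y where y: "y \<in> {0..<x}" "S - \<epsilon> < \<omega> 0 y"
    using less_cSUP_iff[OF ne bdd, of "S - \<epsilon>"] assms(3) unfolding S_def by auto
  show ?thesis
  proof (intro exI[of _ "x - y"] conjI allI impI)
    show "0 < x - y" using y by auto
    fix u q assume uq: "q < x" "u \<le> q" "x - (x - y) < u" "0 \<le> u"
    have "\<omega> 0 u + \<omega> u q \<le> \<omega> 0 q" using uq assms by (intro superadditive) auto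
    moreover have "\<omega> 0 q \<le> S" unfolding S_def using uq by (intro cSUP_upper bdd) auto
    moreover have "\<omega> 0 y \<le> \<omega> 0 u" using uq y assms by (intro control_mono) auto
    ultimately show "\<omega> u q \<le> \<epsilon>" using y by auto
  qed
qed

text \<open>
  Around every point \<open>x\<close> the partition \<open>{x}\<close> works, since an interval on either side of \<open>x\<close> can
  only see the jump at its endpoint \<open>x\<close>.  Such partitions can be glued, and Bolzano's bisection
  principle makes the statement global.
\<close>

lemma ex_one_sided_fine:
  assumes "0 \<le> T" "0 < \<epsilon>"
  shows "\<exists>P. one_sided_fine \<epsilon> P"
proof -
  define R where "R a b \<longleftrightarrow> (\<exists>P. finite P \<and> (\<forall>u v. 0 \<le> u \<longrightarrow> a \<le> u \<longrightarrow> u < v \<longrightarrow> v \<le> b \<longrightarrow>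
    v \<le> T \<longrightarrow> P \<inter> {u<..<v} = {} \<longrightarrow> one_sided_small \<epsilon> u v))" for a b
  have "R 0 T"
    using assms(1)
  proof (induction rule: Bolzano)
    case (trans a b c)
    obtain P where P: "finite P" "\<And>u v. \<lbrakk>0 \<le> u; a \<le> u; u < v; v \<le> b; v \<le> T; P \<inter> {u<..<v} = {}\<rbrakk>
        \<Longrightarrow> one_sided_small \<epsilon> u v"
      using trans(1) unfolding R_def by metis
    obtain Q where Q: "finite Q" "\<And>u v. \<lbrakk>0 \<le> u; b \<le> u; u < v; v \<le> c; v \<le> T; Q \<inter> {u<..<v} = {}\<rbrakk>
        \<Longrightarrow> one_sided_small \<epsilon> u v"
      using trans(2) unfolding R_def by metis
    show ?case unfolding R_def
    proof (intro exI[of _ "insert b (P \<union> Q)"] conjI allI impI)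
      show "finite (insert b (P \<union> Q))" using P Q by simp
      fix u v assume uv: "0 \<le> u" "a \<le> u" "u < v" "v \<le> c" "v \<le> T"
        and gap: "insert b (P \<union> Q) \<inter> {u<..<v} = {}"
      then have "v \<le> b \<or> b \<le> u" by auto
      then show "one_sided_small \<epsilon> u v"
        using P(2)[of u v] Q(2)[of u v] uv gap by auto
    qed
  next
    case (local x)
    obtain d where d: "d > 0"
      "\<And>q v. \<lbrakk>x < q; q \<le> v; v < x + d; v \<le> T\<rbrakk> \<Longrightarrow> \<omega> q v \<le> \<epsilon>"
      using small_right_of_point[of x \<epsilon>] local assms by auto
    obtain d' where d': "d' > 0"
      "\<And>u q. \<lbrakk>q < x; u \<le> q; x - d' < u; 0 \<le> u\<rbrakk> \<Longrightarrow> \<omega> u q \<le> \<epsilon>"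
      using small_left_of_point[of x \<epsilon>] local assms by auto
    show ?case
    proof (intro exI[of _ "min d d'"] conjI allI impI)
      show "0 < min d d'" using d d' by simp
      fix a b assume ab: "a \<le> x \<and> x \<le> b \<and> b - a < min d d'"
      show "R a b" unfolding R_def
      proof (intro exI[of _ "{x}"] conjI allI impI)
        fix u v assume uv: "0 \<le> u" "a \<le> u" "u < v" "v \<le> b" "v \<le> T" "{x} \<inter> {u<..<v} = {}"
        then consider "x \<le> u" | "v \<le> x" by force
        then show "one_sided_small \<epsilon> u v"
        proof cases
          case 1
          then have "\<forall>q\<in>{u<..<v}. \<omega> q v \<le> \<epsilon>" using ab uv by (auto intro!: d(2))
          then show ?thesis by (simp add: one_sided_small_def)
        next
          case 2
          then have "\<forall>q\<in>{u<..<v}. \<omega> u q \<le> \<epsilon>" using ab uv by (auto intro!: d'(2))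
          then show ?thesis by (simp add: one_sided_small_def)
        qed
      qed simp
    qed
  qed
  then show ?thesis unfolding R_def one_sided_fine_def by meson
qed

text \<open>
  The interval \<open>[l, r]\<close> is where \<open>\<omega> s x\<close> first exceeds \<open>c\<close> as \<open>x\<close> runs through the points of \<open>Q\<close>
  and then \<open>t\<close>.  With \<open>c = \<omega> s t / 2\<close> both outer parts carry at most half of the control; with
  \<open>c = \<delta>\<close> the right part has lost at least \<open>\<delta>\<close>.  The interval \<open>[l, r]\<close> itself may carry any
  amount, which is what happens at a jump.
\<close>

lemma ex_crossing_interval:
  assumes "finite Q" "0 \<le> s" "s < t" "t \<le> T" "0 \<le> c" "c \<le> \<omega> s t"
  obtains l r where "s \<le> l" "l < r" "r \<le> t" "l \<in> insert s Q" "r \<in> insert t Q"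
    "Q \<inter> {l<..<r} = {}" "\<omega> s l \<le> c" "\<omega> r t \<le> \<omega> s t - c"
proof -
  define A where "A = {x \<in> insert t (Q \<inter> {s<..<t}). x = t \<or> c < \<omega> s x}"
  define r where "r = Min A"
  define l where "l = Max (insert s (Q \<inter> {s<..<r}))"
  have A: "finite A" "A \<noteq> {}" using assms(1) by (auto simp: A_def)
  have "r \<in> A" using Min_in[OF A] by (simp add: r_def)
  then have r: "r \<in> insert t Q" "s < r" "r \<le> t" "r = t \<or> c < \<omega> s r"
    using assms(3) by (auto simp: A_def)
  have "l \<in> insert s (Q \<inter> {s<..<r})" unfolding l_def using assms(1) by (intro Max_in) auto
  then have l: "l \<in> insert s Q" "s \<le> l" "l < r" using r(2) by auto
  have "x \<le> l" if "x \<in> Q" "s < x" "x < r" for x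
    unfolding l_def using assms(1) that by (intro Max_ge) auto
  then have gap: "Q \<inter> {l<..<r} = {}" using l by force
  have "\<omega> s l \<le> c"
  proof (cases "l = s")
    case True
    then show ?thesis using assms diagonal[of s] by simp
  next
    case False
    have "l \<notin> A" using Min_le[OF A(1), of l] l(3) by (auto simp: r_def)
    then show ?thesis using False l r(3) by (auto simp: A_def)
  qed
  moreover have "\<omega> r t \<le> \<omega> s t - c"
    using r(4)
  proof
    assume "r = t"
    then show ?thesis using assms diagonal[of t] by simp
  next
    assume "c < \<omega> s r"
    then show ?thesis using superadditive[of s r t] assms r by auto
  qed
  ultimately show ?thesis using that[of l r] l r gap by blast
qed

text \<open>
  The induction for cutting an interval at two points of \<open>Q\<close>: either outer part has fewer points of
  \<open>Q\<close> in its interior than the whole.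
\<close>

lemma crossing_induct [consumes 4, case_names gap cross]:
  assumes "finite Q" "0 \<le> s" "s \<le> t" "t \<le> T"
    and base: "\<And>s t. \<lbrakk>0 \<le> s; s \<le> t; t \<le> T; Q \<inter> {s<..<t} = {}\<rbrakk> \<Longrightarrow> R s t"
    and step: "\<And>s t. \<lbrakk>0 \<le> s; s < t; t \<le> T;
      \<And>l r. \<lbrakk>s \<le> l; l < r; r \<le> t; l \<in> insert s Q; r \<in> insert t Q\<rbrakk> \<Longrightarrow> R s l \<and> R r t\<rbrakk> \<Longrightarrow> R s t"
  shows "R s t"
  using assms(2-4)
proof (induction "card (Q \<inter> {s<..<t})" arbitrary: s t rule: less_induct)
  case less
  show ?case
  proof (cases "Q \<inter> {s<..<t} = {}")
    case True
    then show ?thesis using less base by blast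
  next
    case ne: False
    then have "s < t" by auto
    show ?thesis
    proof (rule step[OF \<open>0 \<le> s\<close> \<open>s < t\<close> \<open>t \<le> T\<close>], intro conjI)
      fix l r assume lr: "s \<le> l" "l < r" "r \<le> t" "l \<in> insert s Q" "r \<in> insert t Q"
      have "Q \<inter> {s<..<l} \<subset> Q \<inter> {s<..<t}"
      proof (cases "l = s")
        case True
        then show ?thesis using ne by auto
      next
        case False
        then have "l \<in> Q \<inter> {s<..<t}" using lr by auto
        then show ?thesis using lr by auto
      qed
      then show "R s l" using lr less(2-4) assms(1) by (intro less(1) psubset_card_mono) auto
      have "Q \<inter> {r<..<t} \<subset> Q \<inter> {s<..<t}"
      proof (cases "r = t")
        case True
        then show ?thesis using ne by auto
      next
        case False
        then have "r \<in> Q \<inter> {s<..<t}" using lr by auto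
        then show ?thesis using lr by auto
      qed
      then show "R r t" using lr less(2-4) assms(1) by (intro less(1) psubset_card_mono) auto
    qed
  qed
qed

end


section \<open>Sewing almost flows\<close>

lemma norm_add4_le:
  fixes x1 x2 x3 x4 :: "'a::real_normed_vector"
  assumes "norm x1 \<le> e1" "norm x2 \<le> e2" "norm x3 \<le> e3" "norm x4 \<le> e4"
  shows "norm (x1 + x2 + x3 + x4) \<le> e1 + e2 + e3 + e4"
  using assms by (intro norm_triangle_le add_mono) auto

text \<open>
  The two facts that drive everything are \<open>flow_defect\<close> and its Lipschitz version.  The minimum in
  \<open>flow_defect\<close> is stronger than the customary bound by \<open>\<omega> s t\<close> to the power \<open>1 + \<eta>\<close> and is what
  makes jumps harmless.  The last hypothesis controls second differences, as one has for maps with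
  Lipschitz derivative; it is what keeps the Lipschitz constants of long compositions under control.
\<close>

locale almost_flow = control T \<omega> for T \<omega> +
  fixes \<phi> :: "real \<Rightarrow> real \<Rightarrow> 'a::banach \<Rightarrow> 'a" and \<eta> \<alpha> L K :: real
  assumes T_nonneg: "0 \<le> T"
    and eta_pos: "0 < \<eta>" and alpha_pos: "0 < \<alpha>" and L_nonneg: "0 \<le> L" and K_nonneg: "0 \<le> K"
    and flow_diag: "\<lbrakk>0 \<le> s; s \<le> T\<rbrakk> \<Longrightarrow> \<phi> s s a = a"
    and flow_defect: "\<lbrakk>0 \<le> s; s \<le> u; u \<le> t; t \<le> T\<rbrakk> \<Longrightarrow>
      norm (\<phi> u t (\<phi> s u a) - \<phi> s t a) \<le> K * (min (\<omega> s u) (\<omega> u t) powr \<eta> * \<omega> s t)"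
    and flow_lipschitz: "\<lbrakk>0 \<le> s; s \<le> t; t \<le> T\<rbrakk> \<Longrightarrow>
      norm (\<phi> s t a - \<phi> s t b) \<le> (1 + L * \<omega> s t powr \<alpha>) * norm (a - b)"
    and flow_defect_lipschitz: "\<lbrakk>0 \<le> s; s \<le> u; u \<le> t; t \<le> T\<rbrakk> \<Longrightarrow>
      norm ((\<phi> u t (\<phi> s u a) - \<phi> s t a) - (\<phi> u t (\<phi> s u b) - \<phi> s t b))
        \<le> K * \<omega> s t powr (1 + \<eta>) * norm (a - b)"
    and flow_second_difference: "\<lbrakk>0 \<le> s; s \<le> t; t \<le> T\<rbrakk> \<Longrightarrow>
      norm ((\<phi> s t a - \<phi> s t b) - (\<phi> s t a' - \<phi> s t b'))
        \<le> (1 + L * \<omega> s t powr \<alpha>) * norm ((a - b) - (a' - b'))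
          + K * (norm (a - a') + norm (b - b')) * norm (a - b)"
begin

abbreviation approx :: "real set \<Rightarrow> real \<Rightarrow> real \<Rightarrow> 'a \<Rightarrow> 'a" where
  "approx \<equiv> compose_along \<phi>"

lemma approx_split:
  assumes "finite Q" "0 \<le> s" "s \<le> u" "u \<le> t" "t \<le> T" "u \<in> insert s (insert t Q)"
  shows "approx Q s t a = approx Q u t (approx Q s u a)"
proof -
  consider "u = s" | "u = t" | "s < u" "u < t" "u \<in> Q" using assms by force
  then show ?thesis
    by cases (use assms in \<open>auto simp: compose_along_gap flow_diag intro: compose_along_split\<close>)
qed

lemma approx_split_interval:
  assumes "finite Q" "0 \<le> s" "s \<le> l" "l < r" "r \<le> t" "t \<le> T"
    "l \<in> insert s Q" "r \<in> insert t Q" "Q \<inter> {l<..<r} = {}"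
  shows "approx Q s t a = approx Q r t (\<phi> l r (approx Q s l a))"
proof -
  have "approx Q s t a = approx Q l t (approx Q s l a)"
    using assms by (intro approx_split) auto
  also have "\<dots> = approx Q r t (approx Q l r (approx Q s l a))"
    using assms by (intro approx_split) auto
  finally show ?thesis using assms(9) by (simp add: compose_along_gap)
qed

lemma flow_defect_crude:
  assumes "0 \<le> s" "s \<le> u" "u \<le> t" "t \<le> T"
  shows "norm (\<phi> u t (\<phi> s u a) - \<phi> s t a) \<le> K * \<omega> s t powr (1 + \<eta>)"
proof -
  have "min (\<omega> s u) (\<omega> u t) powr \<eta> * \<omega> s t \<le> \<omega> s t powr \<eta> * \<omega> s t"
    using assms eta_pos control_mono[of s s u t]
    by (intro mult_right_mono powr_mono2) (auto intro!: nonneg)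
  also have "\<dots> = \<omega> s t powr (1 + \<eta>)"
    using nonneg[of s t] assms by (cases "\<omega> s t = 0") (auto simp: powr_add)
  finally show ?thesis
    using flow_defect[OF assms, of a] K_nonneg by (meson mult_left_mono order_trans)
qed

text \<open>
  The number \<open>\<Lambda>\<close> bounds the Lipschitz constants of steps and compositions at small scales.  It is
  chosen so close to \<open>1\<close> that the gain \<open>2\<close> to the power \<open>-(1 + \<eta>)\<close> from halving the control beats
  the two halves together, see \<open>halving_gain\<close>.  Then \<open>C1\<close> and \<open>C2\<close> are the fixed points of the
  recursions that halving produces for the error and for its Lipschitz constant.
\<close>

definition \<Lambda> :: real where "\<Lambda> = 2 powr (\<eta> / 3)"

definition C1 :: real where "C1 = 2 * K / (1 - 1 / \<Lambda>)"

definition C2 :: real where "C2 = (K * \<Lambda> + 2 * K * \<Lambda> * C1 + K) / (1 - 1 / \<Lambda>)"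

lemma \<Lambda>_gt_1: "1 < \<Lambda>"
  using eta_pos by (simp add: \<Lambda>_def)

lemma C1_nonneg: "0 \<le> C1"
  using K_nonneg \<Lambda>_gt_1 by (simp add: C1_def)

lemma C2_nonneg: "0 \<le> C2"
  using K_nonneg \<Lambda>_gt_1 C1_nonneg by (simp add: C2_def)

lemma C1_eq: "C1 / \<Lambda> + 2 * K = C1"
  using \<Lambda>_gt_1 unfolding C1_def by (simp add: field_simps)

lemma C2_eq: "C2 / \<Lambda> + (K * \<Lambda> + 2 * K * \<Lambda> * C1 + K) = C2"
proof -
  define m where "m = K * \<Lambda> + 2 * K * \<Lambda> * C1 + K"
  show ?thesis using \<Lambda>_gt_1 unfolding C2_def m_def[symmetric] by (simp add: field_simps)
qed

text \<open>
  The exponent \<open>\<eta> / 3\<close> in \<open>\<Lambda>\<close> is arranged for this: \<open>\<Lambda> * \<Lambda> + \<Lambda>\<close> is at most \<open>2 * \<Lambda> * \<Lambda>\<close>, whose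
  exponent of two is \<open>1 + 2 * \<eta> / 3\<close>, so a factor \<open>1 / \<Lambda>\<close> remains.
\<close>

lemma halving_gain: "2 powr (- (1 + \<eta>)) * (\<Lambda> * \<Lambda> + \<Lambda>) \<le> 1 / \<Lambda>"
proof -
  have "\<Lambda> * \<Lambda> + \<Lambda> \<le> 2 * (\<Lambda> * \<Lambda>)" using \<Lambda>_gt_1 by simp
  then have "2 powr (- (1 + \<eta>)) * (\<Lambda> * \<Lambda> + \<Lambda>) \<le> 2 powr (- (1 + \<eta>)) * (2 * (\<Lambda> * \<Lambda>))"
    by (intro mult_left_mono) auto
  also have "\<dots> = 2 powr (- (1 + \<eta>)) * (2 powr 1 * (2 powr (\<eta> / 3) * 2 powr (\<eta> / 3)))"
    by (simp add: \<Lambda>_def)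
  also have "\<dots> = 2 powr (- (\<eta> / 3))"
    by (simp only: powr_add[symmetric]) (simp add: field_simps)
  also have "\<dots> = 1 / \<Lambda>" by (simp add: \<Lambda>_def powr_minus_divide)
  finally show ?thesis .
qed

lemma half_control_powr:
  assumes "0 \<le> s" "s \<le> t" "t \<le> T" "0 \<le> w" "w \<le> \<omega> s t / 2"
  shows "w powr (1 + \<eta>) \<le> 2 powr (- (1 + \<eta>)) * \<omega> s t powr (1 + \<eta>)"
proof -
  have "w powr (1 + \<eta>) \<le> (\<omega> s t / 2) powr (1 + \<eta>)"
    using assms eta_pos by (intro powr_mono2) auto
  also have "\<dots> = 2 powr (- (1 + \<eta>)) * \<omega> s t powr (1 + \<eta>)"
    using nonneg[of s t] assms powr_minus_divide[of 2 "1 + \<eta>"] by (simp add: powr_divide)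
  finally show ?thesis .
qed

definition small_threshold :: "real \<Rightarrow> bool" where
  "small_threshold \<delta> \<longleftrightarrow> 0 < \<delta> \<and> 1 + L * \<delta> powr \<alpha> + C2 * \<delta> powr (1 + \<eta>) \<le> \<Lambda>"

lemma ex_small_threshold: "\<exists>\<delta>. small_threshold \<delta>"
proof -
  have "((\<lambda>\<delta>. 1 + L * \<delta> powr \<alpha> + C2 * \<delta> powr (1 + \<eta>)) \<longlongrightarrow>
      1 + L * 0 powr \<alpha> + C2 * 0 powr (1 + \<eta>)) (at_right 0)"
    using alpha_pos eta_pos
    by (intro tendsto_intros tendsto_powr2) (auto simp: eventually_at_filter)
  then have "((\<lambda>\<delta>. 1 + L * \<delta> powr \<alpha> + C2 * \<delta> powr (1 + \<eta>)) \<longlongrightarrow> 1) (at_right 0)"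
    using alpha_pos eta_pos by simp
  then have "\<forall>\<^sub>F \<delta> in at_right 0. 1 + L * \<delta> powr \<alpha> + C2 * \<delta> powr (1 + \<eta>) < \<Lambda>"
    using \<Lambda>_gt_1 by (rule order_tendstoD)
  moreover have "\<forall>\<^sub>F \<delta> in at_right (0::real). 0 < \<delta>"
    by (simp add: eventually_at_filter)
  ultimately have "\<forall>\<^sub>F \<delta> in at_right 0. small_threshold \<delta>"
    by eventually_elim (auto simp: small_threshold_def)
  then show ?thesis by (metis eventually_happens trivial_limit_at_right_real)
qed

lemma lipschitz_factor_small:
  assumes "small_threshold \<delta>" "0 \<le> w" "w \<le> \<delta>"
  shows "1 + L * w powr \<alpha> + C2 * w powr (1 + \<eta>) \<le> \<Lambda>" and "1 + L * w powr \<alpha> \<le> \<Lambda>"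
proof -
  have "L * w powr \<alpha> \<le> L * \<delta> powr \<alpha>" "C2 * w powr (1 + \<eta>) \<le> C2 * \<delta> powr (1 + \<eta>)"
    using assms L_nonneg C2_nonneg alpha_pos eta_pos by (auto intro!: mult_left_mono powr_mono2)
  then show *: "1 + L * w powr \<alpha> + C2 * w powr (1 + \<eta>) \<le> \<Lambda>"
    using assms(1) by (auto simp: small_threshold_def)
  moreover have "0 \<le> C2 * w powr (1 + \<eta>)" using C2_nonneg by simp
  ultimately show "1 + L * w powr \<alpha> \<le> \<Lambda>" by linarith
qed

lemma flow_lipschitz_small:
  assumes "small_threshold \<delta>" "0 \<le> s" "s \<le> t" "t \<le> T" "\<omega> s t \<le> \<delta>"
  shows "norm (\<phi> s t a - \<phi> s t b) \<le> \<Lambda> * norm (a - b)"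
  using flow_lipschitz[of s t a b] lipschitz_factor_small(2)[OF assms(1), of "\<omega> s t"]
    nonneg[of s t] assms
  by (meson mult_right_mono norm_ge_zero order_trans)

text \<open>
  Davie's argument.  Cut the composition at the crossing interval \<open>[l, r]\<close> for half of the control.
  Replacing the compositions over \<open>[s, l]\<close> and \<open>[r, t]\<close> by single steps costs, by induction, a
  fraction \<open>1 / \<Lambda>\<close> of the claimed bound, and merging the three resulting steps costs two defects.
\<close>

lemma approx_error_small:
  assumes \<delta>: "small_threshold \<delta>" and Q: "finite Q" and "0 \<le> s" "s \<le> t" "t \<le> T" "\<omega> s t \<le> \<delta>"
  shows "norm (approx Q s t a - \<phi> s t a) \<le> C1 * \<omega> s t powr (1 + \<eta>)"
proof -
  have "\<omega> s t \<le> \<delta> \<longrightarrow> (\<forall>a. norm (approx Q s t a - \<phi> s t a) \<le> C1 * \<omega> s t powr (1 + \<eta>))"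
    using Q assms(3-5)
  proof (induction rule: crossing_induct)
    case (gap s t)
    then show ?case using C1_nonneg by (simp add: compose_along_gap)
  next
    case (cross s t)
    show ?case
    proof (intro impI allI)
      fix a assume small: "\<omega> s t \<le> \<delta>"
      define W where "W = \<omega> s t powr (1 + \<eta>)"
      define h where "h = 2 powr (- (1 + \<eta>))"
      have W: "0 \<le> W" by (simp add: W_def)
      obtain l r where lr: "s \<le> l" "l < r" "r \<le> t" "l \<in> insert s Q" "r \<in> insert t Q"
          "Q \<inter> {l<..<r} = {}" and half: "\<omega> s l \<le> \<omega> s t / 2" "\<omega> r t \<le> \<omega> s t - \<omega> s t / 2"
        using ex_crossing_interval[OF Q cross(1-3), of "\<omega> s t / 2"] nonneg[of s t] cross(1-3)
        by auto
      have sub: "\<omega> s l \<le> \<delta>" "\<omega> r t \<le> \<delta>" "\<omega> l t \<le> \<delta>"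
        using small control_mono[of s s l t] control_mono[of s r t t] control_mono[of s l t t]
          cross(1-3) lr by auto
      define w where "w = approx Q s l a"
      define z where "z = \<phi> l r w"
      have "norm (approx Q r t z - \<phi> r t z) \<le> C1 * \<omega> r t powr (1 + \<eta>)"
        using cross(4)[of l r] lr sub by auto
      also have "\<dots> \<le> C1 * (h * W)" unfolding h_def W_def
        using half cross(1-3) lr C1_nonneg nonneg[of r t]
        by (intro mult_left_mono half_control_powr) auto
      finally have 1: "norm (approx Q r t z - \<phi> r t z) \<le> C1 * (h * W)" .
      have mono: "\<omega> l t powr (1 + \<eta>) \<le> W"
        unfolding W_def using cross(1-3) lr eta_pos
        by (intro powr_mono2 control_mono nonneg) auto
      have 2: "norm (\<phi> r t z - \<phi> l t w) \<le> K * W"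
        using flow_defect_crude[of l r t w] mono cross(1-3) lr K_nonneg unfolding z_def
        by (meson dual_order.trans less_imp_le mult_left_mono)
      have "norm (w - \<phi> s l a) \<le> C1 * \<omega> s l powr (1 + \<eta>)"
        using cross(4)[of l r] lr sub unfolding w_def by auto
      also have "\<dots> \<le> C1 * (h * W)" unfolding h_def W_def
        using half cross(1-3) lr C1_nonneg nonneg[of s l]
        by (intro mult_left_mono half_control_powr) auto
      finally have w: "norm (w - \<phi> s l a) \<le> C1 * (h * W)" .
      have "norm (\<phi> l t w - \<phi> l t (\<phi> s l a)) \<le> \<Lambda> * norm (w - \<phi> s l a)"
        using flow_lipschitz_small[OF \<delta>, of l t] cross(1-3) lr sub by auto
      also have "\<dots> \<le> \<Lambda> * (C1 * (h * W))" using w \<Lambda>_gt_1 by simp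
      finally have 3: "norm (\<phi> l t w - \<phi> l t (\<phi> s l a)) \<le> \<Lambda> * (C1 * (h * W))" .
      have 4: "norm (\<phi> l t (\<phi> s l a) - \<phi> s t a) \<le> K * W"
        using flow_defect_crude[of s l t a] cross(1-3) lr unfolding W_def by auto
      have eq: "approx Q s t a - \<phi> s t a = (approx Q r t z - \<phi> r t z) + (\<phi> r t z - \<phi> l t w)
          + (\<phi> l t w - \<phi> l t (\<phi> s l a)) + (\<phi> l t (\<phi> s l a) - \<phi> s t a)"
        using approx_split_interval[OF Q, of s l r t a] cross(1-3) lr by (simp add: w_def z_def)
      have "norm (approx Q s t a - \<phi> s t a) \<le>
          C1 * (h * W) + K * W + \<Lambda> * (C1 * (h * W)) + K * W"
        unfolding eq by (intro norm_add4_le 1 2 3 4)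
      also have "\<dots> = (C1 * (h * (1 + \<Lambda>)) + 2 * K) * W" by (simp add: algebra_simps)
      also have "\<dots> \<le> (C1 * (h * (\<Lambda> * \<Lambda> + \<Lambda>)) + 2 * K) * W"
        using \<Lambda>_gt_1 C1_nonneg W less_1_mult[of \<Lambda> \<Lambda>] unfolding h_def
        by (intro mult_right_mono add_mono mult_left_mono) auto
      also have "\<dots> \<le> (C1 * (1 / \<Lambda>) + 2 * K) * W"
        using halving_gain W C1_nonneg unfolding h_def
        by (intro mult_right_mono add_mono mult_left_mono) auto
      also have "\<dots> = C1 * W" using C1_eq by simp
      finally show "norm (approx Q s t a - \<phi> s t a) \<le> C1 * \<omega> s t powr (1 + \<eta>)"
        by (simp add: W_def)
    qed
  qed
  then show ?thesis using assms by blast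
qed

lemma lipschitz_of_error_lipschitz:
  assumes "small_threshold \<delta>" "0 \<le> s" "s \<le> t" "t \<le> T" "\<omega> s t \<le> \<delta>"
    and "norm ((y - \<phi> s t a) - (y' - \<phi> s t b)) \<le> C2 * \<omega> s t powr (1 + \<eta>) * norm (a - b)"
  shows "norm (y - y') \<le> \<Lambda> * norm (a - b)"
proof -
  have "norm (y - y') \<le> norm ((y - \<phi> s t a) - (y' - \<phi> s t b)) + norm (\<phi> s t a - \<phi> s t b)"
    using norm_triangle_ineq[of "(y - \<phi> s t a) - (y' - \<phi> s t b)" "\<phi> s t a - \<phi> s t b"]
    by (simp add: algebra_simps)
  also have "\<dots> \<le> C2 * \<omega> s t powr (1 + \<eta>) * norm (a - b) + (1 + L * \<omega> s t powr \<alpha>) * norm (a - b)"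
    using assms flow_lipschitz[of s t a b] by (intro add_mono) auto
  also have "\<dots> = (1 + L * \<omega> s t powr \<alpha> + C2 * \<omega> s t powr (1 + \<eta>)) * norm (a - b)"
    by (simp add: algebra_simps)
  also have "\<dots> \<le> \<Lambda> * norm (a - b)"
    using lipschitz_factor_small(1)[OF assms(1)] nonneg[of s t] assms
    by (intro mult_right_mono) auto
  finally show ?thesis .
qed

text \<open>
  The same decomposition as for \<open>approx_error_small\<close>, applied to the difference of two starting
  points.  The new term is the step over \<open>[l, t]\<close> evaluated at four points, which is where the bound
  on second differences and the bound \<open>C1\<close> on the error enter.
\<close>

lemma approx_error_lipschitz_small:
  assumes \<delta>: "small_threshold \<delta>" and Q: "finite Q" and "0 \<le> s" "s \<le> t" "t \<le> T" "\<omega> s t \<le> \<delta>"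
  shows "norm ((approx Q s t a - \<phi> s t a) - (approx Q s t b - \<phi> s t b))
    \<le> C2 * \<omega> s t powr (1 + \<eta>) * norm (a - b)"
proof -
  have "\<omega> s t \<le> \<delta> \<longrightarrow> (\<forall>a b. norm ((approx Q s t a - \<phi> s t a) - (approx Q s t b - \<phi> s t b))
    \<le> C2 * \<omega> s t powr (1 + \<eta>) * norm (a - b))"
    using Q assms(3-5)
  proof (induction rule: crossing_induct)
    case (gap s t)
    then show ?case using C2_nonneg by (simp add: compose_along_gap)
  next
    case (cross s t)
    show ?case
    proof (intro impI allI)
      fix a b :: 'a assume small: "\<omega> s t \<le> \<delta>"
      define W where "W = \<omega> s t powr (1 + \<eta>)"
      define h where "h = 2 powr (- (1 + \<eta>))"
      define d where "d = norm (a - b)"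
      have W: "0 \<le> W" and d: "0 \<le> d" and h: "0 \<le> h" "h \<le> 1"
        using eta_pos powr_mono[of "- (1 + \<eta>)" 0 2] by (simp_all add: W_def d_def h_def)
      obtain l r where lr: "s \<le> l" "l < r" "r \<le> t" "l \<in> insert s Q" "r \<in> insert t Q"
          "Q \<inter> {l<..<r} = {}" and half: "\<omega> s l \<le> \<omega> s t / 2" "\<omega> r t \<le> \<omega> s t - \<omega> s t / 2"
        using ex_crossing_interval[OF Q cross(1-3), of "\<omega> s t / 2"] nonneg[of s t] cross(1-3)
        by auto
      have sub: "\<omega> s l \<le> \<delta>" "\<omega> r t \<le> \<delta>" "\<omega> l t \<le> \<delta>" "\<omega> l r \<le> \<delta>"
        using small control_mono[of s s l t] control_mono[of s r t t] control_mono[of s l t t]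
          control_mono[of s l r t] cross(1-3) lr by auto
      define w w' where "w = approx Q s l a" and "w' = approx Q s l b"
      define z z' where "z = \<phi> l r w" and "z' = \<phi> l r w'"
      have hw1: "C2 * \<omega> s l powr (1 + \<eta>) \<le> C2 * (h * W)"
        unfolding h_def W_def using half cross(1-3) lr C2_nonneg nonneg[of s l]
        by (intro mult_left_mono half_control_powr) auto
      have hw2: "C2 * \<omega> r t powr (1 + \<eta>) \<le> C2 * (h * W)"
        unfolding h_def W_def using half cross(1-3) lr C2_nonneg nonneg[of r t]
        by (intro mult_left_mono half_control_powr) auto
      have err_w: "norm ((w - \<phi> s l a) - (w' - \<phi> s l b)) \<le> C2 * \<omega> s l powr (1 + \<eta>) * d"
        using cross(4)[of l r] lr sub unfolding w_def w'_def d_def by auto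
      then have ww': "norm (w - w') \<le> \<Lambda> * d"
        unfolding d_def using cross(1-3) lr sub
        by (intro lipschitz_of_error_lipschitz[OF \<delta>, of s l]) auto
      have err_w: "norm ((w - \<phi> s l a) - (w' - \<phi> s l b)) \<le> C2 * (h * W) * d"
        using err_w hw1 d by (meson mult_right_mono order_trans)
      have "norm (z - z') \<le> \<Lambda> * norm (w - w')"
        unfolding z_def z'_def using cross(1-3) lr sub by (intro flow_lipschitz_small[OF \<delta>]) auto
      also have "\<dots> \<le> \<Lambda> * (\<Lambda> * d)" using ww' \<Lambda>_gt_1 by simp
      finally have zz': "norm (z - z') \<le> \<Lambda> * (\<Lambda> * d)" .

      have "norm ((approx Q r t z - \<phi> r t z) - (approx Q r t z' - \<phi> r t z'))
          \<le> C2 * \<omega> r t powr (1 + \<eta>) * norm (z - z')"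
        using cross(4)[of l r] lr sub by auto
      also have "\<dots> \<le> C2 * (h * W) * (\<Lambda> * (\<Lambda> * d))"
        by (rule mult_mono[OF hw2 zz']) (use C2_nonneg h W in auto)
      finally have 1: "norm ((approx Q r t z - \<phi> r t z) - (approx Q r t z' - \<phi> r t z'))
          \<le> C2 * (h * W) * (\<Lambda> * (\<Lambda> * d))" .
      have "\<omega> l t powr (1 + \<eta>) \<le> W"
        unfolding W_def using cross(1-3) lr eta_pos
        by (intro powr_mono2 control_mono nonneg) auto
      then have "K * \<omega> l t powr (1 + \<eta>) * norm (w - w') \<le> K * W * (\<Lambda> * d)"
        using ww' K_nonneg W by (intro mult_mono[OF mult_left_mono]) auto
      then have 2: "norm ((\<phi> r t z - \<phi> l t w) - (\<phi> r t z' - \<phi> l t w')) \<le> K * W * (\<Lambda> * d)"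
        using flow_defect_lipschitz[of l r t w w'] cross(1-3) lr unfolding z_def z'_def by auto

      have werr: "norm (w - \<phi> s l a) \<le> C1 * W"
      proof -
        have "norm (w - \<phi> s l a) \<le> C1 * \<omega> s l powr (1 + \<eta>)"
          unfolding w_def using cross(1-3) lr sub by (intro approx_error_small[OF \<delta> Q]) auto
        also have "\<dots> \<le> C1 * W" unfolding W_def using cross(1-3) lr C1_nonneg eta_pos
          by (intro mult_left_mono powr_mono2 control_mono nonneg) auto
        finally show ?thesis .
      qed
      have phi_ab: "norm (\<phi> s l a - \<phi> s l b) \<le> \<Lambda> * d"
        unfolding d_def using cross(1-3) lr sub by (intro flow_lipschitz_small[OF \<delta>]) auto
      have "norm ((\<phi> l t w - \<phi> l t (\<phi> s l a)) - (\<phi> l t w' - \<phi> l t (\<phi> s l b)))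
        \<le> (1 + L * \<omega> l t powr \<alpha>) * norm ((w - \<phi> s l a) - (w' - \<phi> s l b))
          + K * (norm (w - w') + norm (\<phi> s l a - \<phi> s l b)) * norm (w - \<phi> s l a)"
        using cross(1-3) lr by (intro flow_second_difference) auto
      also have "\<dots> \<le> \<Lambda> * (C2 * (h * W) * d) + K * (\<Lambda> * d + \<Lambda> * d) * (C1 * W)"
      proof (rule add_mono)
        have "1 + L * \<omega> l t powr \<alpha> \<le> \<Lambda>"
          using nonneg[of l t] cross(1-3) lr sub by (intro lipschitz_factor_small(2)[OF \<delta>]) auto
        then show "(1 + L * \<omega> l t powr \<alpha>) * norm ((w - \<phi> s l a) - (w' - \<phi> s l b))
            \<le> \<Lambda> * (C2 * (h * W) * d)"
          using err_w by (rule mult_mono) (use \<Lambda>_gt_1 in auto)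
        have "K * (norm (w - w') + norm (\<phi> s l a - \<phi> s l b)) \<le> K * (\<Lambda> * d + \<Lambda> * d)"
          using ww' phi_ab K_nonneg by (intro mult_left_mono add_mono) auto
        then show "K * (norm (w - w') + norm (\<phi> s l a - \<phi> s l b)) * norm (w - \<phi> s l a)
            \<le> K * (\<Lambda> * d + \<Lambda> * d) * (C1 * W)"
          using werr by (rule mult_mono) (use K_nonneg \<Lambda>_gt_1 d in auto)
      qed
      finally have 3: "norm ((\<phi> l t w - \<phi> l t (\<phi> s l a)) - (\<phi> l t w' - \<phi> l t (\<phi> s l b)))
          \<le> \<Lambda> * (C2 * (h * W) * d) + K * (\<Lambda> * d + \<Lambda> * d) * (C1 * W)" .
      have 4: "norm ((\<phi> l t (\<phi> s l a) - \<phi> s t a) - (\<phi> l t (\<phi> s l b) - \<phi> s t b)) \<le> K * W * d"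
        using flow_defect_lipschitz[of s l t a b] cross(1-3) lr unfolding W_def d_def by auto
      have eq: "(approx Q s t a - \<phi> s t a) - (approx Q s t b - \<phi> s t b) =
          ((approx Q r t z - \<phi> r t z) - (approx Q r t z' - \<phi> r t z'))
          + ((\<phi> r t z - \<phi> l t w) - (\<phi> r t z' - \<phi> l t w'))
          + ((\<phi> l t w - \<phi> l t (\<phi> s l a)) - (\<phi> l t w' - \<phi> l t (\<phi> s l b)))
          + ((\<phi> l t (\<phi> s l a) - \<phi> s t a) - (\<phi> l t (\<phi> s l b) - \<phi> s t b))"
        using approx_split_interval[OF Q, of s l r t] cross(1-3) lr
        by (simp add: w_def w'_def z_def z'_def)
      have "norm ((approx Q s t a - \<phi> s t a) - (approx Q s t b - \<phi> s t b)) \<le>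
          C2 * (h * W) * (\<Lambda> * (\<Lambda> * d)) + K * W * (\<Lambda> * d)
          + (\<Lambda> * (C2 * (h * W) * d) + K * (\<Lambda> * d + \<Lambda> * d) * (C1 * W)) + K * W * d"
        unfolding eq by (intro norm_add4_le 1 2 3 4)
      also have "\<dots> = (C2 * (h * (\<Lambda> * \<Lambda> + \<Lambda>)) + (K * \<Lambda> + 2 * K * \<Lambda> * C1 + K)) * W * d"
        by (simp add: algebra_simps)
      also have "\<dots> \<le> (C2 * (1 / \<Lambda>) + (K * \<Lambda> + 2 * K * \<Lambda> * C1 + K)) * W * d"
        using halving_gain W d C2_nonneg \<Lambda>_gt_1 K_nonneg C1_nonneg unfolding h_def
        by (intro mult_right_mono add_mono mult_left_mono) auto
      also have "\<dots> = C2 * W * d" using C2_eq by simp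
      finally show "norm ((approx Q s t a - \<phi> s t a) - (approx Q s t b - \<phi> s t b))
          \<le> C2 * \<omega> s t powr (1 + \<eta>) * norm (a - b)"
        by (simp add: W_def d_def)
    qed
  qed
  then show ?thesis using assms by blast
qed

lemma approx_lipschitz_small:
  assumes "small_threshold \<delta>" "finite Q" "0 \<le> s" "s \<le> t" "t \<le> T" "\<omega> s t \<le> \<delta>"
  shows "norm (approx Q s t a - approx Q s t b) \<le> \<Lambda> * norm (a - b)"
  by (rule lipschitz_of_error_lipschitz[OF assms(1,3-6) approx_error_lipschitz_small[OF assms]])

end


section \<open>From small scales to the whole interval\<close>

context almost_flow
begin

definition flow_lip :: real where "flow_lip = 1 + L * \<omega> 0 T powr \<alpha>"

lemma flow_lip_ge_1: "1 \<le> flow_lip"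
  using L_nonneg by (simp add: flow_lip_def)

lemma flow_lipschitz_global:
  assumes "0 \<le> s" "s \<le> t" "t \<le> T"
  shows "norm (\<phi> s t a - \<phi> s t b) \<le> flow_lip * norm (a - b)"
proof -
  have "\<omega> s t powr \<alpha> \<le> \<omega> 0 T powr \<alpha>"
    using assms alpha_pos by (intro powr_mono2 control_mono nonneg) auto
  then have "1 + L * \<omega> s t powr \<alpha> \<le> flow_lip"
    using L_nonneg by (simp add: flow_lip_def mult_left_mono)
  then show ?thesis
    using flow_lipschitz[OF assms, of a b] by (meson mult_right_mono norm_ge_zero order_trans)
qed

text \<open>
  Split the composition into blocks: a part \<open>[s, l]\<close> of control at most \<open>\<delta>\<close>, one interval of
  arbitrary size, and the rest, whose control is smaller by \<open>\<delta>\<close>.  Each block multiplies the Lipschitz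
  constant by at most \<open>flow_lip * \<Lambda>\<close>, so it grows at most exponentially in \<open>\<omega> s t\<close>.
\<close>

lemma approx_lipschitz:
  obtains M where "1 \<le> M"
    "\<And>Q s t a b. \<lbrakk>finite Q; 0 \<le> s; s \<le> t; t \<le> T\<rbrakk> \<Longrightarrow>
      norm (approx Q s t a - approx Q s t b) \<le> M * norm (a - b)"
proof -
  obtain \<delta> where \<delta>: "small_threshold \<delta>" using ex_small_threshold by blast
  have \<delta>0: "0 < \<delta>" using \<delta> by (simp add: small_threshold_def)
  \<comment> \<open>The rate is chosen so that losing \<open>\<delta>\<close> of control pays for exactly one block.\<close>
  define \<kappa> where "\<kappa> = ln (flow_lip * \<Lambda>) / \<delta>"
  define g where "g w = \<Lambda> * exp (\<kappa> * w)" for w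
  have big: "1 \<le> flow_lip * \<Lambda>"
    using flow_lip_ge_1 \<Lambda>_gt_1 mult_mono[of 1 flow_lip 1 \<Lambda>] by auto
  have \<kappa>0: "0 \<le> \<kappa>" using big \<delta>0 by (simp add: \<kappa>_def)
  have exp_\<delta>: "exp (\<kappa> * \<delta>) = flow_lip * \<Lambda>" using \<delta>0 big by (simp add: \<kappa>_def)
  have g_mono: "g w \<le> g w'" if "w \<le> w'" for w w'
    using that \<kappa>0 \<Lambda>_gt_1 by (simp add: g_def mult_left_mono)
  have g0: "g 0 = \<Lambda>" by (simp add: g_def)
  have g_step: "g w * (flow_lip * \<Lambda>) \<le> g w'" if "w \<le> w' - \<delta>" for w w'
  proof -
    have "g w * (flow_lip * \<Lambda>) = g (w + \<delta>)"
      using exp_\<delta> by (simp add: g_def exp_add distrib_left)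
    also have "\<dots> \<le> g w'" using that by (intro g_mono) auto
    finally show ?thesis .
  qed
  have main: "norm (approx Q s t a - approx Q s t b) \<le> g (\<omega> s t) * norm (a - b)"
    if Q: "finite Q" and st: "0 \<le> s" "s \<le> t" "t \<le> T" for Q s t a b
  proof -
    have "\<forall>a b. norm (approx Q s t a - approx Q s t b) \<le> g (\<omega> s t) * norm (a - b)"
      using Q st
    proof (induction rule: crossing_induct)
      case (gap s t)
      have "norm (\<phi> s t a - \<phi> s t b) \<le> g (\<omega> s t) * norm (a - b)" for a b
      proof (cases "\<omega> s t \<le> \<delta>")
        case True
        have "norm (\<phi> s t a - \<phi> s t b) \<le> \<Lambda> * norm (a - b)"
          using flow_lipschitz_small[OF \<delta>] gap True by auto
        also have "\<dots> \<le> g (\<omega> s t) * norm (a - b)"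
          using g_mono[of 0 "\<omega> s t"] g0 nonneg[of s t] gap by (intro mult_right_mono) auto
        finally show ?thesis .
      next
        case False
        have "flow_lip * 1 \<le> flow_lip * (\<Lambda> * \<Lambda>)"
          using \<Lambda>_gt_1 flow_lip_ge_1 less_1_mult[of \<Lambda> \<Lambda>] by (intro mult_left_mono) auto
        also have "\<dots> = g 0 * (flow_lip * \<Lambda>)" using g0 by simp
        also have "\<dots> \<le> g (\<omega> s t)" using False by (intro g_step) auto
        finally show ?thesis
          using flow_lipschitz_global[of s t a b] gap
          by simp (meson mult_right_mono norm_ge_zero order_trans)
      qed
      then show ?case using gap by (simp add: compose_along_gap)
    next
      case (cross s t)
      show ?case
      proof (cases "\<omega> s t \<le> \<delta>")
        case True
        have "norm (approx Q s t a - approx Q s t b) \<le> \<Lambda> * norm (a - b)" for a b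
          using approx_lipschitz_small[OF \<delta> Q] cross(1-3) True by auto
        moreover have "\<Lambda> \<le> g (\<omega> s t)"
          using g_mono[of 0 "\<omega> s t"] g0 nonneg[of s t] cross(1-3) by auto
        ultimately show ?thesis by (meson mult_right_mono norm_ge_zero order_trans)
      next
        case False
        obtain l r where lr: "s \<le> l" "l < r" "r \<le> t" "l \<in> insert s Q" "r \<in> insert t Q"
            "Q \<inter> {l<..<r} = {}" and half: "\<omega> s l \<le> \<delta>" "\<omega> r t \<le> \<omega> s t - \<delta>"
          using ex_crossing_interval[OF Q cross(1-3), of \<delta>] \<delta>0 False by auto
        show ?thesis
        proof (intro allI)
          fix a b
          define w w' where "w = approx Q s l a" and "w' = approx Q s l b"
          have "norm (approx Q r t (\<phi> l r w) - approx Q r t (\<phi> l r w'))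
              \<le> g (\<omega> r t) * norm (\<phi> l r w - \<phi> l r w')"
            using cross(4)[of l r] lr by auto
          also have "norm (\<phi> l r w - \<phi> l r w') \<le> flow_lip * norm (w - w')"
            using lr cross(1-3) by (intro flow_lipschitz_global) auto
          also have "norm (w - w') \<le> \<Lambda> * norm (a - b)"
            unfolding w_def w'_def using lr cross(1-3) half
            by (intro approx_lipschitz_small[OF \<delta> Q]) auto
          also have "g (\<omega> r t) * (flow_lip * (\<Lambda> * norm (a - b)))
              = g (\<omega> r t) * (flow_lip * \<Lambda>) * norm (a - b)" by simp
          also have "\<dots> \<le> g (\<omega> s t) * norm (a - b)"
            using half by (intro mult_right_mono g_step) auto
          finally show "norm (approx Q s t a - approx Q s t b) \<le> g (\<omega> s t) * norm (a - b)"
            using approx_split_interval[OF Q, of s l r t] lr cross(1-3) flow_lip_ge_1 \<Lambda>_gt_1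
            by (auto simp: w_def w'_def g_def mult_left_mono)
        qed
      qed
    qed
    then show ?thesis by blast
  qed
  have "1 \<le> g (\<omega> 0 T)" using g_mono[of 0 "\<omega> 0 T"] g0 \<Lambda>_gt_1 nonneg[of 0 T] T_nonneg by auto
  moreover have "norm (approx Q s t a - approx Q s t b) \<le> g (\<omega> 0 T) * norm (a - b)"
    if "finite Q" "0 \<le> s" "s \<le> t" "t \<le> T" for Q s t a b
    using main[OF that, of a b] g_mono[of "\<omega> s t" "\<omega> 0 T"] control_mono[of 0 s t T] that
    by (meson mult_right_mono norm_ge_zero order.refl order_trans)
  ultimately show ?thesis by (rule that)
qed

text \<open>
  The same blocks: each contributes a bounded error, and their number is at most proportional to
  \<open>1 + \<omega> s t / \<delta>\<close>.  When \<open>\<omega> s t > \<delta>\<close> a bounded error is at most a multiple of the claimed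
  power of \<open>\<omega> s t\<close>, which extends \<open>approx_error_small\<close> to all intervals.
\<close>

lemma approx_error:
  obtains C where "0 \<le> C"
    "\<And>Q s t a. \<lbrakk>finite Q; 0 \<le> s; s \<le> t; t \<le> T\<rbrakk> \<Longrightarrow>
      norm (approx Q s t a - \<phi> s t a) \<le> C * \<omega> s t powr (1 + \<eta>)"
proof -
  obtain \<delta> where \<delta>: "small_threshold \<delta>" using ex_small_threshold by blast
  have \<delta>0: "0 < \<delta>" using \<delta> by (simp add: small_threshold_def)
  \<comment> \<open>\<open>D\<close> collects the errors of one block: two defects, the error of the composition over \<open>[s, l]\<close>
    enlarged by the step over \<open>[l, t]\<close>, and once more \<open>C1 * M\<close> for intervals with \<open>\<omega> s t \<le> \<delta>\<close>.\<close>
  define M where "M = \<omega> 0 T powr (1 + \<eta>)"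
  define D where "D = (2 * K + (1 + flow_lip) * C1) * M"
  have M0: "0 \<le> M" by (simp add: M_def)
  have le_M: "\<omega> s t powr (1 + \<eta>) \<le> M" if "0 \<le> s" "s \<le> t" "t \<le> T" for s t
    unfolding M_def using that eta_pos by (intro powr_mono2 control_mono nonneg) auto
  have KM: "0 \<le> K * M" "0 \<le> C1 * M" "0 \<le> flow_lip * (C1 * M)"
    using K_nonneg C1_nonneg M0 flow_lip_ge_1 by auto
  have D: "D = K * M + C1 * M + flow_lip * (C1 * M) + K * M"
    by (simp add: D_def algebra_simps)
  have D0: "0 \<le> D" using KM D by linarith
  have main: "norm (approx Q s t a - \<phi> s t a) \<le> D * (1 + \<omega> s t / \<delta>)"
    if Q: "finite Q" and st: "0 \<le> s" "s \<le> t" "t \<le> T" for Q s t a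
  proof -
    have "\<forall>a. norm (approx Q s t a - \<phi> s t a) \<le> D * (1 + \<omega> s t / \<delta>)"
      using Q st
    proof (induction rule: crossing_induct)
      case (gap s t)
      then show ?case using D0 \<delta>0 nonneg[of s t] by (simp add: compose_along_gap)
    next
      case (cross s t)
      show ?case
      proof (cases "\<omega> s t \<le> \<delta>")
        case True
        show ?thesis
        proof
          fix a
          have "norm (approx Q s t a - \<phi> s t a) \<le> C1 * \<omega> s t powr (1 + \<eta>)"
            using approx_error_small[OF \<delta> Q] cross(1-3) True by auto
          also have "\<dots> \<le> C1 * M" using le_M[of s t] cross(1-3) C1_nonneg by (intro mult_left_mono) auto
          also have "\<dots> \<le> D * 1" using KM D by linarith
          also have "\<dots> \<le> D * (1 + \<omega> s t / \<delta>)"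
            using D0 \<delta>0 nonneg[of s t] cross(1-3) by (intro mult_left_mono) auto
          finally show "norm (approx Q s t a - \<phi> s t a) \<le> D * (1 + \<omega> s t / \<delta>)" .
        qed
      next
        case False
        obtain l r where lr: "s \<le> l" "l < r" "r \<le> t" "l \<in> insert s Q" "r \<in> insert t Q"
            "Q \<inter> {l<..<r} = {}" and half: "\<omega> s l \<le> \<delta>" "\<omega> r t \<le> \<omega> s t - \<delta>"
          using ex_crossing_interval[OF Q cross(1-3), of \<delta>] \<delta>0 False by auto
        show ?thesis
        proof
          fix a
          define w where "w = approx Q s l a"
          define z where "z = \<phi> l r w"
          have 1: "norm (approx Q r t z - \<phi> r t z) \<le> D * (1 + \<omega> r t / \<delta>)"
            using cross(4)[of l r] lr by auto
          have 2: "norm (\<phi> r t z - \<phi> l t w) \<le> K * M"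
            using flow_defect_crude[of l r t w] le_M[of l t] cross(1-3) lr K_nonneg unfolding z_def
            by (meson dual_order.trans less_imp_le mult_left_mono)
          have "norm (w - \<phi> s l a) \<le> C1 * \<omega> s l powr (1 + \<eta>)"
            unfolding w_def using cross(1-3) lr half by (intro approx_error_small[OF \<delta> Q]) auto
          also have "\<dots> \<le> C1 * M"
            using le_M[of s l] cross(1-3) lr C1_nonneg by (intro mult_left_mono) auto
          finally have "flow_lip * norm (w - \<phi> s l a) \<le> flow_lip * (C1 * M)"
            using flow_lip_ge_1 by (intro mult_left_mono) auto
          then have 3: "norm (\<phi> l t w - \<phi> l t (\<phi> s l a)) \<le> flow_lip * (C1 * M)"
            using flow_lipschitz_global[of l t w "\<phi> s l a"] cross(1-3) lr by auto
          have 4: "norm (\<phi> l t (\<phi> s l a) - \<phi> s t a) \<le> K * M"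
            using flow_defect_crude[of s l t a] le_M[of s t] cross(1-3) lr K_nonneg
            by (meson dual_order.trans less_imp_le mult_left_mono)
          have eq: "approx Q s t a - \<phi> s t a = (approx Q r t z - \<phi> r t z) + (\<phi> r t z - \<phi> l t w)
              + (\<phi> l t w - \<phi> l t (\<phi> s l a)) + (\<phi> l t (\<phi> s l a) - \<phi> s t a)"
            using approx_split_interval[OF Q, of s l r t a] cross(1-3) lr by (simp add: w_def z_def)
          have "norm (approx Q s t a - \<phi> s t a)
              \<le> D * (1 + \<omega> r t / \<delta>) + K * M + flow_lip * (C1 * M) + K * M"
            unfolding eq by (intro norm_add4_le 1 2 3 4)
          also have "\<dots> \<le> D * (1 + \<omega> r t / \<delta>) + D" using KM D by linarith
          also have "\<dots> = D * (1 + (\<omega> r t + \<delta>) / \<delta>)" using \<delta>0 by (simp add: field_simps)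
          also have "\<dots> \<le> D * (1 + \<omega> s t / \<delta>)"
            using D0 \<delta>0 half by (intro mult_left_mono add_left_mono divide_right_mono) auto
          finally show "norm (approx Q s t a - \<phi> s t a) \<le> D * (1 + \<omega> s t / \<delta>)" .
        qed
      qed
    qed
    then show ?thesis by blast
  qed
  define D' where "D' = D * (1 + \<omega> 0 T / \<delta>)"
  define C where "C = C1 + D' / \<delta> powr (1 + \<eta>)"
  have D'0: "0 \<le> D'" using D0 \<delta>0 nonneg[of 0 T] T_nonneg by (simp add: D'_def)
  have "0 \<le> C" using C1_nonneg D'0 by (simp add: C_def)
  moreover have "norm (approx Q s t a - \<phi> s t a) \<le> C * \<omega> s t powr (1 + \<eta>)"
    if st: "finite Q" "0 \<le> s" "s \<le> t" "t \<le> T" for Q s t a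
  proof (cases "\<omega> s t \<le> \<delta>")
    case True
    have "norm (approx Q s t a - \<phi> s t a) \<le> C1 * \<omega> s t powr (1 + \<eta>)"
      using st True by (intro approx_error_small[OF \<delta>]) auto
    also have "\<dots> \<le> C * \<omega> s t powr (1 + \<eta>)"
      using D'0 by (intro mult_right_mono) (auto simp: C_def)
    finally show ?thesis .
  next
    case False
    have "norm (approx Q s t a - \<phi> s t a) \<le> D * (1 + \<omega> s t / \<delta>)" using main[OF st] .
    also have "\<dots> \<le> D'" unfolding D'_def
      using D0 \<delta>0 control_mono[of 0 s t T] st
      by (intro mult_left_mono add_left_mono divide_right_mono) auto
    also have "\<dots> = D' / \<delta> powr (1 + \<eta>) * \<delta> powr (1 + \<eta>)" using \<delta>0 by simp
    also have "\<dots> \<le> D' / \<delta> powr (1 + \<eta>) * \<omega> s t powr (1 + \<eta>)"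
      using False D'0 \<delta>0 eta_pos by (intro mult_left_mono powr_mono2) auto
    also have "\<dots> \<le> C * \<omega> s t powr (1 + \<eta>)"
      using C1_nonneg by (intro mult_right_mono) (auto simp: C_def)
    finally show ?thesis .
  qed
  ultimately show ?thesis by (rule that)
qed

text \<open>
  If the control is small away from the left endpoint, separate the first interval \<open>[s, q]\<close>, which may
  contain a large jump.  The composition over \<open>[q, t]\<close> is replaced by one step using
  \<open>approx_error\<close>, and merging this step with \<open>\<phi> s q\<close> costs one defect; both errors contain a power of
  the small control \<open>\<omega> q t\<close>.  The other case separates the last interval.
\<close>

lemma approx_error_one_sided:
  obtains C where "0 \<le> C"
    "\<And>Q s t a \<epsilon>. \<lbrakk>finite Q; 0 \<le> s; s \<le> t; t \<le> T; one_sided_small \<epsilon> s t\<rbrakk> \<Longrightarrow>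
      norm (approx Q s t a - \<phi> s t a) \<le> C * \<epsilon> powr \<eta> * \<omega> s t"
proof -
  obtain C where C: "0 \<le> C" "\<And>Q s t a. \<lbrakk>finite Q; 0 \<le> s; s \<le> t; t \<le> T\<rbrakk> \<Longrightarrow>
      norm (approx Q s t a - \<phi> s t a) \<le> C * \<omega> s t powr (1 + \<eta>)"
    using approx_error by blast
  define C' where "C' = flow_lip * C + K"
  have "0 \<le> C'" using C flow_lip_ge_1 K_nonneg by (simp add: C'_def)
  moreover have "norm (approx Q s t a - \<phi> s t a) \<le> C' * \<epsilon> powr \<eta> * \<omega> s t"
    if Q: "finite Q" and st: "0 \<le> s" "s \<le> t" "t \<le> T" and small: "one_sided_small \<epsilon> s t" for Q s t a \<epsilon>
  proof (cases "Q \<inter> {s<..<t} = {}")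
    case True
    then show ?thesis using \<open>0 \<le> C'\<close> nonneg[of s t] st by (simp add: compose_along_gap)
  next
    case ne: False
    have fin: "finite (Q \<inter> {s<..<t})" using Q by simp
    have w0: "0 \<le> \<omega> s t" using nonneg st by auto
    have power_split: "w powr (1 + \<eta>) \<le> \<epsilon> powr \<eta> * \<omega> s t"
      if "0 \<le> w" "w \<le> \<epsilon>" "w \<le> \<omega> s t" for w
    proof -
      have "w powr (1 + \<eta>) = w powr \<eta> * w"
        using that by (cases "w = 0") (auto simp: powr_add)
      also have "\<dots> \<le> \<epsilon> powr \<eta> * \<omega> s t"
        using that eta_pos by (intro mult_mono powr_mono2) auto
      finally show ?thesis .
    qed
    have min_split: "K * (m powr \<eta> * \<omega> s t) \<le> K * (\<epsilon> powr \<eta> * \<omega> s t)" if "0 \<le> m" "m \<le> \<epsilon>" for m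
      using that eta_pos w0 K_nonneg by (intro mult_left_mono mult_right_mono powr_mono2) auto
    consider "\<forall>q\<in>{s<..<t}. \<omega> q t \<le> \<epsilon>" | "\<forall>q\<in>{s<..<t}. \<omega> s q \<le> \<epsilon>"
      using small by (auto simp: one_sided_small_def)
    then show ?thesis
    proof cases
      case 1
      define q where "q = Min (Q \<inter> {s<..<t})"
      have q: "q \<in> Q" "s < q" "q < t" using Min_in[OF fin ne] by (auto simp: q_def)
      have gap: "Q \<inter> {s<..<q} = {}" using Min_le[OF fin] q by (fastforce simp: q_def)
      have step: "approx Q s t a = approx Q q t (\<phi> s q a)"
        using q gap Q by (intro compose_along_step) auto
      have "norm (approx Q q t (\<phi> s q a) - \<phi> q t (\<phi> s q a)) \<le> C * \<omega> q t powr (1 + \<eta>)"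
        using q st Q by (intro C(2)) auto
      also have "\<dots> \<le> C * (\<epsilon> powr \<eta> * \<omega> s t)"
        using 1 q st C(1) nonneg[of q t] control_mono[of s q t t]
        by (intro mult_left_mono power_split) auto
      also have "\<dots> \<le> flow_lip * (C * (\<epsilon> powr \<eta> * \<omega> s t))"
        using flow_lip_ge_1 C(1) w0 mult_right_mono[of 1 flow_lip "C * (\<epsilon> powr \<eta> * \<omega> s t)"] by simp
      finally have e1: "norm (approx Q q t (\<phi> s q a) - \<phi> q t (\<phi> s q a))
          \<le> flow_lip * (C * (\<epsilon> powr \<eta> * \<omega> s t))" .
      have "norm (\<phi> q t (\<phi> s q a) - \<phi> s t a) \<le> K * (min (\<omega> s q) (\<omega> q t) powr \<eta> * \<omega> s t)"
        using q st by (intro flow_defect) auto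
      also have "\<dots> \<le> K * (\<epsilon> powr \<eta> * \<omega> s t)"
        using 1 q st nonneg[of s q] nonneg[of q t] by (intro min_split) (auto simp: min_le_iff_disj)
      finally have e2: "norm (\<phi> q t (\<phi> s q a) - \<phi> s t a) \<le> K * (\<epsilon> powr \<eta> * \<omega> s t)" .
      show ?thesis
        using norm_triangle_le[OF add_mono[OF e1 e2]] by (simp add: step C'_def algebra_simps)
    next
      case 2
      define q where "q = Max (Q \<inter> {s<..<t})"
      have q: "q \<in> Q" "s < q" "q < t" using Max_in[OF fin ne] by (auto simp: q_def)
      have gap: "Q \<inter> {q<..<t} = {}" using Max_ge[OF fin] q by (fastforce simp: q_def)
      have step: "approx Q s t a = \<phi> q t (approx Q s q a)"
        using compose_along_split[OF Q, of s q t \<phi> a] q gap by (simp add: compose_along_gap)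
      have "norm (approx Q s q a - \<phi> s q a) \<le> C * \<omega> s q powr (1 + \<eta>)"
        using q st Q by (intro C(2)) auto
      also have "\<dots> \<le> C * (\<epsilon> powr \<eta> * \<omega> s t)"
        using 2 q st C(1) nonneg[of s q] control_mono[of s s q t]
        by (intro mult_left_mono power_split) auto
      finally have "flow_lip * norm (approx Q s q a - \<phi> s q a)
          \<le> flow_lip * (C * (\<epsilon> powr \<eta> * \<omega> s t))"
        using flow_lip_ge_1 by (intro mult_left_mono) auto
      then have e1: "norm (\<phi> q t (approx Q s q a) - \<phi> q t (\<phi> s q a))
          \<le> flow_lip * (C * (\<epsilon> powr \<eta> * \<omega> s t))"
        using flow_lipschitz_global[of q t "approx Q s q a" "\<phi> s q a"] q st by auto
      have "norm (\<phi> q t (\<phi> s q a) - \<phi> s t a) \<le> K * (min (\<omega> s q) (\<omega> q t) powr \<eta> * \<omega> s t)"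
        using q st by (intro flow_defect) auto
      also have "\<dots> \<le> K * (\<epsilon> powr \<eta> * \<omega> s t)"
        using 2 q st nonneg[of s q] nonneg[of q t] by (intro min_split) (auto simp: min_le_iff_disj)
      finally have e2: "norm (\<phi> q t (\<phi> s q a) - \<phi> s t a) \<le> K * (\<epsilon> powr \<eta> * \<omega> s t)" .
      show ?thesis
        using norm_triangle_le[OF add_mono[OF e1 e2]] by (simp add: step C'_def algebra_simps)
    qed
  qed
  ultimately show ?thesis by (rule that)
qed

text \<open>
  The errors of \<open>W\<close> on the individual intervals are transported to time \<open>t\<close> by compositions, hence
  enlarged by at most \<open>M\<close>, and the controls of the intervals add up to at most \<open>\<omega> s t\<close>.
\<close>

lemma approx_tracks_almost_orbit:
  assumes lip: "1 \<le> M" "\<And>Q s t a b. \<lbrakk>finite Q; 0 \<le> s; s \<le> t; t \<le> T\<rbrakk> \<Longrightarrow>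
      norm (approx Q s t a - approx Q s t b) \<le> M * norm (a - b)"
    and P: "finite P" and st: "0 \<le> s" "s \<le> t" "t \<le> T" and c: "0 \<le> c"
    and orbit: "\<And>u v. \<lbrakk>s \<le> u; u < v; v \<le> t; u \<in> insert s P; v \<in> insert t P; P \<inter> {u<..<v} = {}\<rbrakk>
      \<Longrightarrow> norm (W v - \<phi> u v (W u)) \<le> c * \<omega> u v"
  shows "norm (W t - approx P s t (W s)) \<le> M * c * \<omega> s t"
proof -
  have "0 \<le> M * c" using lip(1) c by simp
  have one: "c * \<omega> u v \<le> M * c * \<omega> u v" if "0 \<le> u" "u \<le> v" "v \<le> T" for u v
    using lip(1) c nonneg[OF that] mult_right_mono[of 1 M "c * \<omega> u v"] by (simp add: mult.assoc)
  have "s \<le> r \<longrightarrow> r \<le> t \<longrightarrow> r \<in> insert s P \<longrightarrow> norm (W t - approx P r t (W r)) \<le> M * c * \<omega> r t" for r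
    using P
  proof (induction r rule: next_point_induct[where t = t])
    case (base r)
    show ?case
    proof (intro impI)
      assume r: "s \<le> r" "r \<le> t" "r \<in> insert s P"
      show "norm (W t - approx P r t (W r)) \<le> M * c * \<omega> r t"
      proof (cases "r = t")
        case True
        then show ?thesis using st by (simp add: compose_along_gap flow_diag diagonal)
      next
        case False
        then have "norm (W t - \<phi> r t (W r)) \<le> c * \<omega> r t"
          using r base by (intro orbit) auto
        then show ?thesis using one[of r t] r st base by (simp add: compose_along_gap)
      qed
    qed
  next
    case (step r u)
    show ?case
    proof (intro impI)
      assume r: "s \<le> r" "r \<le> t" "r \<in> insert s P"
      have IH: "norm (W t - approx P u t (W u)) \<le> M * c * \<omega> u t" using step r by auto
      have "norm (approx P u t (W u) - approx P u t (\<phi> r u (W r))) \<le> M * norm (W u - \<phi> r u (W r))"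
        using P st r step by (intro lip(2)) auto
      also have "\<dots> \<le> M * (c * \<omega> r u)"
        using lip(1) step r by (intro mult_left_mono orbit) auto
      finally have "norm (W t - approx P r t (W r)) \<le> M * c * \<omega> u t + M * c * \<omega> r u"
        using norm_diff_triangle_le[OF IH] compose_along_step[OF P, of r u t \<phi> "W r"] step
        by (simp add: mult.assoc)
      also have "\<dots> = M * c * (\<omega> r u + \<omega> u t)" by (simp add: algebra_simps)
      also have "\<dots> \<le> M * c * \<omega> r t"
        using \<open>0 \<le> M * c\<close> step r st by (intro mult_left_mono superadditive) auto
      finally show "norm (W t - approx P r t (W r)) \<le> M * c * \<omega> r t" .
    qed
  qed
  then show ?thesis using st by auto
qed

end


section \<open>Limit orbits and their uniqueness\<close>

lemma inverse_Suc_powr_tendsto_0: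
  assumes "0 < \<eta>"
  shows "(\<lambda>n. inverse (real (Suc n)) powr \<eta>) \<longlonglongrightarrow> 0"
proof -
  have "(\<lambda>n. inverse (real (Suc n)) powr \<eta>) \<longlonglongrightarrow> 0 powr \<eta>"
    using LIMSEQ_inverse_real_of_nat assms by (intro tendsto_powr2 tendsto_const) auto
  then show ?thesis by simp
qed

context almost_flow
begin

text \<open>
  Seen from the coarse partition \<open>P\<close>, the composition along \<open>Q\<close> is an almost orbit.
\<close>

lemma approx_refinement:
  obtains C where "0 \<le> C"
    "\<And>P Q s t a \<epsilon>. \<lbrakk>one_sided_fine \<epsilon> P; finite Q; P \<subseteq> Q; 0 \<le> s; s \<le> t; t \<le> T\<rbrakk> \<Longrightarrow>
      norm (approx Q s t a - approx P s t a) \<le> C * \<epsilon> powr \<eta>"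
proof -
  obtain M where M: "1 \<le> M" "\<And>Q s t a b. \<lbrakk>finite Q; 0 \<le> s; s \<le> t; t \<le> T\<rbrakk> \<Longrightarrow>
      norm (approx Q s t a - approx Q s t b) \<le> M * norm (a - b)"
    using approx_lipschitz by blast
  obtain C where C: "0 \<le> C"
    "\<And>Q s t a \<epsilon>. \<lbrakk>finite Q; 0 \<le> s; s \<le> t; t \<le> T; one_sided_small \<epsilon> s t\<rbrakk> \<Longrightarrow>
      norm (approx Q s t a - \<phi> s t a) \<le> C * \<epsilon> powr \<eta> * \<omega> s t"
    using approx_error_one_sided by blast
  have "norm (approx Q s t a - approx P s t a) \<le> M * C * \<omega> 0 T * \<epsilon> powr \<eta>"
    if fine: "one_sided_fine \<epsilon> P" and Q: "finite Q" "P \<subseteq> Q" and st: "0 \<le> s" "s \<le> t" "t \<le> T"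
    for P Q s t a \<epsilon>
  proof -
    have fin: "finite P" using fine by (simp add: one_sided_fine_def)
    define W where "W v = approx Q s v a" for v
    have "norm (W t - approx P s t (W s)) \<le> M * (C * \<epsilon> powr \<eta>) * \<omega> s t"
    proof (rule approx_tracks_almost_orbit[OF M fin st])
      show "0 \<le> C * \<epsilon> powr \<eta>" using C(1) by simp
      fix u v assume uv: "s \<le> u" "u < v" "v \<le> t" "u \<in> insert s P" "v \<in> insert t P"
        "P \<inter> {u<..<v} = {}"
      have "W v = approx Q u v (W u)"
        unfolding W_def using uv st Q by (intro approx_split) auto
      then show "norm (W v - \<phi> u v (W u)) \<le> C * \<epsilon> powr \<eta> * \<omega> u v"
        using C(2)[of Q u v \<epsilon> "W u"] Q uv st one_sided_fineD[OF fine, of u v] by auto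
    qed
    also have "\<dots> \<le> M * (C * \<epsilon> powr \<eta>) * \<omega> 0 T"
      using M(1) C(1) st by (intro mult_left_mono control_mono) auto
    finally show ?thesis
      using st by (simp add: W_def compose_along_gap flow_diag algebra_simps)
  qed
  moreover have "0 \<le> M * C * \<omega> 0 T" using M C nonneg[of 0 T] T_nonneg by simp
  ultimately show ?thesis by (rule that[rotated])
qed

text \<open>
  By \<open>approx_refinement\<close> the compositions along ever finer partitions form a Cauchy sequence, as is
  seen by comparing two of them with the composition along the union.  The estimates for \<open>Y\<close> are the
  limits of the estimates for compositions, uniform in the partition; to use them on \<open>[s, t]\<close>
  the point \<open>s\<close> is added to the partitions, which does not change the limit.
\<close>

lemma ex_limit_orbit:
  obtains Y C where "Y 0 = y" and "0 \<le> C"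
    "\<And>s t. \<lbrakk>0 \<le> s; s \<le> t; t \<le> T\<rbrakk> \<Longrightarrow> norm (Y t - \<phi> s t (Y s)) \<le> C * \<omega> s t powr (1 + \<eta>)"
    "\<And>s t \<epsilon>. \<lbrakk>0 \<le> s; s \<le> t; t \<le> T; one_sided_small \<epsilon> s t\<rbrakk> \<Longrightarrow>
      norm (Y t - \<phi> s t (Y s)) \<le> C * \<epsilon> powr \<eta> * \<omega> s t"
proof -
  obtain A where A: "0 \<le> A" "\<And>Q s t a. \<lbrakk>finite Q; 0 \<le> s; s \<le> t; t \<le> T\<rbrakk> \<Longrightarrow>
      norm (approx Q s t a - \<phi> s t a) \<le> A * \<omega> s t powr (1 + \<eta>)"
    using approx_error by blast
  obtain B where B: "0 \<le> B"
    "\<And>Q s t a \<epsilon>. \<lbrakk>finite Q; 0 \<le> s; s \<le> t; t \<le> T; one_sided_small \<epsilon> s t\<rbrakk> \<Longrightarrow>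
      norm (approx Q s t a - \<phi> s t a) \<le> B * \<epsilon> powr \<eta> * \<omega> s t"
    using approx_error_one_sided by blast
  obtain R where R: "0 \<le> R"
    "\<And>P Q s t a \<epsilon>. \<lbrakk>one_sided_fine \<epsilon> P; finite Q; P \<subseteq> Q; 0 \<le> s; s \<le> t; t \<le> T\<rbrakk> \<Longrightarrow>
      norm (approx Q s t a - approx P s t a) \<le> R * \<epsilon> powr \<eta>"
    using approx_refinement by blast
  define e where "e n = inverse (real (Suc n))" for n
  have "\<forall>n. \<exists>P. one_sided_fine (e n) P"
    using ex_one_sided_fine[OF T_nonneg] by (auto simp: e_def)
  then obtain P where P: "\<And>n. one_sided_fine (e n) (P n)" by metis
  have finP: "finite (P n)" for n using P[of n] by (simp add: one_sided_fine_def)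
  define b where "b n = R * e n powr \<eta>" for n
  have "(\<lambda>n. e n powr \<eta>) \<longlonglongrightarrow> 0"
    unfolding e_def using eta_pos by (rule inverse_Suc_powr_tendsto_0)
  then have b: "b \<longlonglongrightarrow> 0"
    unfolding b_def by (rule tendsto_mult_right_zero)
  define y_n where "y_n n t = approx (P n) 0 t y" for n t
  have near: "norm (approx Q 0 t y - y_n n t) \<le> b n"
    if "finite Q" "P n \<subseteq> Q" "0 \<le> t" "t \<le> T" for Q n t
    unfolding y_n_def b_def using that by (intro R(2) P) auto
  have conv: "convergent (\<lambda>n. y_n n t)" if t: "0 \<le> t" "t \<le> T" for t
  proof (rule Cauchy_convergent, rule metric_CauchyI)
    fix r :: real assume "0 < r"
    then have "\<forall>\<^sub>F n in sequentially. b n < r / 2" using b by (intro order_tendstoD) auto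
    then obtain N where N: "\<And>n. N \<le> n \<Longrightarrow> b n < r / 2" by (auto simp: eventually_sequentially)
    show "\<exists>M. \<forall>m\<ge>M. \<forall>n\<ge>M. dist (y_n m t) (y_n n t) < r"
    proof (intro exI allI impI)
      fix m n assume "N \<le> m" "N \<le> n"
      let ?a = "approx (P m \<union> P n) 0 t y"
      have "norm (?a - y_n m t) \<le> b m" "norm (?a - y_n n t) \<le> b n"
        by (intro near t, simp_all add: finP)+
      then have "dist ?a (y_n m t) < r / 2" "dist ?a (y_n n t) < r / 2"
        using N[OF \<open>N \<le> m\<close>] N[OF \<open>N \<le> n\<close>] by (simp_all add: dist_norm)
      then show "dist (y_n m t) (y_n n t) < r" by (rule dist_triangle_half_r)
    qed
  qed
  define Y where "Y t = lim (\<lambda>n. y_n n t)" for t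
  have lim: "(\<lambda>n. y_n n t) \<longlonglongrightarrow> Y t" if "0 \<le> t" "t \<le> T" for t
    using conv[OF that] unfolding Y_def by (simp add: convergent_LIMSEQ_iff)
  have lim': "(\<lambda>n. approx (insert s (P n)) 0 t y) \<longlonglongrightarrow> Y t" if t: "0 \<le> t" "t \<le> T" for s t
  proof -
    have "(\<lambda>n. approx (insert s (P n)) 0 t y - y_n n t) \<longlonglongrightarrow> 0"
      by (rule Lim_null_comparison[OF _ b]) (intro always_eventually allI near, use finP t in auto)
    from tendsto_add[OF this lim[OF t]] show ?thesis by simp
  qed
  have close: "norm (Y t - \<phi> s t (Y s)) \<le> c"
    if st: "0 \<le> s" "s \<le> t" "t \<le> T"
      and c: "\<And>Q a. finite Q \<Longrightarrow> norm (approx Q s t a - \<phi> s t a) \<le> c" for s t c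
  proof -
    define x where "x n = approx (insert s (P n)) 0 s y" for n
    have x: "x \<longlonglongrightarrow> Y s" unfolding x_def using st by (intro lim') auto
    have "(\<lambda>n. \<phi> s t (x n)) \<longlonglongrightarrow> \<phi> s t (Y s)"
    proof (rule LIM_zero_cancel, rule Lim_null_comparison)
      show "\<forall>\<^sub>F n in sequentially. norm (\<phi> s t (x n) - \<phi> s t (Y s)) \<le> flow_lip * norm (x n - Y s)"
        by (intro always_eventually allI flow_lipschitz_global st)
      show "(\<lambda>n. flow_lip * norm (x n - Y s)) \<longlonglongrightarrow> 0"
        using x by (intro tendsto_mult_right_zero tendsto_norm_zero LIM_zero)
    qed
    then have *: "(\<lambda>n. norm (approx (insert s (P n)) 0 t y - \<phi> s t (x n))) \<longlonglongrightarrow> norm (Y t - \<phi> s t (Y s))"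
      using st by (intro tendsto_norm tendsto_diff lim') auto
    have "norm (approx (insert s (P n)) 0 t y - \<phi> s t (x n)) \<le> c" for n
      using approx_split[of "insert s (P n)" 0 s t y] finP st c[of "insert s (P n)" "x n"]
      by (simp add: x_def)
    then show ?thesis by (intro LIMSEQ_le_const2[OF *]) blast
  qed
  show ?thesis
  proof (rule that[of Y "A + B"])
    have "(\<lambda>n. y_n n 0) = (\<lambda>n. y)"
      using T_nonneg by (auto simp: y_n_def compose_along_gap flow_diag)
    then show "Y 0 = y" using lim[of 0] T_nonneg by (simp add: LIMSEQ_const_iff)
    show "0 \<le> A + B" using A B by simp
    show "norm (Y t - \<phi> s t (Y s)) \<le> (A + B) * \<omega> s t powr (1 + \<eta>)"
      if st: "0 \<le> s" "s \<le> t" "t \<le> T" for s t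
    proof -
      have "norm (Y t - \<phi> s t (Y s)) \<le> A * \<omega> s t powr (1 + \<eta>)"
        using st A by (intro close) auto
      also have "\<dots> \<le> (A + B) * \<omega> s t powr (1 + \<eta>)"
        using B by (intro mult_right_mono) auto
      finally show ?thesis .
    qed
    show "norm (Y t - \<phi> s t (Y s)) \<le> (A + B) * \<epsilon> powr \<eta> * \<omega> s t"
      if st: "0 \<le> s" "s \<le> t" "t \<le> T" and small: "one_sided_small \<epsilon> s t" for s t \<epsilon>
    proof -
      have "norm (Y t - \<phi> s t (Y s)) \<le> B * \<epsilon> powr \<eta> * \<omega> s t"
        using st B small by (intro close) auto
      also have "\<dots> \<le> (A + B) * \<epsilon> powr \<eta> * \<omega> s t"
        using A nonneg st by (intro mult_right_mono) auto
      finally show ?thesis .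
    qed
  qed
qed

text \<open>
  For a fine partition \<open>P\<close> both paths are close to the composition along \<open>P\<close> that starts from
  their common initial value.
\<close>

lemma almost_orbits_agree:
  assumes c: "0 \<le> c" "0 \<le> c'" and t: "0 \<le> t" "t \<le> T" and start: "Y 0 = Z 0"
    and Y: "\<And>s t \<epsilon>. \<lbrakk>0 \<le> s; s < t; t \<le> T; 0 < \<epsilon>; one_sided_small \<epsilon> s t\<rbrakk> \<Longrightarrow>
      norm (Y t - \<phi> s t (Y s)) \<le> c * \<epsilon> powr \<eta> * \<omega> s t"
    and Z: "\<And>s t \<epsilon>. \<lbrakk>0 \<le> s; s < t; t \<le> T; 0 < \<epsilon>; one_sided_small \<epsilon> s t\<rbrakk> \<Longrightarrow>
      norm (Z t - \<phi> s t (Z s)) \<le> c' * \<epsilon> powr \<eta> * \<omega> s t"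
  shows "Y t = Z t"
proof -
  obtain M where M: "1 \<le> M" "\<And>Q s t a b. \<lbrakk>finite Q; 0 \<le> s; s \<le> t; t \<le> T\<rbrakk> \<Longrightarrow>
      norm (approx Q s t a - approx Q s t b) \<le> M * norm (a - b)"
    using approx_lipschitz by blast
  define e where "e n = inverse (real (Suc n))" for n
  have e0: "0 < e n" for n by (simp add: e_def)
  have "norm (Y t - Z t) \<le> M * (c + c') * \<omega> 0 t * e n powr \<eta>" for n
  proof -
    obtain P where P: "one_sided_fine (e n) P" using ex_one_sided_fine[OF T_nonneg e0] by blast
    have fin: "finite P" using P by (simp add: one_sided_fine_def)
    have "norm (Y t - approx P 0 t (Y 0)) \<le> M * (c * e n powr \<eta>) * \<omega> 0 t"
      using c t e0 one_sided_fineD[OF P]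
      by (intro approx_tracks_almost_orbit[OF M fin] Y) auto
    moreover have "norm (Z t - approx P 0 t (Z 0)) \<le> M * (c' * e n powr \<eta>) * \<omega> 0 t"
      using c t e0 one_sided_fineD[OF P]
      by (intro approx_tracks_almost_orbit[OF M fin] Z) auto
    ultimately have "norm (Y t - Z t) \<le> M * (c * e n powr \<eta>) * \<omega> 0 t + M * (c' * e n powr \<eta>) * \<omega> 0 t"
      unfolding start by (metis norm_diff_triangle_le norm_minus_commute)
    then show ?thesis by (simp add: algebra_simps)
  qed
  moreover have "(\<lambda>n. M * (c + c') * \<omega> 0 t * e n powr \<eta>) \<longlonglongrightarrow> 0"
    unfolding e_def using eta_pos
    by (intro tendsto_mult_right_zero inverse_Suc_powr_tendsto_0)
  ultimately have "norm (Y t - Z t) \<le> 0" by (intro LIMSEQ_le_const) auto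
  then show ?thesis by simp
qed

end

section \<open>Partition sums as compositions of translations\<close>

lemma linear_almost_flow:
  fixes \<Xi> :: "real \<Rightarrow> real \<Rightarrow> 'a::banach"
  assumes "control T \<omega>" "0 \<le> T" "0 < \<eta>" "0 \<le> K"
    and "\<And>s. \<lbrakk>0 \<le> s; s \<le> T\<rbrakk> \<Longrightarrow> \<Xi> s s = 0"
    and "\<And>s u t. \<lbrakk>0 \<le> s; s \<le> u; u \<le> t; t \<le> T\<rbrakk> \<Longrightarrow>
      norm (\<Xi> s u + \<Xi> u t - \<Xi> s t) \<le> K * (min (\<omega> s u) (\<omega> u t) powr \<eta> * \<omega> s t)"
  shows "almost_flow T \<omega> (\<lambda>s t y. y + \<Xi> s t) \<eta> 1 0 K"
proof -
  interpret control T \<omega> by fact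
  show ?thesis
    using assms(2-) by unfold_locales (auto simp: algebra_simps norm_minus_commute)
qed

text \<open>
  The local estimate for compositions of translations bounds every partition sum, hence also every
  limit of partition sums.
\<close>

lemma RRS_limit_close:
  fixes \<Xi> :: "real \<Rightarrow> real \<Rightarrow> 'a::banach"
  assumes "almost_flow T \<omega> (\<lambda>s t y. y + \<Xi> s t) \<eta> 1 0 K"
  obtains C where "0 \<le> C"
    "\<And>s t \<epsilon> I. \<lbrakk>0 \<le> s; s \<le> t; t \<le> T; control.one_sided_small \<omega> \<epsilon> s t; RRS_limit s t \<Xi> I\<rbrakk>
      \<Longrightarrow> norm (I - \<Xi> s t) \<le> C * \<epsilon> powr \<eta> * \<omega> s t"
proof -
  interpret almost_flow T \<omega> "\<lambda>s t y. y + \<Xi> s t" \<eta> 1 0 K by fact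
  obtain C where C: "0 \<le> C"
    "\<And>Q s t a \<epsilon>. \<lbrakk>finite Q; 0 \<le> s; s \<le> t; t \<le> T; one_sided_small \<epsilon> s t\<rbrakk> \<Longrightarrow>
      norm (approx Q s t a - (a + \<Xi> s t)) \<le> C * \<epsilon> powr \<eta> * \<omega> s t"
    using approx_error_one_sided by blast
  have "norm (I - \<Xi> s t) \<le> C * \<epsilon> powr \<eta> * \<omega> s t"
    if st: "0 \<le> s" "s \<le> t" "t \<le> T" and small: "one_sided_small \<epsilon> s t" and I: "RRS_limit s t \<Xi> I"
    for s t \<epsilon> I
  proof (rule field_le_epsilon)
    fix r :: real assume "0 < r"
    then obtain P where P: "partition_points s t P" "norm (partition_sum \<Xi> P - I) < r"
      using I unfolding RRS_limit_def by blast
    have "\<Xi> t t = 0" using flow_diag[of t 0] st by auto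
    then have "approx P s t 0 = partition_sum \<Xi> P"
      using compose_along_translation[OF P(1), of \<Xi> 0] by simp
    moreover have "norm (approx P s t 0 - (0 + \<Xi> s t)) \<le> C * \<epsilon> powr \<eta> * \<omega> s t"
      using P(1) st small by (intro C(2)) (auto simp: partition_points_def)
    ultimately show "norm (I - \<Xi> s t) \<le> C * \<epsilon> powr \<eta> * \<omega> s t + r"
      using P(2) norm_triangle_ineq[of "partition_sum \<Xi> P - \<Xi> s t" "I - partition_sum \<Xi> P"]
      by (simp add: norm_minus_commute)
  qed
  with C(1) show ?thesis by (rule that)
qed

text \<open>
  Only partitions of \<open>[a, t]\<close> that contain \<open>s\<close> matter; their sums split at \<open>s\<close>.  The sum over \<open>[a, s]\<close>
  is taken along a partition \<open>P'\<close> fine enough for both given limits.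
\<close>

lemma RRS_limit_increment:
  fixes \<Xi> :: "real \<Rightarrow> real \<Rightarrow> 'a::real_normed_vector"
  assumes "RRS_limit a s \<Xi> I" "RRS_limit a t \<Xi> J" "a \<le> s" "s \<le> t"
  shows "RRS_limit s t \<Xi> (J - I)"
  unfolding RRS_limit_def
proof (intro allI impI)
  fix e :: real assume "0 < e"
  then have e2: "0 < e / 2" by simp
  obtain P where P: "partition_points a s P"
    "\<And>Q. \<lbrakk>partition_points a s Q; P \<subseteq> Q\<rbrakk> \<Longrightarrow> norm (partition_sum \<Xi> Q - I) < e / 2"
    using assms(1)[unfolded RRS_limit_def, rule_format, OF e2] by metis
  obtain R where R: "partition_points a t R"
    "\<And>Q. \<lbrakk>partition_points a t Q; R \<subseteq> Q\<rbrakk> \<Longrightarrow> norm (partition_sum \<Xi> Q - J) < e / 2"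
    using assms(2)[unfolded RRS_limit_def, rule_format, OF e2] by metis
  define P' where "P' = P \<union> (R \<inter> {a..s})"
  define R' where "R' = insert s (R \<inter> {s..t})"
  have P': "partition_points a s P'" using P(1) R(1) by (auto simp: P'_def partition_points_def)
  have R': "partition_points s t R'" using R(1) assms(4) by (auto simp: R'_def partition_points_def)
  have "norm (partition_sum \<Xi> Q - (J - I)) < e" if Q: "partition_points s t Q" "R' \<subseteq> Q" for Q
  proof -
    have "R \<subseteq> P' \<union> R'" using R(1) by (auto simp: P'_def R'_def partition_points_def)
    then have "norm (partition_sum \<Xi> (P' \<union> Q) - J) < e / 2"
      using Q by (intro R(2) partition_append(1)[OF P' Q(1)]) auto
    moreover have "norm (partition_sum \<Xi> P' - I) < e / 2"
      by (rule P(2)[OF P']) (auto simp: P'_def)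
    moreover have eq: "partition_sum \<Xi> Q - (J - I)
        = (partition_sum \<Xi> (P' \<union> Q) - J) - (partition_sum \<Xi> P' - I)"
      by (simp add: partition_append(2)[OF P' Q(1)])
    ultimately show ?thesis
      unfolding eq using norm_triangle_ineq4[of "partition_sum \<Xi> (P' \<union> Q) - J" "partition_sum \<Xi> P' - I"]
      by linarith
  qed
  with R' show "\<exists>P. partition_points s t P \<and>
      (\<forall>Q. partition_points s t Q \<and> P \<subseteq> Q \<longrightarrow> norm (partition_sum \<Xi> Q - (J - I)) < e)"
    by blast
qed


section \<open>Second differences of smooth maps\<close>

lemma lipschitz_of_bounded_derivative:
  fixes f :: "'a::real_normed_vector \<Rightarrow> 'b::real_normed_vector"
  assumes "\<And>y. (f has_derivative blinfun_apply (f1 y)) (at y)" "\<And>y. norm (f1 y) \<le> c"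
  shows "norm (f a - f b) \<le> c * norm (a - b)"
  using assms
  by (intro differentiable_bound[where S = UNIV and f' = "\<lambda>y. blinfun_apply (f1 y)"])
    (auto simp: norm_blinfun.rep_eq[symmetric])

lemma norm_increment_le_unit_interval:
  fixes k :: "real \<Rightarrow> 'b::real_normed_vector"
  assumes "\<And>\<tau>. \<lbrakk>0 \<le> \<tau>; \<tau> \<le> 1\<rbrakk> \<Longrightarrow> (k has_vector_derivative k' \<tau>) (at \<tau>)"
    and "\<And>\<tau>. \<lbrakk>0 \<le> \<tau>; \<tau> \<le> 1\<rbrakk> \<Longrightarrow> norm (k' \<tau>) \<le> B"
  shows "norm (k 1 - k 0) \<le> B"
proof -
  have "norm (k 1 - k 0) \<le> B * norm (1 - 0 :: real)"
  proof (rule differentiable_bound[where S = "{0..1}" and f' = "\<lambda>\<tau> h. h *\<^sub>R k' \<tau>"])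
    fix \<tau> :: real assume t: "\<tau> \<in> {0..1}"
    then show "(k has_derivative (\<lambda>h. h *\<^sub>R k' \<tau>)) (at \<tau> within {0..1})"
      using assms(1)[of \<tau>] by (auto simp: has_vector_derivative_def intro: has_derivative_at_withinI)
    show "onorm (\<lambda>h. h *\<^sub>R k' \<tau>) \<le> B"
      using assms(2)[of \<tau>] t by (intro onorm_le) (auto simp: mult.commute[of B] intro!: mult_left_mono)
  qed auto
  then show ?thesis by simp
qed

lemma has_vector_derivative_along_line:
  assumes "\<And>y. (f has_derivative blinfun_apply (f1 y)) (at y)"
  shows "((\<lambda>\<tau>. f (b + \<tau> *\<^sub>R v)) has_vector_derivative f1 (b + \<tau> *\<^sub>R v) v) (at \<tau>)"
proof -
  have "((\<lambda>\<tau>. b + \<tau> *\<^sub>R v) has_derivative (\<lambda>h. h *\<^sub>R v)) (at \<tau>)"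
    by (auto intro!: derivative_eq_intros)
  from has_derivative_compose[OF this assms] show ?thesis
    by (simp add: has_vector_derivative_def blinfun.scaleR_right)
qed

lemma norm_blinfun_le:
  "\<lbrakk>norm L \<le> c; norm v \<le> d\<rbrakk> \<Longrightarrow> norm (blinfun_apply L v) \<le> c * d"
  using norm_blinfun[of L v] mult_mono[of "norm L" c "norm v" d] norm_ge_zero[of L] norm_ge_zero[of v]
  by linarith

text \<open>
  Integrate the derivative of \<open>f\<close> along the segments from \<open>b\<close> to \<open>a\<close> and from \<open>b'\<close> to \<open>a'\<close>.
\<close>

lemma second_difference_bound:
  fixes f :: "'a::real_normed_vector \<Rightarrow> 'b::real_normed_vector"
  assumes f1: "\<And>y. (f has_derivative blinfun_apply (f1 y)) (at y)"
    and c: "0 \<le> c" "\<And>y. norm (f1 y) \<le> c" "\<And>y z. norm (f1 y - f1 z) \<le> c * norm (y - z)"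
  shows "norm ((f a - f b) - (f a' - f b'))
    \<le> c * norm ((a - b) - (a' - b')) + c * (norm (a - a') + norm (b - b')) * norm (a - b)"
proof -
  define k where "k \<tau> = f (b + \<tau> *\<^sub>R (a - b)) - f (b' + \<tau> *\<^sub>R (a' - b'))" for \<tau> :: real
  define y y' where "y \<tau> = b + \<tau> *\<^sub>R (a - b)" and "y' \<tau> = b' + \<tau> *\<^sub>R (a' - b')" for \<tau> :: real
  have "norm (k 1 - k 0)
    \<le> c * norm ((a - b) - (a' - b')) + c * (norm (a - a') + norm (b - b')) * norm (a - b)"
  proof (rule norm_increment_le_unit_interval)
    fix \<tau> :: real assume t: "0 \<le> \<tau>" "\<tau> \<le> 1"
    show "(k has_vector_derivative f1 (y \<tau>) (a - b) - f1 (y' \<tau>) (a' - b')) (at \<tau>)"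
      unfolding k_def y_def y'_def
      by (intro has_vector_derivative_diff has_vector_derivative_along_line f1)
    have "y \<tau> - y' \<tau> = (1 - \<tau>) *\<^sub>R (b - b') + \<tau> *\<^sub>R (a - a')"
      by (simp add: y_def y'_def algebra_simps)
    then have "norm (y \<tau> - y' \<tau>) \<le> (1 - \<tau>) * norm (b - b') + \<tau> * norm (a - a')"
      using t by (auto intro!: norm_triangle_le)
    also have "\<dots> \<le> 1 * norm (b - b') + 1 * norm (a - a')"
      using t by (intro add_mono mult_right_mono) auto
    finally have "norm (y \<tau> - y' \<tau>) \<le> norm (a - a') + norm (b - b')" by simp
    then have "norm (f1 (y \<tau>) - f1 (y' \<tau>)) \<le> c * (norm (a - a') + norm (b - b'))"
      using c(1,3) by (meson mult_left_mono order_trans)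
    then have "norm ((f1 (y \<tau>) - f1 (y' \<tau>)) (a - b))
        \<le> c * (norm (a - a') + norm (b - b')) * norm (a - b)"
      by (intro norm_blinfun_le) auto
    moreover have "norm (f1 (y' \<tau>) ((a - b) - (a' - b'))) \<le> c * norm ((a - b) - (a' - b'))"
      using c(2) by (intro norm_blinfun_le) auto
    moreover have "f1 (y \<tau>) (a - b) - f1 (y' \<tau>) (a' - b')
        = f1 (y' \<tau>) ((a - b) - (a' - b')) + (f1 (y \<tau>) - f1 (y' \<tau>)) (a - b)"
      by (simp add: blinfun.diff_left blinfun.diff_right)
    ultimately show "norm (f1 (y \<tau>) (a - b) - f1 (y' \<tau>) (a' - b'))
        \<le> c * norm ((a - b) - (a' - b')) + c * (norm (a - a') + norm (b - b')) * norm (a - b)"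
      by (metis norm_triangle_mono)
  qed
  moreover have "k 1 - k 0 = (f a - f b) - (f a' - f b')" by (simp add: k_def)
  ultimately show ?thesis by simp
qed

lemma taylor_remainder_bound:
  fixes f :: "'a::real_normed_vector \<Rightarrow> 'b::real_normed_vector"
  assumes f1: "\<And>y. (f has_derivative blinfun_apply (f1 y)) (at y)"
    and c: "0 \<le> c" "\<And>y z. norm (f1 y - f1 z) \<le> c * norm (y - z)"
  shows "norm (f (a + v) - f a - f1 a v) \<le> c * norm v * norm v"
proof -
  define k where "k \<tau> = f (a + \<tau> *\<^sub>R v) - \<tau> *\<^sub>R f1 a v" for \<tau> :: real
  have "norm (k 1 - k 0) \<le> c * norm v * norm v"
  proof (rule norm_increment_le_unit_interval)
    fix \<tau> :: real assume t: "0 \<le> \<tau>" "\<tau> \<le> 1"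
    show "(k has_vector_derivative f1 (a + \<tau> *\<^sub>R v) v - f1 a v) (at \<tau>)"
      unfolding k_def
      by (intro has_vector_derivative_diff has_vector_derivative_along_line f1)
        (auto intro!: derivative_eq_intros simp: has_vector_derivative_def)
    have "norm (f1 (a + \<tau> *\<^sub>R v) - f1 a) \<le> c * norm (\<tau> *\<^sub>R v)"
      using c(2)[of "a + \<tau> *\<^sub>R v" a] by simp
    also have "\<dots> \<le> c * (1 * norm v)"
      using t c(1) mult_right_mono[of \<tau> 1 "norm v"] by (auto intro!: mult_left_mono)
    finally have "norm ((f1 (a + \<tau> *\<^sub>R v) - f1 a) v) \<le> c * norm v * norm v"
      by (intro norm_blinfun_le) auto
    then show "norm (f1 (a + \<tau> *\<^sub>R v) v - f1 a v) \<le> c * norm v * norm v"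
      by (simp add: blinfun.diff_left)
  qed
  then show ?thesis by (simp add: k_def algebra_simps)
qed

text \<open>
  A Lipschitz bound for the Taylor remainder as a function of the pair \<open>(a, v)\<close>.  It is meant for
  directions \<open>v\<close> that depend on \<open>a\<close> with a Lipschitz constant of the size of \<open>v\<close>; then it is quadratic in
  that size and linear in \<open>a - b\<close>.  The derivative of the remainder along the segment consists of
  differences of \<open>f1\<close>, so comparing two remainders involves second differences of \<open>f1\<close>.
\<close>

lemma taylor_remainder_difference:
  fixes f :: "'a::real_normed_vector \<Rightarrow> 'b::real_normed_vector"
  assumes f1: "\<And>y. (f has_derivative blinfun_apply (f1 y)) (at y)"
    and c: "0 \<le> c" "\<And>y z. norm (f1 y - f1 z) \<le> c * norm (y - z)"
      "\<And>a b a' b'. norm ((f1 a - f1 b) - (f1 a' - f1 b'))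
        \<le> c * norm ((a - b) - (a' - b')) + c * (norm (a - a') + norm (b - b')) * norm (a - b)"
  shows "norm ((f (a + v) - f a - f1 a v) - (f (b + w) - f b - f1 b w))
    \<le> (c * norm (v - w) + c * (2 * norm (a - b) + norm (v - w)) * norm v) * norm v
      + c * norm w * norm (v - w)"
proof -
  define k where "k \<tau> = (f (a + \<tau> *\<^sub>R v) - \<tau> *\<^sub>R f1 a v) - (f (b + \<tau> *\<^sub>R w) - \<tau> *\<^sub>R f1 b w)"
    for \<tau> :: real
  have "norm (k 1 - k 0)
    \<le> (c * norm (v - w) + c * (2 * norm (a - b) + norm (v - w)) * norm v) * norm v
      + c * norm w * norm (v - w)"
  proof (rule norm_increment_le_unit_interval)
    fix \<tau> :: real assume t: "0 \<le> \<tau>" "\<tau> \<le> 1"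
    define y z where "y = a + \<tau> *\<^sub>R v" and "z = b + \<tau> *\<^sub>R w"
    show "(k has_vector_derivative (f1 y v - f1 a v) - (f1 z w - f1 b w)) (at \<tau>)"
      unfolding k_def y_def z_def
      by (intro has_vector_derivative_diff has_vector_derivative_along_line f1)
        (auto intro!: derivative_eq_intros simp: has_vector_derivative_def)
    have shrink: "\<tau> * norm u \<le> norm u" for u :: 'a
      using t mult_right_mono[of \<tau> 1 "norm u"] by simp
    have "(y - a) - (z - b) = \<tau> *\<^sub>R (v - w)" by (simp add: y_def z_def algebra_simps)
    then have d1: "norm ((y - a) - (z - b)) \<le> norm (v - w)" using shrink t by simp
    have "y - z = (a - b) + \<tau> *\<^sub>R (v - w)" by (simp add: y_def z_def algebra_simps)
    then have "norm (y - z) \<le> norm (a - b) + norm (\<tau> *\<^sub>R (v - w))"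
      by (metis norm_triangle_ineq)
    then have d2: "norm (y - z) + norm (a - b) \<le> 2 * norm (a - b) + norm (v - w)"
      using shrink[of "v - w"] t by simp
    have d3: "norm (y - a) \<le> norm v" using shrink t by (simp add: y_def)
    have d4: "norm (z - b) \<le> norm w" using shrink t by (simp add: z_def)
    have "norm ((f1 y - f1 a) - (f1 z - f1 b))
        \<le> c * norm ((y - a) - (z - b)) + c * (norm (y - z) + norm (a - b)) * norm (y - a)"
      by (rule c(3))
    also have "\<dots> \<le> c * norm (v - w) + c * (2 * norm (a - b) + norm (v - w)) * norm v"
    proof (intro add_mono)
      show "c * norm ((y - a) - (z - b)) \<le> c * norm (v - w)" using d1 c(1) by (rule mult_left_mono)
      have "c * (norm (y - z) + norm (a - b)) \<le> c * (2 * norm (a - b) + norm (v - w))"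
        using d2 c(1) by (rule mult_left_mono)
      then show "c * (norm (y - z) + norm (a - b)) * norm (y - a)
          \<le> c * (2 * norm (a - b) + norm (v - w)) * norm v"
        using d3 by (rule mult_mono) (use c(1) in auto)
    qed
    finally have "norm (((f1 y - f1 a) - (f1 z - f1 b)) v)
        \<le> (c * norm (v - w) + c * (2 * norm (a - b) + norm (v - w)) * norm v) * norm v"
      by (intro norm_blinfun_le) auto
    moreover have "norm (f1 z - f1 b) \<le> c * norm w"
      using c(2)[of z b] mult_left_mono[OF d4 c(1)] by linarith
    then have "norm ((f1 z - f1 b) (v - w)) \<le> c * norm w * norm (v - w)"
      by (intro norm_blinfun_le) auto
    moreover have "(f1 y v - f1 a v) - (f1 z w - f1 b w)
        = ((f1 y - f1 a) - (f1 z - f1 b)) v + (f1 z - f1 b) (v - w)"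
      by (simp add: blinfun.diff_left blinfun.diff_right)
    ultimately show "norm ((f1 y v - f1 a v) - (f1 z w - f1 b w))
        \<le> (c * norm (v - w) + c * (2 * norm (a - b) + norm (v - w)) * norm v) * norm v
          + c * norm w * norm (v - w)"
      by (metis norm_triangle_mono)
  qed
  moreover have "k 1 - k 0 = (f (a + v) - f a - f1 a v) - (f (b + w) - f b - f1 b w)"
    by (simp add: k_def algebra_simps)
  ultimately show ?thesis by simp
qed

section \<open>One step of the second-order scheme\<close>

text \<open>
  \<open>G y A\<close> stands for \<open>DF(y)F(y)A\<close>.  It is treated as an abstract map that is additive in the
  second-level argument \<open>A\<close> and equals \<open>DF(y)(F(y)x)x'\<close> at \<open>tens x x'\<close>, with the regularity of a map
  whose derivative is bounded and Lipschitz.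
\<close>

locale second_order_field =
  fixes F :: "'e::real_normed_vector \<Rightarrow> 'd::real_normed_vector \<Rightarrow>\<^sub>L 'e"
    and F1 :: "'e \<Rightarrow> 'e \<Rightarrow>\<^sub>L 'd \<Rightarrow>\<^sub>L 'e"
    and G :: "'e \<Rightarrow> 'm::real_normed_vector \<Rightarrow> 'e"
    and tens :: "'d \<Rightarrow> 'd \<Rightarrow> 'm"
    and c :: real
  assumes c_nonneg: "0 \<le> c"
    and deriv: "\<And>y. (F has_derivative blinfun_apply (F1 y)) (at y)"
    and F_bound: "\<And>y. norm (F y) \<le> c"
    and F1_bound: "\<And>y. norm (F1 y) \<le> c"
    and F1_lipschitz: "\<And>y z. norm (F1 y - F1 z) \<le> c * norm (y - z)"
    and F1_second_difference: "\<And>a b a' b'. norm ((F1 a - F1 b) - (F1 a' - F1 b'))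
        \<le> c * norm ((a - b) - (a' - b')) + c * (norm (a - a') + norm (b - b')) * norm (a - b)"
    and G_add: "\<And>y A B. G y (A + B) = G y A + G y B"
    and G_bound: "\<And>y A. norm (G y A) \<le> c * norm A"
    and G_lipschitz: "\<And>y z A. norm (G y A - G z A) \<le> c * norm A * norm (y - z)"
    and G_second_difference: "\<And>a b a' b' A. norm ((G a A - G b A) - (G a' A - G b' A))
        \<le> c * norm A * (norm ((a - b) - (a' - b')) + (norm (a - a') + norm (b - b')) * norm (a - b))"
    and G_tens: "\<And>y x x'. G y (tens x x') = F1 y (F y x) x'"
begin

definition step :: "'d \<Rightarrow> 'm \<Rightarrow> 'e \<Rightarrow> 'e" where
  "step x A a = a + (F a x + G a A)"

lemma F_lipschitz: "norm (F a - F b) \<le> c * norm (a - b)"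
  using deriv F1_bound by (rule lipschitz_of_bounded_derivative)

lemma F_second_difference: "norm ((F a - F b) - (F a' - F b'))
    \<le> c * norm ((a - b) - (a' - b')) + c * (norm (a - a') + norm (b - b')) * norm (a - b)"
  by (rule second_difference_bound[OF deriv c_nonneg F1_bound F1_lipschitz])

lemma F_apply_bound: "norm (F a x) \<le> c * norm x"
  by (rule norm_blinfun_le[OF F_bound order_refl])

lemma F_apply_lipschitz: "norm (F a x - F b x) \<le> c * norm x * norm (a - b)"
  using norm_blinfun_le[OF F_lipschitz order_refl, of a b x] by (simp add: blinfun.diff_left mult_ac)

lemma step_displacement: "norm (step x A a - a) \<le> c * (norm x + norm A)"
  using norm_triangle_le[OF add_mono[OF F_apply_bound[of a x] G_bound[of a A]]]
  by (simp add: step_def distrib_left)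

lemma displacement_lipschitz:
  "norm ((step x A a - a) - (step x A b - b)) \<le> c * (norm x + norm A) * norm (a - b)"
proof -
  have eq: "(step x A a - a) - (step x A b - b) = (F a x - F b x) + (G a A - G b A)"
    by (simp add: step_def)
  have "norm ((step x A a - a) - (step x A b - b)) \<le> c * norm x * norm (a - b) + c * norm A * norm (a - b)"
    unfolding eq by (rule norm_triangle_mono[OF F_apply_lipschitz G_lipschitz])
  then show ?thesis by (simp add: algebra_simps)
qed

lemma step_lipschitz: "norm (step x A a - step x A b) \<le> (1 + c * (norm x + norm A)) * norm (a - b)"
proof -
  have "step x A a - step x A b = (a - b) + ((step x A a - a) - (step x A b - b))" by simp
  then have "norm (step x A a - step x A b) \<le> norm (a - b) + norm ((step x A a - a) - (step x A b - b))"
    by (metis norm_triangle_ineq)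
  then show ?thesis using displacement_lipschitz[of x A a b] by (simp add: distrib_right)
qed

lemma step_second_difference:
  "norm ((step x A a - step x A b) - (step x A a' - step x A b'))
    \<le> (1 + c * (norm x + norm A)) * norm ((a - b) - (a' - b'))
      + c * (norm x + norm A) * (norm (a - a') + norm (b - b')) * norm (a - b)"
proof -
  define D where "D = norm ((a - b) - (a' - b'))"
  define S where "S = (norm (a - a') + norm (b - b')) * norm (a - b)"
  have "norm (((F a - F b) - (F a' - F b')) x) \<le> (c * D + c * S) * norm x"
    using F_second_difference[of a b a' b']
    by (intro norm_blinfun_le) (auto simp: D_def S_def mult.assoc)
  moreover have "norm ((G a A - G b A) - (G a' A - G b' A)) \<le> c * norm A * (D + S)"
    using G_second_difference[of a A b a' b'] by (simp add: D_def S_def)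
  moreover have "(step x A a - step x A b) - (step x A a' - step x A b') = ((a - b) - (a' - b'))
      + (((F a - F b) - (F a' - F b')) x + ((G a A - G b A) - (G a' A - G b' A)))"
    by (simp add: step_def blinfun.diff_left)
  ultimately have "norm ((step x A a - step x A b) - (step x A a' - step x A b'))
      \<le> D + ((c * D + c * S) * norm x + c * norm A * (D + S))"
    unfolding D_def by (metis norm_triangle_mono order_refl)
  also have "\<dots> = (1 + c * (norm x + norm A)) * D + c * (norm x + norm A) * S"
    by (simp add: algebra_simps)
  finally show ?thesis by (simp add: D_def S_def mult.assoc)
qed

text \<open>
  The left-hand side is what remains when a step from \<open>y\<close> is compared with its second-order expansion
  at \<open>a\<close>.  It occurs both for the scheme, with \<open>y\<close> the result of a step from \<open>a\<close>, and for a given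
  solution, with \<open>a\<close> and \<open>y\<close> two of its values.
\<close>

lemma local_error_bound:
  "norm ((F y - F a - F1 a (F a x)) x' + (G y A' - G a A'))
    \<le> c * (norm (y - a) * norm (y - a) + norm (y - a - F a x)) * norm x'
      + c * norm A' * norm (y - a)"
proof -
  have "norm (F y - F a - F1 a (y - a)) \<le> c * norm (y - a) * norm (y - a)"
    using taylor_remainder_bound[OF deriv c_nonneg F1_lipschitz, of a "y - a"] by simp
  moreover have "norm (F1 a (y - a - F a x)) \<le> c * norm (y - a - F a x)"
    by (intro norm_blinfun_le F1_bound) auto
  moreover have "F y - F a - F1 a (F a x) = (F y - F a - F1 a (y - a)) + F1 a (y - a - F a x)"
    by (simp add: blinfun.diff_right)
  ultimately have "norm (F y - F a - F1 a (F a x))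
      \<le> c * norm (y - a) * norm (y - a) + c * norm (y - a - F a x)"
    by (metis norm_triangle_mono)
  then have "norm (F y - F a - F1 a (F a x))
      \<le> c * (norm (y - a) * norm (y - a) + norm (y - a - F a x))"
    by (simp add: distrib_left mult.assoc)
  then have "norm ((F y - F a - F1 a (F a x)) x')
      \<le> c * (norm (y - a) * norm (y - a) + norm (y - a - F a x)) * norm x'"
    by (intro norm_blinfun_le) auto
  then show ?thesis using G_lipschitz by (rule norm_triangle_mono)
qed

definition defect :: "'d \<Rightarrow> 'm \<Rightarrow> 'd \<Rightarrow> 'm \<Rightarrow> 'e \<Rightarrow> 'e" where
  "defect x A x' A' a = (F (step x A a) - F a - F1 a (F a x)) x' + (G (step x A a) A' - G a A')"

text \<open>
  With the increments related as in Chen's relation, the first-order terms cancel, and the tensor term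
  cancels the second-order term \<open>DF(a)(F(a)x)x'\<close>.
\<close>

lemma step_compose:
  "step x' A' (step x A a) - step (x + x') (A + A' + tens x x') a = defect x A x' A' a"
  by (simp add: step_def[of x'] step_def[of "x + x'"] defect_def G_add G_tens
      blinfun.diff_left blinfun.add_right) (simp add: step_def)

lemma defect_bound:
  "norm (defect x A x' A' a) \<le> c * (c * (norm x + norm A) * (c * (norm x + norm A)) + c * norm A) * norm x'
      + c * norm A' * (c * (norm x + norm A))"
proof -
  define d where "d = c * (norm x + norm A)"
  have d: "norm (step x A a - a) \<le> d" unfolding d_def by (rule step_displacement)
  have "norm (step x A a - a) * norm (step x A a - a) \<le> d * d"
    using d by (intro mult_mono) (auto simp: d_def c_nonneg)
  moreover have "norm (step x A a - a - F a x) \<le> c * norm A"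
    using G_bound[of a A] by (simp add: step_def)
  ultimately have "c * (norm (step x A a - a) * norm (step x A a - a) + norm (step x A a - a - F a x)) * norm x'
      \<le> c * (d * d + c * norm A) * norm x'"
    using c_nonneg by (intro mult_right_mono mult_left_mono add_mono) auto
  moreover have "c * norm A' * norm (step x A a - a) \<le> c * norm A' * d"
    using d c_nonneg by (intro mult_left_mono) auto
  ultimately show ?thesis
    using local_error_bound[of "step x A a" a x x' A'] unfolding defect_def d_def by linarith
qed

text \<open>
  The part of the defect that involves \<open>F\<close> is split into the Taylor remainder at \<open>a\<close> in direction
  \<open>F a x\<close> and the effect of the additional displacement \<open>G a A\<close>, which is of second order by itself.
\<close>

lemma defect_lipschitz:
  "norm (defect x A x' A' a - defect x A x' A' b) \<le>
     ((c * (c * norm x) + c * (2 + c * norm x) * (c * norm x)) * (c * norm x)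
       + c * (c * norm x) * (c * norm x)
       + (c * (c * norm A) + c * (2 + 2 * (c * (norm x + norm A))) * (c * norm A))) * norm (a - b) * norm x'
     + c * norm A' * ((c * (norm x + norm A)
         + (2 + c * (norm x + norm A)) * (c * (norm x + norm A))) * norm (a - b))"
proof -
  define d where "d = norm (a - b)"
  define q where "q = c * norm x"
  define r where "r = c * norm A"
  have pos: "0 \<le> d" "0 \<le> q" "0 \<le> r" using c_nonneg by (auto simp: d_def q_def r_def)
  have qr: "c * (norm x + norm A) = q + r" by (simp add: q_def r_def distrib_left)
  define y z v w where "y = step x A a" and "z = step x A b" and "v = F a x" and "w = F b x"
  have v: "norm v \<le> q" and w: "norm w \<le> q" and vw: "norm (v - w) \<le> q * d"
    using F_apply_bound F_apply_lipschitz by (auto simp: v_def w_def q_def d_def)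
  have yz: "norm (y - z) \<le> (1 + (q + r)) * d"
    using step_lipschitz[of x A a b] by (simp add: y_def z_def d_def qr)
  have ya: "y - (a + v) = G a A" "z - (b + w) = G b A"
    by (simp_all add: y_def z_def v_def w_def step_def)
  have avbw: "norm ((a + v) - (b + w)) \<le> (1 + (q + r)) * d"
  proof -
    have "norm ((a + v) - (b + w)) \<le> norm (a - b) + norm (v - w)"
      using norm_triangle_ineq[of "a - b" "v - w"] by (simp add: algebra_simps)
    also have "\<dots> \<le> d + q * d" using vw by (simp add: d_def)
    also have "\<dots> \<le> (1 + (q + r)) * d" using pos by (simp add: algebra_simps)
    finally show ?thesis .
  qed
  have "norm ((F (a + v) - F a - F1 a v) - (F (b + w) - F b - F1 b w))
    \<le> (c * norm (v - w) + c * (2 * norm (a - b) + norm (v - w)) * norm v) * norm v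
      + c * norm w * norm (v - w)"
    by (rule taylor_remainder_difference[OF deriv c_nonneg F1_lipschitz F1_second_difference])
  also have "\<dots> \<le> (c * (q * d) + c * (2 * d + q * d) * q) * q + c * q * (q * d)"
    using v w vw pos c_nonneg unfolding d_def[symmetric]
    by (intro add_mono mult_mono[OF add_mono] mult_mono[OF mult_left_mono] mult_left_mono order_refl)
      (auto intro!: mult_nonneg_nonneg add_nonneg_nonneg)
  finally have 1: "norm ((F (a + v) - F a - F1 a v) - (F (b + w) - F b - F1 b w))
    \<le> (c * (q * d) + c * (2 * d + q * d) * q) * q + c * q * (q * d)" .
  have "norm ((F y - F (a + v)) - (F z - F (b + w)))
    \<le> c * norm (G a A - G b A) + c * (norm (y - z) + norm ((a + v) - (b + w))) * norm (G a A)"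
    using F_second_difference[of y "a + v" z "b + w"] unfolding ya .
  also have "\<dots> \<le> c * (r * d) + c * ((1 + (q + r)) * d + (1 + (q + r)) * d) * r"
    using G_lipschitz[of a A b] G_bound[of a A] yz avbw pos c_nonneg
    unfolding d_def[symmetric] r_def[symmetric]
    by (intro add_mono mult_mono[OF mult_left_mono] mult_left_mono)
      (auto intro!: mult_nonneg_nonneg add_nonneg_nonneg)
  finally have 2: "norm ((F y - F (a + v)) - (F z - F (b + w)))
    \<le> c * (r * d) + c * ((1 + (q + r)) * d + (1 + (q + r)) * d) * r" .
  have eq: "(F y - F a - F1 a v) - (F z - F b - F1 b w)
      = ((F (a + v) - F a - F1 a v) - (F (b + w) - F b - F1 b w))
        + ((F y - F (a + v)) - (F z - F (b + w)))" by simp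
  have "norm ((F y - F a - F1 a v) - (F z - F b - F1 b w))
      \<le> ((c * (q * d) + c * (2 * d + q * d) * q) * q + c * q * (q * d))
        + (c * (r * d) + c * ((1 + (q + r)) * d + (1 + (q + r)) * d) * r)"
    unfolding eq by (rule norm_triangle_mono[OF 1 2])
  then have "norm (((F y - F a - F1 a v) - (F z - F b - F1 b w)) x')
      \<le> (((c * (q * d) + c * (2 * d + q * d) * q) * q + c * q * (q * d))
        + (c * (r * d) + c * ((1 + (q + r)) * d + (1 + (q + r)) * d) * r)) * norm x'"
    by (intro norm_blinfun_le) auto
  also have "\<dots> = ((c * q + c * (2 + q) * q) * q + c * q * q
      + (c * r + c * (2 + 2 * (q + r)) * r)) * d * norm x'"
    by (simp add: algebra_simps)
  finally have 3: "norm (((F y - F a - F1 a v) - (F z - F b - F1 b w)) x')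
      \<le> ((c * q + c * (2 + q) * q) * q + c * q * q
      + (c * r + c * (2 + 2 * (q + r)) * r)) * d * norm x'" .
  have "norm ((G y A' - G a A') - (G z A' - G b A'))
    \<le> c * norm A' * (norm ((y - a) - (z - b)) + (norm (y - z) + norm (a - b)) * norm (y - a))"
    by (rule G_second_difference)
  also have "\<dots> \<le> c * norm A' * ((q + r) * d + ((1 + (q + r)) * d + d) * (q + r))"
    using displacement_lipschitz[of x A a b] step_displacement[of x A a] yz pos c_nonneg
    unfolding y_def[symmetric] z_def[symmetric] d_def[symmetric] qr
    by (intro mult_left_mono add_mono mult_mono) auto
  also have "\<dots> = c * norm A' * (((q + r) + (2 + (q + r)) * (q + r)) * d)"
    by (simp add: algebra_simps)
  finally have 4: "norm ((G y A' - G a A') - (G z A' - G b A'))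
    \<le> c * norm A' * (((q + r) + (2 + (q + r)) * (q + r)) * d)" .
  have "defect x A x' A' a - defect x A x' A' b
    = ((F y - F a - F1 a v) - (F z - F b - F1 b w)) x' + ((G y A' - G a A') - (G z A' - G b A'))"
    by (simp add: defect_def y_def z_def v_def w_def blinfun.diff_left)
  then show ?thesis
    using norm_triangle_mono[OF 3 4] unfolding qr by (simp add: q_def r_def d_def)
qed

end


section \<open>Variation controls\<close>

text \<open>
  The \<open>q\<close>-th power of the \<open>q\<close>-variation of \<open>\<Xi>\<close> on \<open>[s, t]\<close>, which is superadditive because
  partitions of adjacent intervals can be joined.
\<close>

definition variation_control ::
  "real \<Rightarrow> (real \<Rightarrow> real \<Rightarrow> 'a::real_normed_vector) \<Rightarrow> real \<Rightarrow> real \<Rightarrow> real" where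
  "variation_control q \<Xi> s t =
     (SUP P\<in>{P. partition_points s t P}. partition_sum (\<lambda>u v. norm (\<Xi> u v) powr q) P)"

lemma partition_sum_nonneg:
  fixes f :: "real \<Rightarrow> real \<Rightarrow> real"
  assumes "\<And>u v. 0 \<le> f u v"
  shows "0 \<le> partition_sum f P"
  unfolding partition_sum_def using assms by (intro sum_nonneg) auto

lemma partition_points_pair: "a \<le> b \<Longrightarrow> partition_points a b {a, b}"
  by (auto simp: partition_points_def)

lemma partition_sum_pair: "a < b \<Longrightarrow> partition_sum \<Xi> {a, b} = \<Xi> a b"
  using partition_sum_Cons[of a b b "{b}" \<Xi>] by simp

lemma
  assumes fin: "finite_variation2 q T \<Xi>"
  shows control_variation_control: "control T (variation_control q \<Xi>)"
    and powr_le_variation_control: "\<And>s t. \<lbrakk>0 \<le> s; s < t; t \<le> T\<rbrakk> \<Longrightarrow>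
      norm (\<Xi> s t) powr q \<le> variation_control q \<Xi> s t"
proof -
  let ?S = "partition_sum (\<lambda>u v. norm (\<Xi> u v) powr q)"
  let ?V = "variation_control q \<Xi>"
  have S0: "0 \<le> ?S P" for P by (rule partition_sum_nonneg) auto
  obtain B where B: "\<And>P. partition_points 0 T P \<Longrightarrow> ?S P \<le> B"
    using fin unfolding finite_variation2_def bdd_above_def by blast
  have bound: "?S P \<le> B" if "0 \<le> s" "t \<le> T" "partition_points s t P" for s t P
  proof -
    have "s \<le> t" using that(3) by (rule partition_points_le)
    have 1: "partition_points 0 t ({0, s} \<union> P)" "?S ({0, s} \<union> P) = ?S {0, s} + ?S P"
      using partition_append[OF partition_points_pair[OF that(1)] that(3)] by auto
    have "partition_points 0 T (({0, s} \<union> P) \<union> {t, T})"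
      "?S (({0, s} \<union> P) \<union> {t, T}) = ?S ({0, s} \<union> P) + ?S {t, T}"
      using partition_append[OF 1(1) partition_points_pair[OF that(2)]] by auto
    then show ?thesis using B 1(2) S0[of "{0, s}"] S0[of "{t, T}"] by fastforce
  qed
  have upper: "?S P \<le> ?V s t" if "0 \<le> s" "t \<le> T" "partition_points s t P" for s t P
    unfolding variation_control_def using that bound
    by (intro cSUP_upper) (auto intro!: bdd_aboveI2[where M = B])
  have least: "?V s t \<le> c" if "s \<le> t" "\<And>P. partition_points s t P \<Longrightarrow> ?S P \<le> c" for s t c
    unfolding variation_control_def using that partition_points_pair[of s t]
    by (intro cSUP_least) auto
  show "control T ?V"
  proof
    fix s t assume "0 \<le> s" "s \<le> t" "t \<le> T"
    then show "0 \<le> ?V s t"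
      using upper[OF _ _ partition_points_pair[of s t]] S0[of "{s, t}"] by fastforce
  next
    fix s u t assume st: "0 \<le> s" "s \<le> u" "u \<le> t" "t \<le> T"
    have "?V s u \<le> ?V s t - ?V u t"
    proof (rule least[OF st(2)])
      fix P assume P: "partition_points s u P"
      have "?V u t \<le> ?V s t - ?S P"
      proof (rule least[OF st(3)])
        fix Q assume Q: "partition_points u t Q"
        show "?S Q \<le> ?V s t - ?S P"
          using upper[OF st(1,4) partition_append(1)[OF P Q]]
            partition_append(2)[OF P Q, of "\<lambda>u v. norm (\<Xi> u v) powr q"] by simp
      qed
      then show "?S P \<le> ?V s t - ?V u t" by simp
    qed
    then show "?V s u + ?V u t \<le> ?V s t" by simp
  qed
  show "norm (\<Xi> s t) powr q \<le> ?V s t" if "0 \<le> s" "s < t" "t \<le> T" for s t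
    using upper[OF that(1,3) partition_points_pair[of s t]] that(2) by (simp add: partition_sum_pair)
qed

text \<open>
  The \<open>q\<close>-th powers of the increments are bounded by multiples of \<open>\<omega>\<close>, whose sum over any partition is at most
  its value on the whole interval.
\<close>

lemma (in control) finite_variation_of_control_bound:
  assumes "0 < q" "0 \<le> C"
    and "\<And>s t. \<lbrakk>0 \<le> s; s < t; t \<le> T\<rbrakk> \<Longrightarrow> norm (\<Xi> s t) \<le> C * \<omega> s t powr (1 / q)"
  shows "finite_variation2 q T \<Xi>"
  unfolding finite_variation2_def
proof (rule bdd_aboveI[where M = "C powr q * \<omega> 0 T"])
  fix x assume "x \<in> {partition_sum (\<lambda>s t. norm (\<Xi> s t) powr q) P |P. partition_points 0 T P}"
  then obtain P where P: "partition_points 0 T P"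
    and x: "x = partition_sum (\<lambda>s t. norm (\<Xi> s t) powr q) P" by blast
  have "x \<le> partition_sum (\<lambda>s t. C powr q * \<omega> s t) P"
    unfolding x
  proof (rule partition_sum_mono[OF P])
    fix u v assume uv: "0 \<le> u" "u < v" "v \<le> T"
    have "norm (\<Xi> u v) powr q \<le> (C * \<omega> u v powr (1 / q)) powr q"
      using assms uv by (intro powr_mono2) auto
    also have "\<dots> = C powr q * \<omega> u v"
      using assms nonneg[of u v] uv by (simp add: powr_mult powr_powr)
    finally show "norm (\<Xi> u v) powr q \<le> C powr q * \<omega> u v" .
  qed
  also have "\<dots> = C powr q * partition_sum \<omega> P" by (rule partition_sum_cmult)
  also have "\<dots> \<le> C powr q * \<omega> 0 T"
    using P by (intro mult_left_mono partition_sum_control_le) auto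
  finally show "x \<le> C powr q * \<omega> 0 T" .
qed

lemma control_add:
  assumes "control T \<omega>" "control T \<omega>'"
  shows "control T (\<lambda>s t. \<omega> s t + \<omega>' s t)"
proof -
  interpret a: control T \<omega> by fact
  interpret b: control T \<omega>' by fact
  show ?thesis
  proof
    fix s t :: real assume "0 \<le> s" "s \<le> t" "t \<le> T"
    then show "0 \<le> \<omega> s t + \<omega>' s t" using a.nonneg[of s t] b.nonneg[of s t] by simp
  next
    fix s u t :: real assume "0 \<le> s" "s \<le> u" "u \<le> t" "t \<le> T"
    then show "\<omega> s u + \<omega>' s u + (\<omega> u t + \<omega>' u t) \<le> \<omega> s t + \<omega>' s t"
      using a.superadditive[of s u t] b.superadditive[of s u t] by simp
  qed
qed

lemma le_powr_inverse:
  assumes "norm x powr q \<le> w" "0 < q"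
  shows "norm x \<le> w powr (1 / q)"
proof -
  have "norm x = (norm x powr q) powr (1 / q)" using assms(2) by (simp add: powr_powr)
  also have "\<dots> \<le> w powr (1 / q)" using assms by (intro powr_mono2) auto
  finally show ?thesis .
qed

text \<open>
  The product has total degree \<open>3 / p > 1\<close> and degree at least \<open>1 / p\<close> in the smaller of \<open>a\<close> and
  \<open>b\<close>.  Since \<open>p \<ge> 2\<close> gives \<open>3 / p - 1 \<le> 1 / p\<close>, the excess \<open>3 / p - 1\<close> over degree one can be taken
  entirely from the smaller one.
\<close>

lemma powr_split_min:
  fixes a b w p :: real
  assumes p: "2 \<le> p" "p < 3" and ab: "0 \<le> a" "a \<le> w" "0 \<le> b" "b \<le> w"
  shows "a powr (1 / p) * a powr (1 / p) * b powr (1 / p) \<le> min a b powr (3 / p - 1) * w"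
proof (cases "min a b = 0")
  case True
  then have "a = 0 \<or> b = 0" by (auto simp: min_def split: if_splits)
  then show ?thesis using ab by auto
next
  case False
  define m where "m = min a b"
  have m: "0 < m" "m \<le> w" using False ab by (auto simp: m_def min_def split: if_splits)
  define W where "W = w powr (1 / p)"
  have aW: "a powr (1 / p) \<le> W" and bW: "b powr (1 / p) \<le> W"
    using ab p by (auto simp: W_def intro!: powr_mono2)
  have "a powr (1 / p) * a powr (1 / p) * b powr (1 / p) \<le> m powr (1 / p) * (W * W)"
  proof (cases "a \<le> b")
    case True
    then have "a powr (1 / p) * a powr (1 / p) * b powr (1 / p)
        = m powr (1 / p) * (a powr (1 / p) * b powr (1 / p))" by (simp add: m_def)
    also have "\<dots> \<le> m powr (1 / p) * (W * W)"
      using aW bW by (intro mult_left_mono mult_mono) (auto simp: W_def)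
    finally show ?thesis .
  next
    case False
    then have "a powr (1 / p) * a powr (1 / p) * b powr (1 / p)
        = m powr (1 / p) * (a powr (1 / p) * a powr (1 / p))" by (simp add: m_def)
    also have "\<dots> \<le> m powr (1 / p) * (W * W)"
      using aW by (intro mult_left_mono mult_mono) (auto simp: W_def)
    finally show ?thesis .
  qed
  also have "m powr (1 / p) = m powr (3 / p - 1) * m powr (1 - 2 / p)"
    by (simp add: powr_add[symmetric] field_simps)
  also have "\<dots> * (W * W) \<le> m powr (3 / p - 1) * w powr (1 - 2 / p) * (W * W)"
    using m p by (intro mult_right_mono mult_left_mono powr_mono2) (auto simp: W_def field_simps)
  also have "\<dots> = m powr (3 / p - 1) * (w powr (1 - 2 / p) * (W * W))" by simp
  also have "w powr (1 - 2 / p) * (W * W) = w powr 1"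
    unfolding W_def by (simp only: powr_add[symmetric]) (simp add: field_simps)
  also have "w powr 1 = w" using m by simp
  finally show ?thesis by (simp add: m_def)
qed

section \<open>The scheme driven by a rough path\<close>

context second_order_field
begin

text \<open>
  First-level increments have size \<open>\<rho>\<close>, second-level increments size \<open>\<rho>\<close> squared; terms of
  degree higher than three are absorbed by the bound \<open>R\<close> on \<open>\<rho>\<close>.
\<close>

lemma defect_bound_homogeneous:
  assumes \<rho>: "0 \<le> \<rho>" "\<rho> \<le> R" "norm x \<le> \<rho>" "norm A \<le> \<rho> * \<rho>"
    and \<sigma>: "0 \<le> \<sigma>" "norm x' \<le> \<sigma>" "norm A' \<le> \<sigma> * \<sigma>"
  shows "norm (defect x A x' A' a) \<le>
    c * (c * (1 + R) * (c * (1 + R)) + c) * (\<rho> * \<rho> * \<sigma>) + c * (c * (1 + R)) * (\<sigma> * \<sigma> * \<rho>)"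
proof -
  have "\<rho> * \<rho> \<le> R * \<rho>" using \<rho> by (intro mult_right_mono) auto
  then have "norm x + norm A \<le> (1 + R) * \<rho>" using \<rho> by (simp add: distrib_right)
  then have M: "c * (norm x + norm A) \<le> c * ((1 + R) * \<rho>)" by (intro mult_left_mono c_nonneg)
  have "norm (defect x A x' A' a) \<le>
      c * (c * (norm x + norm A) * (c * (norm x + norm A)) + c * norm A) * norm x'
      + c * norm A' * (c * (norm x + norm A))" by (rule defect_bound)
  also have "\<dots> \<le> c * (c * ((1 + R) * \<rho>) * (c * ((1 + R) * \<rho>)) + c * (\<rho> * \<rho>)) * \<sigma>
      + c * (\<sigma> * \<sigma>) * (c * ((1 + R) * \<rho>))"
    using M \<rho> \<sigma> c_nonneg
    by (intro add_mono[OF mult_mono[OF mult_left_mono[OF add_mono[OF mult_mono mult_left_mono]]]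
          mult_mono[OF mult_left_mono]]) (auto intro!: add_nonneg_nonneg mult_nonneg_nonneg)
  also have "\<dots> = c * (c * (1 + R) * (c * (1 + R)) + c) * (\<rho> * \<rho> * \<sigma>) + c * (c * (1 + R)) * (\<sigma> * \<sigma> * \<rho>)"
    by (simp add: algebra_simps)
  finally show ?thesis .
qed

lemma defect_lipschitz_homogeneous:
  assumes \<rho>: "0 \<le> \<rho>" "\<rho> \<le> R" "norm x \<le> \<rho>" "norm A \<le> \<rho> * \<rho>" "norm x' \<le> \<rho>" "norm A' \<le> \<rho> * \<rho>"
    and M: "M = c * (1 + R)"
  shows "norm (defect x A x' A' a - defect x A x' A' b) \<le>
    (((c * M + c * (2 + M * R) * M) * M + c * M * M + (c * M + c * (2 + 2 * (M * R)) * M))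
      + c * (M + (2 + M * R) * M)) * (\<rho> * \<rho> * \<rho>) * norm (a - b)"
proof -
  have R: "0 \<le> R" using \<rho> by simp
  have M0: "0 \<le> M" using M c_nonneg R by simp
  have \<rho>\<rho>: "\<rho> * \<rho> \<le> R * \<rho>" using \<rho> by (intro mult_right_mono) auto
  then have "norm x + norm A \<le> (1 + R) * \<rho>" using \<rho> by (simp add: distrib_right)
  then have N: "c * (norm x + norm A) \<le> M * \<rho>"
    unfolding M mult.assoc by (intro mult_left_mono c_nonneg)
  have "M * \<rho> \<le> M * R" using \<rho> M0 by (intro mult_left_mono) auto
  then have N': "c * (norm x + norm A) \<le> M * R" using N by simp
  have cM: "c \<le> M" using M c_nonneg R by (simp add: distrib_left)
  have q: "c * norm x \<le> M * \<rho>" using cM \<rho> c_nonneg by (intro mult_mono) auto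
  have q': "c * norm x \<le> M * R" using q \<open>M * \<rho> \<le> M * R\<close> by simp
  have r: "c * norm A \<le> M * (\<rho> * \<rho>)" using cM \<rho> c_nonneg M0 by (intro mult_mono) auto
  define q0 r0 n0 d where "q0 = c * norm x" and "r0 = c * norm A"
    and "n0 = c * (norm x + norm A)" and "d = norm (a - b)"
  note pos = c_nonneg M0 R \<rho>(1)
  have nn: "0 \<le> q0" "0 \<le> r0" "0 \<le> n0" "0 \<le> d" using c_nonneg by (auto simp: q0_def r0_def n0_def d_def)
  have le: "q0 \<le> M * \<rho>" "q0 \<le> M * R" "r0 \<le> M * (\<rho> * \<rho>)" "n0 \<le> M * \<rho>" "n0 \<le> M * R"
    using q q' r N N' by (auto simp: q0_def r0_def n0_def)
  have t1: "c * q0 \<le> c * (M * \<rho>)" using le nn pos by (intro mult_left_mono) auto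
  have t2: "c * (2 + q0) * q0 \<le> c * (2 + M * R) * (M * \<rho>)"
    using le nn pos by (intro mult_mono[OF mult_left_mono]) auto
  have t3: "(c * q0 + c * (2 + q0) * q0) * q0 \<le> (c * (M * \<rho>) + c * (2 + M * R) * (M * \<rho>)) * (M * \<rho>)"
    using t1 t2 le nn pos by (intro mult_mono[OF add_mono]) auto
  have t4: "c * q0 * q0 \<le> c * (M * \<rho>) * (M * \<rho>)"
    using t1 le nn pos by (intro mult_mono) auto
  have t5: "c * r0 + c * (2 + 2 * n0) * r0 \<le> c * (M * (\<rho> * \<rho>)) + c * (2 + 2 * (M * R)) * (M * (\<rho> * \<rho>))"
    using le nn pos by (intro add_mono mult_mono[OF mult_left_mono] mult_left_mono) auto
  have t6: "n0 + (2 + n0) * n0 \<le> M * \<rho> + (2 + M * R) * (M * \<rho>)"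
    using le nn pos by (intro add_mono mult_mono) auto
  have "norm (defect x A x' A' a - defect x A x' A' b) \<le>
      ((c * q0 + c * (2 + q0) * q0) * q0 + c * q0 * q0 + (c * r0 + c * (2 + 2 * n0) * r0)) * d * norm x'
      + c * norm A' * ((n0 + (2 + n0) * n0) * d)"
    unfolding q0_def r0_def n0_def d_def by (rule defect_lipschitz)
  also have "\<dots> \<le> ((c * (M * \<rho>) + c * (2 + M * R) * (M * \<rho>)) * (M * \<rho>) + c * (M * \<rho>) * (M * \<rho>)
      + (c * (M * (\<rho> * \<rho>)) + c * (2 + 2 * (M * R)) * (M * (\<rho> * \<rho>)))) * d * \<rho>
      + c * (\<rho> * \<rho>) * ((M * \<rho> + (2 + M * R) * (M * \<rho>)) * d)"
  proof (rule add_mono)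
    show "((c * q0 + c * (2 + q0) * q0) * q0 + c * q0 * q0 + (c * r0 + c * (2 + 2 * n0) * r0)) * d * norm x'
        \<le> ((c * (M * \<rho>) + c * (2 + M * R) * (M * \<rho>)) * (M * \<rho>) + c * (M * \<rho>) * (M * \<rho>)
      + (c * (M * (\<rho> * \<rho>)) + c * (2 + 2 * (M * R)) * (M * (\<rho> * \<rho>)))) * d * \<rho>"
      using add_mono[OF add_mono[OF t3 t4] t5] nn pos \<rho>
      by (intro mult_mono[OF mult_right_mono]) (auto intro!: add_nonneg_nonneg mult_nonneg_nonneg)
    show "c * norm A' * ((n0 + (2 + n0) * n0) * d)
        \<le> c * (\<rho> * \<rho>) * ((M * \<rho> + (2 + M * R) * (M * \<rho>)) * d)"
      using t6 nn pos \<rho>(6)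
      by (intro mult_mono[OF mult_left_mono mult_right_mono]) auto
  qed
  also have "\<dots> = (((c * M + c * (2 + M * R) * M) * M + c * M * M + (c * M + c * (2 + 2 * (M * R)) * M))
      + c * (M + (2 + M * R) * M)) * (\<rho> * \<rho> * \<rho>) * d"
    by (simp add: algebra_simps)
  finally show ?thesis by (simp add: d_def)
qed

end

text \<open>
  The control is a parameter that dominates the rough path: existence uses the
  variation of the rough path alone, while uniqueness needs a control that also dominates the two
  solutions to be compared.
\<close>

locale rough_equation = second_order_field F F1 G tens c + control T \<omega>
  for F :: "'e::banach \<Rightarrow> 'd::real_normed_vector \<Rightarrow>\<^sub>L 'e" and F1 and G :: "'e \<Rightarrow> 'm::real_normed_vector \<Rightarrow> 'e"
    and tens :: "'d \<Rightarrow> 'd \<Rightarrow> 'm" and c T \<omega> +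
  fixes p :: real and X :: "real \<Rightarrow> 'd" and XX :: "real \<Rightarrow> real \<Rightarrow> 'm"
  assumes p: "2 \<le> p" "p < 3" and T0: "0 \<le> T"
    and chen: "\<lbrakk>0 \<le> s; s \<le> u; u \<le> t; t \<le> T\<rbrakk> \<Longrightarrow>
      XX s t = XX s u + XX u t + tens (incr X s u) (incr X u t)"
    and X_bound: "\<lbrakk>0 \<le> s; s \<le> t; t \<le> T\<rbrakk> \<Longrightarrow> norm (incr X s t) \<le> \<omega> s t powr (1 / p)"
    and XX_bound: "\<lbrakk>0 \<le> s; s \<le> t; t \<le> T\<rbrakk> \<Longrightarrow> norm (XX s t) \<le> \<omega> s t powr (2 / p)"
begin

definition euler :: "real \<Rightarrow> real \<Rightarrow> 'e \<Rightarrow> 'e" where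
  "euler s t = step (incr X s t) (XX s t)"

text \<open>
  The size of a first-level increment; second-level increments have size \<open>\<rho>\<close> squared.
\<close>

definition \<rho> :: "real \<Rightarrow> real \<Rightarrow> real" where "\<rho> s t = \<omega> s t powr (1 / p)"

lemma powr_two_thirds: "w powr (2 / p) = w powr (1 / p) * w powr (1 / p)"
  by (simp add: powr_add[symmetric])

lemma powr_three: "w powr (1 + (3 / p - 1)) = w powr (1 / p) * w powr (1 / p) * w powr (1 / p)"
  by (simp add: powr_add[symmetric])

lemma \<rho>_mono: "\<lbrakk>0 \<le> s; s \<le> s'; s' \<le> t'; t' \<le> t; t \<le> T\<rbrakk> \<Longrightarrow> \<rho> s' t' \<le> \<rho> s t"
  unfolding \<rho>_def using p by (intro powr_mono2 control_mono nonneg) auto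

lemma \<rho>_nonneg: "0 \<le> \<rho> s t"
  by (simp add: \<rho>_def)

lemma X_le: "\<lbrakk>0 \<le> s; s \<le> t; t \<le> T\<rbrakk> \<Longrightarrow> norm (incr X s t) \<le> \<rho> s t"
  using X_bound by (simp add: \<rho>_def)

lemma XX_le: "\<lbrakk>0 \<le> s; s \<le> t; t \<le> T\<rbrakk> \<Longrightarrow> norm (XX s t) \<le> \<rho> s t * \<rho> s t"
  using XX_bound by (simp add: \<rho>_def powr_two_thirds)

lemma \<rho>_split:
  assumes "0 \<le> s" "s \<le> u" "u \<le> t" "t \<le> T"
  shows "\<rho> s u * \<rho> s u * \<rho> u t \<le> min (\<omega> s u) (\<omega> u t) powr (3 / p - 1) * \<omega> s t"
    and "\<rho> u t * \<rho> u t * \<rho> s u \<le> min (\<omega> s u) (\<omega> u t) powr (3 / p - 1) * \<omega> s t"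
proof -
  have "0 \<le> \<omega> s u" "\<omega> s u \<le> \<omega> s t" "0 \<le> \<omega> u t" "\<omega> u t \<le> \<omega> s t"
    using assms by (auto intro!: nonneg control_mono)
  then show "\<rho> s u * \<rho> s u * \<rho> u t \<le> min (\<omega> s u) (\<omega> u t) powr (3 / p - 1) * \<omega> s t"
    "\<rho> u t * \<rho> u t * \<rho> s u \<le> min (\<omega> s u) (\<omega> u t) powr (3 / p - 1) * \<omega> s t"
    using powr_split_min[OF p, of "\<omega> s u" "\<omega> s t" "\<omega> u t"]
      powr_split_min[OF p, of "\<omega> u t" "\<omega> s t" "\<omega> s u"]
    by (simp_all add: \<rho>_def min.commute)
qed

lemma incr_add: "incr X s u + incr X u t = incr X s t"
  by (simp add: incr_def)

lemma XX_diag: "\<lbrakk>0 \<le> s; s \<le> T\<rbrakk> \<Longrightarrow> XX s s = 0"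
  using XX_le[of s s] diagonal[of s] by (simp add: \<rho>_def)

lemma G_zero: "G a 0 = 0"
  using G_bound[of a 0] by simp

lemma euler_compose:
  assumes "0 \<le> s" "s \<le> u" "u \<le> t" "t \<le> T"
  shows "euler u t (euler s u a) - euler s t a = defect (incr X s u) (XX s u) (incr X u t) (XX u t) a"
  unfolding euler_def step_compose[symmetric] incr_add using chen[OF assms] by simp

definition R :: real where "R = \<rho> 0 T"

lemma \<rho>_le_R: "\<lbrakk>0 \<le> s; s \<le> t; t \<le> T\<rbrakk> \<Longrightarrow> \<rho> s t \<le> R"
  unfolding R_def by (rule \<rho>_mono) auto

lemma increments_le:
  assumes "0 \<le> s" "s \<le> t" "t \<le> T"
  shows "norm (incr X s t) + norm (XX s t) \<le> (1 + R) * \<rho> s t"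
proof -
  have "\<rho> s t * \<rho> s t \<le> R * \<rho> s t" using \<rho>_le_R[OF assms] \<rho>_nonneg by (intro mult_right_mono) auto
  then show ?thesis using X_le[OF assms] XX_le[OF assms] by (simp add: distrib_right)
qed

lemma euler_almost_flow: "\<exists>L K. almost_flow T \<omega> euler (3 / p - 1) (1 / p) L K"
proof -
  have R0: "0 \<le> R" by (simp add: R_def \<rho>_nonneg)
  define M where "M = c * (1 + R)"
  have M0: "0 \<le> M" using R0 c_nonneg by (simp add: M_def)
  define K1 where "K1 = c * (M * M + c) + c * M"
  define K2 where "K2 = ((c * M + c * (2 + M * R) * M) * M + c * M * M
      + (c * M + c * (2 + 2 * (M * R)) * M)) + c * (M + (2 + M * R) * M)"
  define K where "K = K1 + K2 + M * R"
  have K0: "0 \<le> K1" "0 \<le> K2" "0 \<le> M * R"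
    using M0 R0 c_nonneg by (simp_all add: K1_def K2_def)
  have lip: "1 + c * (norm (incr X s t) + norm (XX s t)) \<le> 1 + M * \<omega> s t powr (1 / p)"
    if "0 \<le> s" "s \<le> t" "t \<le> T" for s t
    using mult_left_mono[OF increments_le[OF that] c_nonneg] by (simp add: M_def \<rho>_def mult.assoc)
  have "almost_flow T \<omega> euler (3 / p - 1) (1 / p) M K"
  proof unfold_locales
    show "0 \<le> T" "0 < 3 / p - 1" "0 < 1 / p" "0 \<le> M" "0 \<le> K"
      using T0 p M0 K0 by (auto simp: K_def)
    fix s :: real and a :: 'e assume "0 \<le> s" "s \<le> T"
    then show "euler s s a = a"
      by (simp add: euler_def step_def incr_def XX_diag G_zero)
  next
    fix s u t :: real and a :: 'e assume st: "0 \<le> s" "s \<le> u" "u \<le> t" "t \<le> T"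
    let ?m = "min (\<omega> s u) (\<omega> u t) powr (3 / p - 1) * \<omega> s t"
    have m0: "0 \<le> ?m" using nonneg[of s t] st by simp
    have "norm (euler u t (euler s u a) - euler s t a) \<le>
        c * (c * (1 + R) * (c * (1 + R)) + c) * (\<rho> s u * \<rho> s u * \<rho> u t)
        + c * (c * (1 + R)) * (\<rho> u t * \<rho> u t * \<rho> s u)"
      unfolding euler_compose[OF st] using st
      by (intro defect_bound_homogeneous \<rho>_nonneg \<rho>_le_R X_le XX_le) auto
    also have "\<dots> \<le> c * (c * (1 + R) * (c * (1 + R)) + c) * ?m + c * (c * (1 + R)) * ?m"
      using R0 c_nonneg by (intro add_mono mult_left_mono \<rho>_split[OF st]) auto
    also have "\<dots> = K1 * ?m" by (simp add: K1_def M_def algebra_simps)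
    also have "\<dots> \<le> K * ?m" using K0 m0 by (intro mult_right_mono) (auto simp: K_def)
    finally show "norm (euler u t (euler s u a) - euler s t a) \<le> K * ?m" .
  next
    fix s t :: real and a b :: 'e assume st: "0 \<le> s" "s \<le> t" "t \<le> T"
    show "norm (euler s t a - euler s t b) \<le> (1 + M * \<omega> s t powr (1 / p)) * norm (a - b)"
      unfolding euler_def using step_lipschitz lip[OF st]
      by (meson mult_right_mono norm_ge_zero order_trans)
  next
    fix s u t :: real and a b :: 'e assume st: "0 \<le> s" "s \<le> u" "u \<le> t" "t \<le> T"
    have le: "\<rho> s u \<le> \<rho> s t" "\<rho> u t \<le> \<rho> s t" using st by (auto intro: \<rho>_mono)
    then have sq: "\<rho> s u * \<rho> s u \<le> \<rho> s t * \<rho> s t" "\<rho> u t * \<rho> u t \<le> \<rho> s t * \<rho> s t"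
      by (auto intro!: mult_mono \<rho>_nonneg)
    have "norm ((euler u t (euler s u a) - euler s t a) - (euler u t (euler s u b) - euler s t b))
        \<le> K2 * (\<rho> s t * \<rho> s t * \<rho> s t) * norm (a - b)"
      unfolding euler_compose[OF st] K2_def
      using st X_le[of s u] X_le[of u t] XX_le[of s u] XX_le[of u t] le sq
      by (intro defect_lipschitz_homogeneous[OF \<rho>_nonneg \<rho>_le_R _ _ _ _ M_def]) auto
    also have "\<dots> = K2 * \<omega> s t powr (1 + (3 / p - 1)) * norm (a - b)"
      by (simp only: powr_three \<rho>_def)
    also have "\<dots> \<le> K * \<omega> s t powr (1 + (3 / p - 1)) * norm (a - b)"
      using K0 by (intro mult_right_mono) (auto simp: K_def)
    finally show "norm ((euler u t (euler s u a) - euler s t a) - (euler u t (euler s u b) - euler s t b))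
        \<le> K * \<omega> s t powr (1 + (3 / p - 1)) * norm (a - b)" .
  next
    fix s t :: real and a b a' b' :: 'e assume st: "0 \<le> s" "s \<le> t" "t \<le> T"
    let ?S = "norm (a - a') + norm (b - b')"
    have "c * (norm (incr X s t) + norm (XX s t)) \<le> c * ((1 + R) * \<rho> s t)"
      using increments_le[OF st] c_nonneg by (rule mult_left_mono)
    also have "\<dots> \<le> c * ((1 + R) * R)"
      using \<rho>_le_R[OF st] R0 c_nonneg by (intro mult_left_mono) auto
    also have "\<dots> \<le> K" using K0 by (simp add: K_def M_def mult.assoc)
    finally have 1: "c * (norm (incr X s t) + norm (XX s t)) * ?S * norm (a - b) \<le> K * ?S * norm (a - b)"
      by (intro mult_right_mono) auto
    have 2: "(1 + c * (norm (incr X s t) + norm (XX s t))) * norm ((a - b) - (a' - b'))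
        \<le> (1 + M * \<omega> s t powr (1 / p)) * norm ((a - b) - (a' - b'))"
      using lip[OF st] by (intro mult_right_mono) auto
    show "norm ((euler s t a - euler s t b) - (euler s t a' - euler s t b'))
        \<le> (1 + M * \<omega> s t powr (1 / p)) * norm ((a - b) - (a' - b')) + K * ?S * norm (a - b)"
      using step_second_difference[of "incr X s t" "XX s t" a b a' b'] 1 2
      unfolding euler_def by linarith
  qed
  then show ?thesis by blast
qed

abbreviation local_increment :: "(real \<Rightarrow> 'e) \<Rightarrow> real \<Rightarrow> real \<Rightarrow> 'e" where
  "local_increment Y u v \<equiv> F (Y u) (incr X u v) + G (Y u) (XX u v)"

lemma euler_eq: "euler u v (Y u) = Y u + local_increment Y u v"
  by (simp add: euler_def step_def)

text \<open>
  The limit orbit \<open>Y\<close> deviates from a step by \<open>C\<close> times \<open>\<rho>\<close> cubed, so the regularity of its increments and of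
  its remainder is that of a single step.  On intervals of a fine partition the deviation is at
  most \<open>C \<epsilon>\<^sup>\<eta> \<omega>(u,v)\<close>, and the sum of these deviations is the difference between the compensated sum
  and \<open>Y t - y0\<close>.
\<close>

lemma ex_solution:
  obtains Y where "finite_variation2 p T (incr Y)" "finite_variation2 p T (incr (\<lambda>t. F (Y t)))"
    "finite_variation2 (p / 2) T (\<lambda>s t. incr Y s t - F (Y s) (incr X s t))"
    "\<And>t. \<lbrakk>0 \<le> t; t \<le> T\<rbrakk> \<Longrightarrow> RRS_limit 0 t (local_increment Y) (Y t - y0)"
proof -
  obtain L K where "almost_flow T \<omega> euler (3 / p - 1) (1 / p) L K" using euler_almost_flow by blast
  then interpret flow: almost_flow T \<omega> euler "3 / p - 1" "1 / p" L K .
  define \<eta> where "\<eta> = 3 / p - 1"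
  have \<eta>0: "0 < \<eta>" using flow.eta_pos by (simp add: \<eta>_def)
  obtain Y C where Y0: "Y 0 = y0" and C: "0 \<le> C"
    and err: "\<And>s t. \<lbrakk>0 \<le> s; s \<le> t; t \<le> T\<rbrakk> \<Longrightarrow>
      norm (Y t - euler s t (Y s)) \<le> C * \<omega> s t powr (1 + (3 / p - 1))"
    and small: "\<And>s t \<epsilon>. \<lbrakk>0 \<le> s; s \<le> t; t \<le> T; one_sided_small \<epsilon> s t\<rbrakk> \<Longrightarrow>
      norm (Y t - euler s t (Y s)) \<le> C * \<epsilon> powr (3 / p - 1) * \<omega> s t"
    using flow.ex_limit_orbit[of y0] by blast
  have R0: "0 \<le> R" by (simp add: R_def \<rho>_nonneg)
  have remainder: "norm (incr Y s t - F (Y s) (incr X s t)) \<le> (C * R + c) * (\<rho> s t * \<rho> s t)"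
    if st: "0 \<le> s" "s \<le> t" "t \<le> T" for s t
  proof -
    have "norm (Y t - euler s t (Y s)) \<le> C * (\<rho> s t * \<rho> s t * \<rho> s t)"
      using err[OF st] by (simp only: powr_three \<rho>_def)
    also have "\<dots> \<le> C * (\<rho> s t * \<rho> s t * R)"
      using C \<rho>_le_R[OF st] \<rho>_nonneg by (intro mult_left_mono) auto
    finally have 1: "norm (Y t - euler s t (Y s)) \<le> C * (\<rho> s t * \<rho> s t * R)" .
    have "norm (G (Y s) (XX s t)) \<le> c * norm (XX s t)" by (rule G_bound)
    also have "\<dots> \<le> c * (\<rho> s t * \<rho> s t)" using XX_le[OF st] c_nonneg by (rule mult_left_mono)
    finally have 2: "norm (G (Y s) (XX s t)) \<le> c * (\<rho> s t * \<rho> s t)" .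
    have eq: "incr Y s t - F (Y s) (incr X s t) = (Y t - euler s t (Y s)) + G (Y s) (XX s t)"
      unfolding euler_eq by (simp add: incr_def)
    show ?thesis using norm_triangle_mono[OF 1 2] unfolding eq by (simp add: algebra_simps)
  qed
  have increment: "norm (incr Y s t) \<le> ((C * R + c) * R + c) * \<rho> s t"
    if st: "0 \<le> s" "s \<le> t" "t \<le> T" for s t
  proof -
    have "(C * R + c) * (\<rho> s t * \<rho> s t) \<le> (C * R + c) * (R * \<rho> s t)"
      using C R0 c_nonneg \<rho>_le_R[OF st] \<rho>_nonneg by (intro mult_left_mono mult_right_mono) auto
    then have 1: "norm (incr Y s t - F (Y s) (incr X s t)) \<le> (C * R + c) * (R * \<rho> s t)"
      using remainder[OF st] by simp
    have 2: "norm (F (Y s) (incr X s t)) \<le> c * \<rho> s t"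
      by (rule norm_blinfun_le[OF F_bound X_le[OF st]])
    show ?thesis using norm_triangle_mono[OF 1 2] by (simp add: algebra_simps)
  qed
  have CR: "0 \<le> C * R + c" "0 \<le> (C * R + c) * R + c" using C R0 c_nonneg by auto
  show ?thesis
  proof (rule that)
    show "finite_variation2 p T (incr Y)"
      using p increment CR
      by (intro finite_variation_of_control_bound[where C = "(C * R + c) * R + c"]) (auto simp: \<rho>_def)
    show "finite_variation2 p T (incr (\<lambda>t. F (Y t)))"
    proof (intro finite_variation_of_control_bound[where C = "c * ((C * R + c) * R + c)"])
      fix s t assume st: "0 \<le> s" "s < t" "t \<le> T"
      have "norm (incr (\<lambda>t. F (Y t)) s t) \<le> c * norm (incr Y s t)"
        unfolding incr_def by (rule F_lipschitz)
      also have "\<dots> \<le> c * (((C * R + c) * R + c) * \<rho> s t)"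
        using increment st c_nonneg by (intro mult_left_mono) auto
      finally show "norm (incr (\<lambda>t. F (Y t)) s t) \<le> c * ((C * R + c) * R + c) * \<omega> s t powr (1 / p)"
        by (simp add: \<rho>_def mult.assoc)
    qed (use p CR c_nonneg in auto)
    show "finite_variation2 (p / 2) T (\<lambda>s t. incr Y s t - F (Y s) (incr X s t))"
      using p remainder CR
      by (intro finite_variation_of_control_bound[where C = "C * R + c"])
        (auto simp: \<rho>_def powr_two_thirds)
    show "RRS_limit 0 t (local_increment Y) (Y t - y0)" if t: "0 \<le> t" "t \<le> T" for t
      unfolding RRS_limit_def
    proof (intro allI impI)
      fix r :: real assume r: "0 < r"
      define B where "B = C * \<omega> 0 t"
      have B0: "0 \<le> B" using C nonneg[of 0 t] t by (simp add: B_def)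
      \<comment> \<open>Chosen so that \<open>B * e powr \<eta> < r\<close>; the summand \<open>1\<close> covers the case \<open>B = 0\<close>.\<close>
      define e where "e = (r / (B + 1)) powr (1 / \<eta>)"
      have e0: "0 < e" using r B0 by (simp add: e_def)
      have e_pow: "e powr \<eta> = r / (B + 1)" using r B0 \<eta>0 by (simp add: e_def powr_powr)
      obtain P where P: "one_sided_fine e P" using ex_one_sided_fine[OF T0 e0] by blast
      define P' where "P' = insert 0 (insert t (P \<inter> {0..t}))"
      have P': "partition_points 0 t P'"
        using P t by (auto simp: P'_def partition_points_def one_sided_fine_def)
      have "norm (partition_sum (local_increment Y) Q - (Y t - y0)) < r"
        if Q: "partition_points 0 t Q" "P' \<subseteq> Q" for Q
      proof -
        have "partition_sum (local_increment Y) Q - (Y t - y0)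
            = partition_sum (\<lambda>u v. local_increment Y u v - (Y v - Y u)) Q"
          using partition_sum_telescope[OF Q(1), of Y] Y0
          by (simp flip: partition_sum_diff)
        then have "norm (partition_sum (local_increment Y) Q - (Y t - y0))
            \<le> partition_sum (\<lambda>u v. norm (local_increment Y u v - (Y v - Y u))) Q"
          by (simp only: norm_partition_sum_le)
        also have "\<dots> \<le> partition_sum (\<lambda>u v. C * e powr \<eta> * \<omega> u v) Q"
        proof (rule partition_sum_mono[OF Q(1)])
          fix u v assume uv: "0 \<le> u" "u < v" "v \<le> t" "Q \<inter> {u<..<v} = {}"
          have "P \<inter> {u<..<v} = {}"
          proof -
            have "x \<in> Q" if "x \<in> P" "u < x" "x < v" for x
              using that uv Q(2) by (auto simp: P'_def)
            then show ?thesis using uv(4) by (auto simp: disjoint_iff)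
          qed
          then have "norm (Y v - euler u v (Y u)) \<le> C * e powr \<eta> * \<omega> u v"
            unfolding \<eta>_def using uv t by (intro small one_sided_fineD[OF P]) auto
          then show "norm (local_increment Y u v - (Y v - Y u)) \<le> C * e powr \<eta> * \<omega> u v"
            unfolding euler_eq by (simp add: norm_minus_commute algebra_simps)
        qed
        also have "\<dots> = C * e powr \<eta> * partition_sum \<omega> Q" by (rule partition_sum_cmult)
        also have "\<dots> \<le> C * e powr \<eta> * \<omega> 0 t"
          using C t by (intro mult_left_mono partition_sum_control_le[OF Q(1)]) auto
        also have "\<dots> = r * (B / (B + 1))" by (simp add: e_pow B_def)
        also have "\<dots> < r * 1" using r B0 by (intro mult_strict_left_mono) auto
        finally show ?thesis by simp
      qed
      with P' show "\<exists>P. partition_points 0 t P \<and> (\<forall>Q. partition_points 0 t Q \<and> P \<subseteq> Q \<longrightarrow>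
          norm (partition_sum (local_increment Y) Q - (Y t - y0)) < r)"
        by blast
    qed
  qed
qed

text \<open>
  Along a solution, the failure of additivity of the local increments is of third order by Chen's relation
  and \<open>local_error_bound\<close>, so translations by them form an almost flow, and the defining limit of
  partition sums inherits its local estimate.
\<close>

lemma solution_follows_euler:
  assumes Y: "\<And>s t. \<lbrakk>0 \<le> s; s \<le> t; t \<le> T\<rbrakk> \<Longrightarrow> norm (incr Y s t) \<le> \<omega> s t powr (1 / p)"
    and rem: "\<And>s t. \<lbrakk>0 \<le> s; s \<le> t; t \<le> T\<rbrakk> \<Longrightarrow>
      norm (incr Y s t - F (Y s) (incr X s t)) \<le> \<omega> s t powr (2 / p)"
    and lim: "\<And>t. \<lbrakk>0 \<le> t; t \<le> T\<rbrakk> \<Longrightarrow> RRS_limit 0 t (local_increment Y) (Y t - y0)"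
  obtains C where "0 \<le> C" "\<And>s t \<epsilon>. \<lbrakk>0 \<le> s; s \<le> t; t \<le> T; one_sided_small \<epsilon> s t\<rbrakk> \<Longrightarrow>
      norm (Y t - euler s t (Y s)) \<le> C * \<epsilon> powr (3 / p - 1) * \<omega> s t"
proof -
  let ?\<Xi> = "local_increment Y"
  have "almost_flow T \<omega> (\<lambda>s t y. y + ?\<Xi> s t) (3 / p - 1) 1 0 (3 * c)"
  proof (rule linear_almost_flow)
    show "control T \<omega>" by unfold_locales
    show "0 \<le> T" "0 < 3 / p - 1" "0 \<le> 3 * c" using T0 p c_nonneg by auto
    show "?\<Xi> s s = 0" if "0 \<le> s" "s \<le> T" for s
      using that by (simp add: incr_def XX_diag G_zero)
    fix s u t assume st: "0 \<le> s" "s \<le> u" "u \<le> t" "t \<le> T"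
    let ?m = "min (\<omega> s u) (\<omega> u t) powr (3 / p - 1) * \<omega> s t"
    have eq: "?\<Xi> s u + ?\<Xi> u t - ?\<Xi> s t = (F (Y u) - F (Y s) - F1 (Y s) (F (Y s) (incr X s u))) (incr X u t)
        + (G (Y u) (XX u t) - G (Y s) (XX u t))"
      unfolding chen[OF st] incr_add[of s u t, symmetric] G_add G_tens
      by (simp add: blinfun.diff_left blinfun.add_right)
    have y: "norm (Y u - Y s) \<le> \<rho> s u" using Y[of s u] st by (simp add: incr_def \<rho>_def)
    have r: "norm (Y u - Y s - F (Y s) (incr X s u)) \<le> \<rho> s u * \<rho> s u"
      using rem[of s u] st by (simp add: incr_def \<rho>_def powr_two_thirds)
    have "norm (?\<Xi> s u + ?\<Xi> u t - ?\<Xi> s t)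
        \<le> c * (norm (Y u - Y s) * norm (Y u - Y s) + norm (Y u - Y s - F (Y s) (incr X s u))) * norm (incr X u t)
          + c * norm (XX u t) * norm (Y u - Y s)"
      unfolding eq by (rule local_error_bound)
    also have "\<dots> \<le> c * (\<rho> s u * \<rho> s u + \<rho> s u * \<rho> s u) * \<rho> u t + c * (\<rho> u t * \<rho> u t) * \<rho> s u"
      using y r X_le[of u t] XX_le[of u t] st c_nonneg \<rho>_nonneg[of s u] \<rho>_nonneg[of u t]
      by (intro add_mono[OF mult_mono[OF mult_left_mono[OF add_mono[OF mult_mono]]]
            mult_mono[OF mult_left_mono]]) auto
    also have "\<dots> = 2 * c * (\<rho> s u * \<rho> s u * \<rho> u t) + c * (\<rho> u t * \<rho> u t * \<rho> s u)"
      by (simp add: algebra_simps)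
    also have "\<dots> \<le> 2 * c * ?m + c * ?m"
      using c_nonneg by (intro add_mono mult_left_mono \<rho>_split[OF st]) auto
    finally show "norm (?\<Xi> s u + ?\<Xi> u t - ?\<Xi> s t) \<le> 3 * c * ?m" by (simp add: mult_ac)
  qed
  then obtain C where C: "0 \<le> C" "\<And>s t \<epsilon> I. \<lbrakk>0 \<le> s; s \<le> t; t \<le> T; one_sided_small \<epsilon> s t; RRS_limit s t ?\<Xi> I\<rbrakk>
      \<Longrightarrow> norm (I - ?\<Xi> s t) \<le> C * \<epsilon> powr (3 / p - 1) * \<omega> s t"
    by (rule RRS_limit_close) blast
  have "norm (Y t - euler s t (Y s)) \<le> C * \<epsilon> powr (3 / p - 1) * \<omega> s t"
    if st: "0 \<le> s" "s \<le> t" "t \<le> T" and small: "one_sided_small \<epsilon> s t" for s t \<epsilon>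
  proof -
    have "RRS_limit s t ?\<Xi> ((Y t - y0) - (Y s - y0))"
      using st by (intro RRS_limit_increment[OF lim lim]) auto
    from C(2)[OF st small this] show ?thesis
      unfolding euler_eq by (simp add: algebra_simps)
  qed
  with C(1) show ?thesis by (rule that)
qed

end


section \<open>The second-order field of a smooth map\<close>

text \<open>
  \<open>DFF F y A\<close> is \<open>contract A (DF y) (F y)\<close>.  As a function of three arguments the expression is trilinear,
  which turns regularity of \<open>DF\<close> and \<open>F\<close> into regularity of \<open>DFF F\<close>.
\<close>

definition contract :: "real ^ 'd::finite ^ 'd \<Rightarrow> ('e::real_normed_vector \<Rightarrow>\<^sub>L (real ^ 'd) \<Rightarrow>\<^sub>L 'e)
    \<Rightarrow> ((real ^ 'd) \<Rightarrow>\<^sub>L 'e) \<Rightarrow> 'e" where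
  "contract A L M = (\<Sum>i\<in>UNIV. \<Sum>j\<in>UNIV. A $ i $ j *\<^sub>R L (M (axis i 1)) (axis j 1))"

lemma contract_add: "contract (A + B) L M = contract A L M + contract B L M"
  by (simp add: contract_def scaleR_add_left sum.distrib)

lemma contract_diff_left: "contract A (L - L') M = contract A L M - contract A L' M"
  by (simp add: contract_def blinfun.diff_left scaleR_diff_right sum_subtractf)

lemma contract_diff_right: "contract A L (M - M') = contract A L M - contract A L M'"
  by (simp add: contract_def blinfun.diff_left blinfun.diff_right scaleR_diff_right sum_subtractf)

lemma contract_tensor: "contract (tensor x x') L M = L (M x) x'"
proof -
  have expand: "(\<Sum>i\<in>UNIV. v $ i *\<^sub>R axis i 1) = v" for v :: "real ^ 'd"
    using basis_expansion[of v] by (simp add: scalar_mult_eq_scaleR)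
  have "L (M x) x' = L (M (\<Sum>i\<in>UNIV. x $ i *\<^sub>R axis i 1)) (\<Sum>j\<in>UNIV. x' $ j *\<^sub>R axis j 1)"
    by (simp only: expand)
  also have "\<dots> = contract (tensor x x') L M"
    unfolding contract_def tensor_def
    by (simp add: blinfun.sum_right blinfun.sum_left blinfun.scaleR_right blinfun.scaleR_left
        scaleR_sum_right mult.commute)
      (subst sum.swap, simp)
  finally show ?thesis by simp
qed

lemma norm_contract_le:
  fixes A :: "real ^ 'd::finite ^ 'd"
  assumes "norm L \<le> l" "norm M \<le> m"
  shows "norm (contract A L M) \<le> (real CARD('d) * real CARD('d)) * norm A * (l * m)"
proof -
  have l0: "0 \<le> l" "0 \<le> m" using assms norm_ge_zero order_trans by blast+
  have entry: "norm (A $ i $ j *\<^sub>R L (M (axis i 1)) (axis j 1)) \<le> norm A * (l * m)" for i j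
  proof -
    have "norm (A $ i $ j) \<le> norm A"
      using component_le_norm_cart[of "A $ i" j] Finite_Cartesian_Product.norm_nth_le[of A i] by simp
    moreover have "norm (L (M (axis i 1)) (axis j 1)) \<le> l * (m * 1) * 1"
      using assms by (intro norm_blinfun_le) auto
    ultimately show ?thesis using l0 by (auto intro!: mult_mono)
  qed
  have row: "norm (\<Sum>j\<in>UNIV. A $ i $ j *\<^sub>R L (M (axis i 1)) (axis j 1)) \<le> real CARD('d) * (norm A * (l * m))" for i
    by (rule order_trans[OF norm_sum], rule sum_bounded_above) (rule entry)
  have "norm (contract A L M) \<le> real CARD('d) * (real CARD('d) * (norm A * (l * m)))"
    unfolding contract_def
    by (rule order_trans[OF norm_sum], rule sum_bounded_above) (rule row)
  then show ?thesis by (simp add: mult.assoc)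
qed

text \<open>
  The product rule for second differences: besides the two terms with a second difference of one
  factor there are two terms with first differences of both factors.  In these, differences between
  \<open>a'\<close> and \<open>b'\<close> have to be traded for \<open>a - b\<close>, using \<open>d'\<close>; for the part of second order the other
  factor is bounded crudely by \<open>2 * c\<close>.
\<close>

lemma contract_second_difference:
  fixes A :: "real ^ 'd::finite ^ 'd" and f :: "'e::real_normed_vector \<Rightarrow> 'e \<Rightarrow>\<^sub>L (real ^ 'd) \<Rightarrow>\<^sub>L 'e"
    and g :: "'e \<Rightarrow> (real ^ 'd) \<Rightarrow>\<^sub>L 'e"
  assumes c: "0 \<le> c"
    and f: "\<And>y. norm (f y) \<le> c" "\<And>y z. norm (f y - f z) \<le> c * norm (y - z)"
      "\<And>a b a' b'. norm ((f a - f b) - (f a' - f b'))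
        \<le> c * norm ((a - b) - (a' - b')) + c * (norm (a - a') + norm (b - b')) * norm (a - b)"
    and g: "\<And>y. norm (g y) \<le> c" "\<And>y z. norm (g y - g z) \<le> c * norm (y - z)"
      "\<And>a b a' b'. norm ((g a - g b) - (g a' - g b'))
        \<le> c * norm ((a - b) - (a' - b')) + c * (norm (a - a') + norm (b - b')) * norm (a - b)"
  shows "norm ((contract A (f a) (g a) - contract A (f b) (g b))
      - (contract A (f a') (g a') - contract A (f b') (g b')))
    \<le> 6 * (real CARD('d) * real CARD('d)) * (c * c) * norm A *
      (norm ((a - b) - (a' - b')) + (norm (a - a') + norm (b - b')) * norm (a - b))"
proof -
  define k where "k = real CARD('d) * real CARD('d) * norm A"
  define D where "D = norm ((a - b) - (a' - b'))"
  define S where "S = norm (a - a') + norm (b - b')"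
  define d where "d = norm (a - b)"
  have pos: "0 \<le> k" "0 \<le> D" "0 \<le> S" "0 \<le> d" by (auto simp: k_def D_def S_def d_def)
  have B: "norm (contract A L M) \<le> k * (l * m)" if "norm L \<le> l" "norm M \<le> m" for L :: "'e \<Rightarrow>\<^sub>L (real ^ 'd) \<Rightarrow>\<^sub>L 'e" and M l m
    using norm_contract_le[OF that] by (simp add: k_def)
  have d': "norm (a' - b') \<le> d + D"
    using norm_triangle_ineq4[of "a - b" "(a - b) - (a' - b')"] by (simp add: d_def D_def)
  have crude: "norm (u - v) \<le> 2 * c" if "norm u \<le> c" "norm v \<le> c" for u v :: "'x::real_normed_vector"
    using norm_triangle_ineq4[of u v] that by simp
  have 1: "norm (contract A ((f a - f b) - (f a' - f b')) (g a)) \<le> k * ((c * D + c * S * d) * c)"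
    using f(3)[of a b a' b'] g(1) by (intro B) (auto simp: D_def S_def d_def)
  have "norm (contract A (f a' - f b') (g a - g a')) \<le> k * (norm (f a' - f b') * norm (g a - g a'))"
    by (intro B) auto
  also have "norm (f a' - f b') * norm (g a - g a') \<le> (c * D + c * d) * norm (g a - g a')"
    using f(2)[of a' b'] mult_left_mono[OF d' c] by (intro mult_right_mono) (auto simp: algebra_simps)
  also have "\<dots> = c * D * norm (g a - g a') + c * d * norm (g a - g a')" by (rule distrib_right)
  also have "\<dots> \<le> c * D * (2 * c) + c * d * (c * S)"
  proof (intro add_mono mult_left_mono)
    show "norm (g a - g a') \<le> 2 * c" by (intro crude g)
    have "c * norm (a - a') \<le> c * S" using c by (intro mult_left_mono) (auto simp: S_def)
    then show "norm (g a - g a') \<le> c * S" using g(2)[of a a'] by simp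
  qed (use c pos in auto)
  finally have 2: "norm (contract A (f a' - f b') (g a - g a')) \<le> k * (c * D * (2 * c) + c * d * (c * S))"
    using pos by (simp add: mult_left_mono)
  have 3: "norm (contract A (f b) ((g a - g b) - (g a' - g b'))) \<le> k * (c * (c * D + c * S * d))"
    using g(3)[of a b a' b'] f(1) by (intro B) (auto simp: D_def S_def d_def)
  have "norm (contract A (f b - f b') (g a' - g b')) \<le> k * (norm (f b - f b') * norm (g a' - g b'))"
    by (intro B) auto
  also have "norm (f b - f b') * norm (g a' - g b') \<le> norm (f b - f b') * (c * D + c * d)"
    using g(2)[of a' b'] mult_left_mono[OF d' c] by (intro mult_left_mono) (auto simp: algebra_simps)
  also have "\<dots> = norm (f b - f b') * (c * D) + norm (f b - f b') * (c * d)" by (rule distrib_left)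
  also have "\<dots> \<le> 2 * c * (c * D) + c * S * (c * d)"
  proof (intro add_mono mult_right_mono)
    show "norm (f b - f b') \<le> 2 * c" by (intro crude f)
    have "c * norm (b - b') \<le> c * S" using c by (intro mult_left_mono) (auto simp: S_def)
    then show "norm (f b - f b') \<le> c * S" using f(2)[of b b'] by simp
  qed (use c pos in auto)
  finally have 4: "norm (contract A (f b - f b') (g a' - g b')) \<le> k * (2 * c * (c * D) + c * S * (c * d))"
    using pos by (simp add: mult_left_mono)
  have eq: "(contract A (f a) (g a) - contract A (f b) (g b)) - (contract A (f a') (g a') - contract A (f b') (g b'))
      = contract A ((f a - f b) - (f a' - f b')) (g a) + contract A (f a' - f b') (g a - g a')
        + contract A (f b) ((g a - g b) - (g a' - g b')) + contract A (f b - f b') (g a' - g b')"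
    by (simp add: contract_diff_left contract_diff_right)
  have "norm ((contract A (f a) (g a) - contract A (f b) (g b))
      - (contract A (f a') (g a') - contract A (f b') (g b')))
    \<le> k * ((c * D + c * S * d) * c) + k * (c * D * (2 * c) + c * d * (c * S))
      + k * (c * (c * D + c * S * d)) + k * (2 * c * (c * D) + c * S * (c * d))"
    unfolding eq by (intro norm_add4_le 1 2 3 4)
  also have "\<dots> = k * (c * c) * (6 * D + 4 * (S * d))" by (simp add: algebra_simps)
  also have "\<dots> \<le> k * (c * c) * (6 * D + 6 * (S * d))"
    using pos c by (intro mult_left_mono) auto
  also have "\<dots> = 6 * (real CARD('d) * real CARD('d)) * (c * c) * norm A * (D + S * d)"
    by (simp add: k_def algebra_simps)
  finally show ?thesis by (simp add: D_def S_def d_def)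
qed

text \<open>
  The third derivative enters through the second difference of \<open>DF\<close>, which is controlled by a
  Lipschitz bound on \<open>D\<^sup>2F\<close>.  The number \<open>N\<close> is the norm that \<open>norm_contract_le\<close> gives for
  the contraction.
\<close>

lemma Cb3_second_order_field:
  fixes F :: "real ^ 'e::finite \<Rightarrow> ((real ^ 'd::finite) \<Rightarrow>\<^sub>L (real ^ 'e))"
  assumes "Cb3 F"
  obtains F1 c where "second_order_field F F1 (DFF F) tensor c"
proof -
  obtain F1 :: "real ^ 'e \<Rightarrow> (real ^ 'e) \<Rightarrow>\<^sub>L (real ^ 'd) \<Rightarrow>\<^sub>L (real ^ 'e)" and F2 F3
    where F1: "\<And>y. (F has_derivative blinfun_apply (F1 y)) (at y)"
      and F2: "\<And>y. (F1 has_derivative blinfun_apply (F2 y)) (at y)"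
      and F3: "\<And>y. (F2 has_derivative blinfun_apply (F3 y)) (at y)"
      and bdd: "bounded (range F)" "bounded (range F1)" "bounded (range F2)" "bounded (range F3)"
    using assms unfolding Cb3_def by auto
  obtain b0 b1 b2 b3 where b: "\<And>y. norm (F y) \<le> b0" "\<And>y. norm (F1 y) \<le> b1"
      "\<And>y. norm (F2 y) \<le> b2" "\<And>y. norm (F3 y) \<le> b3"
    using bdd unfolding bounded_iff by (auto; metis)
  define c where "c = max (max b0 b1) (max b2 b3)"
  have bound: "norm (F y) \<le> c" "norm (F1 y) \<le> c" "norm (F2 y) \<le> c" "norm (F3 y) \<le> c" for y
    using b[of y] by (auto simp: c_def max_def)
  have c0: "0 \<le> c" using bound(1)[of 0] norm_ge_zero order_trans by blast
  define N where "N = real CARD('d) * real CARD('d)"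
  have N1: "1 \<le> N" unfolding N_def using mult_mono[of 1 "real CARD('d)" 1 "real CARD('d)"] by simp
  define c' where "c' = c + 6 * N * (c * c)"
  have cc': "c \<le> c'" "6 * N * (c * c) \<le> c'" "0 \<le> c'" using c0 N1 by (auto simp: c'_def)
  have weaken: "u \<le> c' * w" if "u \<le> c * w" "0 \<le> w" for u w
    using that mult_right_mono[OF cc'(1) that(2)] by simp
  have weaken2: "u \<le> c' * w + c' * s * r"
    if "u \<le> c * w + c * s * r" "0 \<le> w" "0 \<le> s" "0 \<le> r" for u w s r
    using that(1) mult_right_mono[OF cc'(1) that(2)] mult_right_mono[OF mult_right_mono[OF cc'(1) that(3)] that(4)]
    by linarith
  have weaken3: "u \<le> c' * w * r" if "u \<le> N * w * (c * c) * r" "0 \<le> w" "0 \<le> r" for u w r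
  proof -
    have "0 \<le> N * (c * c)" using N1 c0 by simp
    then have "N * (c * c) \<le> c'" using cc'(2) unfolding mult.assoc by linarith
    then have "N * (c * c) * (w * r) \<le> c' * (w * r)" using that by (intro mult_right_mono) auto
    then show ?thesis using that(1) by (simp add: mult_ac)
  qed
  note lip0 = lipschitz_of_bounded_derivative[OF F1 bound(2)]
  note lip1 = lipschitz_of_bounded_derivative[OF F2 bound(3)]
  note lip2 = lipschitz_of_bounded_derivative[OF F3 bound(4)]
  note sd0 = second_difference_bound[OF F1 c0 bound(2) lip1]
  note sd1 = second_difference_bound[OF F2 c0 bound(3) lip2]
  have DFF: "DFF F y A = contract A (F1 y) (F y)" for y A
    unfolding DFF_def contract_def using frechet_derivative_at[OF F1[of y]] by simp
  have "second_order_field F F1 (DFF F) tensor c'"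
  proof
    show "0 \<le> c'" by (rule cc')
    show "(F has_derivative blinfun_apply (F1 y)) (at y)" for y by (rule F1)
    show "norm (F y) \<le> c'" "norm (F1 y) \<le> c'" for y using bound[of y] cc' by auto
    show "norm (F1 y - F1 z) \<le> c' * norm (y - z)" for y z by (intro weaken lip1) auto
    show "norm ((F1 a - F1 b) - (F1 a' - F1 b'))
        \<le> c' * norm ((a - b) - (a' - b')) + c' * (norm (a - a') + norm (b - b')) * norm (a - b)"
      for a b a' b' by (intro weaken2 sd1) auto
    show "DFF F y (A + B) = DFF F y A + DFF F y B" for y A B by (simp add: DFF contract_add)
    show "DFF F y (tensor x x') = F1 y (F y x) x'" for y x x' by (simp add: DFF contract_tensor)
    show "norm (DFF F y A) \<le> c' * norm A" for y A
      using weaken3[of "norm (DFF F y A)" "norm A" 1] norm_contract_le[OF bound(2) bound(1), of A y y]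
      by (simp add: DFF N_def)
    show "norm (DFF F y A - DFF F z A) \<le> c' * norm A * norm (y - z)" for y z A
    proof -
      have 1: "norm (contract A (F1 y - F1 z) (F y)) \<le> N * norm A * (c * norm (y - z) * c)"
        unfolding N_def by (intro norm_contract_le lip1 bound)
      have 2: "norm (contract A (F1 z) (F y - F z)) \<le> N * norm A * (c * (c * norm (y - z)))"
        unfolding N_def by (intro norm_contract_le lip0 bound)
      have eq: "DFF F y A - DFF F z A = contract A (F1 y - F1 z) (F y) + contract A (F1 z) (F y - F z)"
        by (simp add: DFF contract_diff_left contract_diff_right)
      have "norm (DFF F y A - DFF F z A) \<le> (2 * N * (c * c)) * (norm A * norm (y - z))"
        using norm_triangle_mono[OF 1 2] unfolding eq by (simp add: mult_ac)
      also have "\<dots> \<le> c' * (norm A * norm (y - z))"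
        using cc'(2) N1 c0 by (intro mult_right_mono) (auto simp: c'_def)
      finally show ?thesis by (simp add: mult.assoc)
    qed
    show "norm ((DFF F a A - DFF F b A) - (DFF F a' A - DFF F b' A))
        \<le> c' * norm A * (norm ((a - b) - (a' - b')) + (norm (a - a') + norm (b - b')) * norm (a - b))"
      for a b a' b' A
    proof -
      have "norm ((DFF F a A - DFF F b A) - (DFF F a' A - DFF F b' A)) \<le> 6 * N * (c * c) * norm A *
          (norm ((a - b) - (a' - b')) + (norm (a - a') + norm (b - b')) * norm (a - b))"
        unfolding DFF N_def
        by (rule contract_second_difference[OF c0 bound(2) lip1 sd1 bound(1) lip0 sd0])
      also have "\<dots> \<le> c' * norm A *
          (norm ((a - b) - (a' - b')) + (norm (a - a') + norm (b - b')) * norm (a - b))"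
        using cc'(2) by (intro mult_right_mono) auto
      finally show ?thesis .
    qed
  qed
  then show ?thesis by (rule that)
qed

section \<open>Existence and uniqueness\<close>

lemma rough_equation_of_control:
  assumes rp: "rough_path p T X XX" and field: "second_order_field F F1 (DFF F) tensor c"
    and p: "2 \<le> p" "p < 3" and T: "0 \<le> T" and \<omega>: "control T \<omega>"
    and X: "\<And>s t. \<lbrakk>0 \<le> s; s < t; t \<le> T\<rbrakk> \<Longrightarrow> norm (incr X s t) powr p \<le> \<omega> s t"
    and XX: "\<And>s t. \<lbrakk>0 \<le> s; s < t; t \<le> T\<rbrakk> \<Longrightarrow> norm (XX s t) powr (p / 2) \<le> \<omega> s t"
  shows "rough_equation F F1 (DFF F) tensor c T \<omega> p X XX"
proof -
  have chen: "XX s t = XX s u + XX u t + tensor (incr X s u) (incr X u t)"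
    if "0 \<le> s" "s \<le> u" "u \<le> t" "t \<le> T" for s u t
    using rp that unfolding rough_path_def by blast
  have XX_diag: "XX s s = 0" if "0 \<le> s" "s \<le> T" for s
  proof -
    have "tensor (incr X s s) (incr X s s) = 0" by (simp add: tensor_def incr_def vec_eq_iff)
    then show ?thesis using chen[of s s s] that by simp
  qed
  show ?thesis
  proof (intro rough_equation.intro field \<omega> rough_equation_axioms.intro p T chen)
    fix s t assume st: "0 \<le> s" "s \<le> t" "t \<le> T"
    show "norm (incr X s t) \<le> \<omega> s t powr (1 / p)"
    proof (cases "s = t")
      case True
      then show ?thesis by (simp add: incr_def)
    next
      case False
      then show ?thesis using X[of s t] st p by (intro le_powr_inverse) auto
    qed
    show "norm (XX s t) \<le> \<omega> s t powr (2 / p)"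
    proof (cases "s = t")
      case True
      then show ?thesis using XX_diag st by simp
    next
      case False
      then show ?thesis using le_powr_inverse[of "XX s t" "p / 2" "\<omega> s t"] XX[of s t] st p by auto
    qed
  qed
qed

text \<open>
  The only partition of \<open>[0, 0]\<close> has no intervals, so the defining limit at time \<open>0\<close> is a limit of empty sums.
\<close>

lemma rde_solution_initial_value:
  assumes "rde_solution p T X XX F y0 Y" "0 \<le> T"
  shows "Y 0 = y0"
proof (rule ccontr)
  assume "Y 0 \<noteq> y0"
  then have "0 < norm (Y 0 - y0)" by simp
  moreover have "RRS_limit 0 0 (\<lambda>u v. F (Y u) (incr X u v) + DFF F (Y u) (XX u v)) (Y 0 - y0)"
    using assms by (simp add: rde_solution_def)
  ultimately obtain P where P: "partition_points 0 0 P"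
    "norm (partition_sum (\<lambda>u v. F (Y u) (incr X u v) + DFF F (Y u) (XX u v)) P - (Y 0 - y0)) < norm (Y 0 - y0)"
    unfolding RRS_limit_def by blast
  have "P = {0}" using P(1) by (auto simp: partition_points_def)
  then show False using P(2) by (simp add: norm_minus_commute)
qed

text \<open>
  All variation that occurs, including that of both solutions and their remainders, is collected
  in one control, so that both solutions obey the local estimate with respect to the same almost flow.
\<close>

lemma rde_solution_unique:
  assumes rp: "rough_path p T X XX" and F: "Cb3 F" and p: "2 \<le> p" "p < 3" and T: "0 \<le> T"
    and Y: "rde_solution p T X XX F y0 Y" and Z: "rde_solution p T X XX F y0 Z"
    and t: "0 \<le> t" "t \<le> T"
  shows "Y t = Z t"
proof -
  obtain F1 c where field: "second_order_field F F1 (DFF F) tensor c"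
    using Cb3_second_order_field[OF F] .
  let ?R = "\<lambda>Y s t. incr Y s t - F (Y s) (incr X s t)"
  have fin: "finite_variation2 p T (incr X)" "finite_variation2 (p / 2) T XX"
    "finite_variation2 p T (incr Y)" "finite_variation2 (p / 2) T (?R Y)"
    "finite_variation2 p T (incr Z)" "finite_variation2 (p / 2) T (?R Z)"
    using rp Y Z by (auto simp: rough_path_def rde_solution_def controlled_def Vp_def)
  note ctrl = fin[THEN control_variation_control]
  note le = fin[THEN powr_le_variation_control]
  \<comment> \<open>One control for the rough path, both solutions and both remainders.\<close>
  define \<omega> where "\<omega> = (\<lambda>s t. variation_control p (incr X) s t + variation_control (p / 2) XX s t
    + (variation_control p (incr Y) s t + variation_control (p / 2) (?R Y) s t)
    + (variation_control p (incr Z) s t + variation_control (p / 2) (?R Z) s t))"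
  have \<omega>: "control T \<omega>" unfolding \<omega>_def by (intro control_add ctrl)
  have dom: "norm (incr X s t) powr p \<le> \<omega> s t" "norm (XX s t) powr (p / 2) \<le> \<omega> s t"
    "norm (incr Y s t) powr p \<le> \<omega> s t" "norm (?R Y s t) powr (p / 2) \<le> \<omega> s t"
    "norm (incr Z s t) powr p \<le> \<omega> s t" "norm (?R Z s t) powr (p / 2) \<le> \<omega> s t"
    if "0 \<le> s" "s < t" "t \<le> T" for s t
    using le[OF that] ctrl[THEN control.nonneg, of s t] that unfolding \<omega>_def by auto
  interpret rough_equation F F1 "DFF F" tensor c T \<omega> p X XX
    by (rule rough_equation_of_control[OF rp field p T \<omega> dom(1,2)])
  have follows: "\<exists>C\<ge>0. \<forall>s t \<epsilon>. 0 \<le> s \<longrightarrow> s \<le> t \<longrightarrow> t \<le> T \<longrightarrow> one_sided_small \<epsilon> s t \<longrightarrow>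
      norm (W t - euler s t (W s)) \<le> C * \<epsilon> powr (3 / p - 1) * \<omega> s t"
    if W: "rde_solution p T X XX F y0 W"
      and dom: "\<And>s t. \<lbrakk>0 \<le> s; s < t; t \<le> T\<rbrakk> \<Longrightarrow> norm (incr W s t) powr p \<le> \<omega> s t"
        "\<And>s t. \<lbrakk>0 \<le> s; s < t; t \<le> T\<rbrakk> \<Longrightarrow> norm (?R W s t) powr (p / 2) \<le> \<omega> s t" for W
  proof -
    have inc: "norm (incr W s t) \<le> \<omega> s t powr (1 / p)" if st: "0 \<le> s" "s \<le> t" "t \<le> T" for s t
    proof (cases "s = t")
      case True
      then show ?thesis by (simp add: incr_def)
    next
      case False
      then show ?thesis using dom(1)[of s t] st p by (intro le_powr_inverse) auto
    qed
    have rem: "norm (?R W s t) \<le> \<omega> s t powr (2 / p)" if st: "0 \<le> s" "s \<le> t" "t \<le> T" for s t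
    proof (cases "s = t")
      case True
      then show ?thesis by (simp add: incr_def)
    next
      case False
      then show ?thesis
        using le_powr_inverse[of "?R W s t" "p / 2" "\<omega> s t"] dom(2)[of s t] st p by auto
    qed
    have lim: "RRS_limit 0 t (local_increment W) (W t - y0)" if "0 \<le> t" "t \<le> T" for t
      using W that by (simp add: rde_solution_def)
    show ?thesis by (rule solution_follows_euler[OF inc rem lim]) blast+
  qed
  obtain L K where "almost_flow T \<omega> euler (3 / p - 1) (1 / p) L K" using euler_almost_flow by blast
  then interpret flow: almost_flow T \<omega> euler "3 / p - 1" "1 / p" L K .
  obtain c1 where c1: "0 \<le> c1" "\<And>s t \<epsilon>. \<lbrakk>0 \<le> s; s \<le> t; t \<le> T; one_sided_small \<epsilon> s t\<rbrakk> \<Longrightarrow>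
      norm (Y t - euler s t (Y s)) \<le> c1 * \<epsilon> powr (3 / p - 1) * \<omega> s t"
    using follows[OF Y dom(3,4)] by blast
  obtain c2 where c2: "0 \<le> c2" "\<And>s t \<epsilon>. \<lbrakk>0 \<le> s; s \<le> t; t \<le> T; one_sided_small \<epsilon> s t\<rbrakk> \<Longrightarrow>
      norm (Z t - euler s t (Z s)) \<le> c2 * \<epsilon> powr (3 / p - 1) * \<omega> s t"
    using follows[OF Z dom(5,6)] by blast
  show "Y t = Z t"
  proof (rule flow.almost_orbits_agree[OF c1(1) c2(1) t])
    show "Y 0 = Z 0"
      using rde_solution_initial_value[OF Y T] rde_solution_initial_value[OF Z T] by simp
  qed (auto intro!: c1(2) c2(2))
qed

lemma ex_rde_solution:
  assumes rp: "rough_path p T X XX" and F: "Cb3 F" and p: "2 \<le> p" "p < 3" and T: "0 \<le> T"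
  shows "\<exists>Y\<in>Vp p T. rde_solution p T X XX F y0 Y"
proof -
  obtain F1 c where field: "second_order_field F F1 (DFF F) tensor c"
    using Cb3_second_order_field[OF F] .
  have fin: "finite_variation2 p T (incr X)" "finite_variation2 (p / 2) T XX"
    using rp by (auto simp: rough_path_def Vp_def)
  note ctrl = fin[THEN control_variation_control]
  note le = fin[THEN powr_le_variation_control]
  define \<omega> where "\<omega> = (\<lambda>s t. variation_control p (incr X) s t + variation_control (p / 2) XX s t)"
  have \<omega>: "control T \<omega>" unfolding \<omega>_def by (intro control_add ctrl)
  have dom: "norm (incr X s t) powr p \<le> \<omega> s t" "norm (XX s t) powr (p / 2) \<le> \<omega> s t"
    if "0 \<le> s" "s < t" "t \<le> T" for s t
    using le[OF that] ctrl[THEN control.nonneg, of s t] that unfolding \<omega>_def by auto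
  interpret rough_equation F F1 "DFF F" tensor c T \<omega> p X XX
    by (rule rough_equation_of_control[OF rp field p T \<omega> dom])
  obtain Y where "finite_variation2 p T (incr Y)" "finite_variation2 p T (incr (\<lambda>t. F (Y t)))"
    "finite_variation2 (p / 2) T (\<lambda>s t. incr Y s t - F (Y s) (incr X s t))"
    "\<And>t. \<lbrakk>0 \<le> t; t \<le> T\<rbrakk> \<Longrightarrow> RRS_limit 0 t (local_increment Y) (Y t - y0)"
    using ex_solution[of y0] by blast
  then have "Y \<in> Vp p T" "rde_solution p T X XX F y0 Y"
    by (auto simp: rde_solution_def controlled_def Vp_def)
  then show ?thesis by blast
qed

theorem theorem3p10:
  fixes p T :: real
    and X :: "real \<Rightarrow> real ^ 'd::finite"
    and XX :: "real \<Rightarrow> real \<Rightarrow> real ^ 'd ^ 'd"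
    and F :: "real ^ 'e::finite \<Rightarrow> ((real ^ 'd) \<Rightarrow>\<^sub>L (real ^ 'e))"
    and y0 :: "real ^ 'e"
  assumes "2 \<le> p" and "p < 3" and "0 \<le> T"
    and "rough_path p T X XX"
    and "Cb3 F"
  shows "\<exists>Y\<in>Vp p T. rde_solution p T X XX F y0 Y \<and>
           (\<forall>Z\<in>Vp p T. rde_solution p T X XX F y0 Z \<longrightarrow> (\<forall>t\<in>{0..T}. Z t = Y t))"
proof -
  obtain Y where "Y \<in> Vp p T" and Y: "rde_solution p T X XX F y0 Y"
    using ex_rde_solution[OF assms(4,5,1-3)] by blast
  moreover have "Z t = Y t" if "rde_solution p T X XX F y0 Z" "t \<in> {0..T}" for Z t
    using rde_solution_unique[OF assms(4,5,1-3) that(1) Y, of t] that(2) by simp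
  ultimately show ?thesis by blast
qed

end
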